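(* Let $k\ge 5$ be an odd integer and let $\Gamma$ be a connected amply regular graph with diameter $d\ge 4$ and parameters $(v,k,\lambda,\mu)$, where $\mu=\frac{k-1}{2}$. Let $\Lambda$ be the unique bipartite $(0,2)$-graph with $14$ vertices and valency $4$, which is the point--block incidence graph of the square $2$-$(7,4,2)$ design. Then exactly one of the following holds: (1) $\Gamma$ is the $5$-cube. (2) $\Gamma$ is the graph $K_2\,\square\,\Lambda$, which has diameter $4$ and parameters $(28,5,0,2)$. (3) $\Gamma$ is the point--block incidence graph of a $GDDDP\left(2,k+1;\,k;\,0,\frac{k-1}{2}\right)$. (Here "is" means "is isomorphic to".)
   Context: All graphs are finite, simple and undirected. An amply regular graph with parameters $(v,k,\lambda,\mu)$ is a $k$-regular graph on $v$ vertices such that every pair of adjacent vertices has exactly $\lambda$ common neighbors and every pair of vertices at distance two has exactly $\mu$ common neighbors. A $(0,2)$-graph is a connected graph in which each pair of distinct vertices has either $0$ or $2$ common neighbors. $K_2$ is the complete graph on two vertices. The Cartesian product $\Gamma\,\square\,\Delta$ has vertex set $V(\Gamma)\times V(\Delta)$, with $(x,y)\sim(x',y')$ iff either $x=x'$ and $y\sim y'$, or $x\sim x'$ and $y=y'$. A group divisible design $GDD(n,m;k;\lambda_1,\lambda_2)$ is a triple $(\mathcal P,\mathcal G,\mathcal B)$ consisting of a set $\mathcal P$ of points, a partition $\mathcal G$ of $\mathcal P$ into $m$ subsets of size $n$ (groups), and a collection $\mathcal B$ of $k$-subsets of $\mathcal P$ (blocks), such that each pair of distinct points from the same group appears in exactly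 $\lambda_1$ blocks and each pair of points from different groups appears in exactly $\lambda_2$ blocks. Its dual incidence structure has point set $\mathcal B$ and block set $\mathcal P$, where $p\in\mathcal P$ is identified with the set of blocks $B\in\mathcal B$ containing $p$. If there is a partition $\mathcal G'$ of $\mathcal B$ such that $(\mathcal B,\mathcal G',\mathcal P)$ is a $GDD(n,m;k;\lambda_1,\lambda_2)$ (same parameters), then the design is called a group divisible design with the dual property, denoted $GDDDP(n,m;k;\lambda_1,\lambda_2)$. The point--block incidence graph of an incidence structure has vertex set $\mathcal P\cup\mathcal B$ (disjoint union), with a point and a block adjacent iff they are incident, and no other adjacencies. *)

theory Defs
  imports
    "Graph_Theory.Graph_Theory"
    "HOL-Library.Disjoint_Sets"
    "HOL-Library.Extended_Nat"
begin

text \<open>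
  A finite simple undirected graph is a \<open>pair_graph\<close>: a finite, loopless digraph without
  parallel arcs whose arc relation \<open>parcs\<close> is symmetric, i.e. is the adjacency relation.
\<close>

abbreviation connected_graph :: "'a pair_pre_digraph \<Rightarrow> bool" where
  "connected_graph G \<equiv> Digraph_Component.connected (with_proj G)"

abbreviation graph_iso :: "'a pair_pre_digraph \<Rightarrow> 'b pair_pre_digraph \<Rightarrow> bool" where
  "graph_iso G H \<equiv> digraph_iso (with_proj G) (with_proj H)"

text \<open>For graphs given by adjacency relations, library isomorphism is the usual notion.\<close>

lemma graph_iso_iff:
  assumes G: "pair_wf_digraph G" and H: "pair_wf_digraph H"
  shows "graph_iso G H \<longleftrightarrow>
    (\<exists>f. bij_betw f (pverts G) (pverts H) \<and>
      (\<forall>x\<in>pverts G. \<forall>y\<in>pverts G. (x, y) \<in> parcs G \<longleftrightarrow> (f x, f y) \<in> parcs H))"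
    (is "?L \<longleftrightarrow> ?R")
proof
  assume ?L
  then obtain h where h: "pre_digraph.digraph_isomorphism (with_proj G) h"
    and eq: "with_proj H = app_iso h (with_proj G)"
    by (auto simp: digraph_iso_def)
  define f where "f = iso_verts h"
  have inj: "inj_on f (pverts G)"
    and ends: "\<And>a. a \<in> parcs G \<Longrightarrow> f (fst a) = iso_tail h (iso_arcs h a)
      \<and> f (snd a) = iso_head h (iso_arcs h a)"
    using h by (auto simp: pre_digraph.digraph_isomorphism_def f_def)
  have V: "pverts H = f ` pverts G" and A: "parcs H = iso_arcs h ` parcs G"
    and t: "iso_tail h = fst" and hd: "iso_head h = snd"
    using eq by (simp_all add: with_proj_def app_iso_def f_def)
  have A': "parcs H = map_prod f f ` parcs G"
    unfolding A using ends t hd by (intro image_cong) (auto simp: prod_eq_iff)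
  have "(x, y) \<in> parcs G" if "x \<in> pverts G" "y \<in> pverts G" "(f x, f y) \<in> parcs H" for x y
  proof -
    from that A' obtain x' y' where xy: "(x', y') \<in> parcs G" "f x = f x'" "f y = f y'"
      by auto
    moreover have "x' \<in> pverts G" "y' \<in> pverts G"
      using pair_wf_digraph.wellformed'[OF G] xy(1) by blast+
    ultimately show ?thesis using that inj by (metis inj_onD)
  qed
  moreover have "(f x, f y) \<in> parcs H" if "(x, y) \<in> parcs G" for x y
    using that unfolding A' by force
  ultimately have "\<forall>x\<in>pverts G. \<forall>y\<in>pverts G. (x, y) \<in> parcs G \<longleftrightarrow> (f x, f y) \<in> parcs H"
    by blast
  then show ?R using inj V by (auto simp: bij_betw_def)
next
  assume ?R
  then obtain f where f: "inj_on f (pverts G)" "pverts H = f ` pverts G"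
    and a: "\<And>x y. x \<in> pverts G \<Longrightarrow> y \<in> pverts G \<Longrightarrow>
      (x, y) \<in> parcs G \<longleftrightarrow> (f x, f y) \<in> parcs H"
    by (auto simp: bij_betw_def)
  have wfG: "x \<in> pverts G" "y \<in> pverts G" if "(x, y) \<in> parcs G" for x y
    using pair_wf_digraph.wellformed'[OF G that] by simp_all
  have wfH: "x \<in> pverts H" "y \<in> pverts H" if "(x, y) \<in> parcs H" for x y
    using pair_wf_digraph.wellformed'[OF H that] by simp_all
  define h where
    "h = \<lparr> iso_verts = f, iso_arcs = map_prod f f, iso_head = snd, iso_tail = fst \<rparr>"
  have A: "parcs H = map_prod f f ` parcs G"
  proof (intro equalityI subsetI)
    fix e assume e: "e \<in> parcs H"
    obtain u w where uw: "e = (u, w)" by (cases e)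
    then have "u \<in> f ` pverts G" "w \<in> f ` pverts G" using e wfH f(2) by metis+
    then obtain x y where xy: "x \<in> pverts G" "y \<in> pverts G" "u = f x" "w = f y"
      by (elim imageE)
    then have "(x, y) \<in> parcs G" using e uw a by simp
    then show "e \<in> map_prod f f ` parcs G" unfolding uw xy by (metis image_eqI map_prod_simp)
  next
    fix e assume "e \<in> map_prod f f ` parcs G"
    then obtain x y where xy: "(x, y) \<in> parcs G" "e = (f x, f y)" by auto
    then show "e \<in> parcs H" using a wfG[OF xy(1)] by simp
  qed
  have inj2: "inj_on (map_prod f f) (parcs G)"
  proof (rule inj_onI)
    fix d e assume "d \<in> parcs G" "e \<in> parcs G" "map_prod f f d = map_prod f f e"
    then show "d = e"
      using pair_wf_digraph.arc_fst_in_verts[OF G] pair_wf_digraph.arc_snd_in_verts[OF G]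
        inj_onD[OF f(1)] by (simp add: prod_eq_iff)
  qed
  have wf: "wf_digraph (with_proj G)" using G by (simp add: wf_digraph_wp_iff)
  have "pre_digraph.digraph_isomorphism (with_proj G) h"
    using f(1) inj2 wf by (auto simp: pre_digraph.digraph_isomorphism_def h_def)
  moreover have "with_proj H = app_iso h (with_proj G)"
    using f(2) A by (simp add: with_proj_def app_iso_def h_def)
  ultimately show ?L by (auto simp: digraph_iso_def)
qed

definition neighbors :: "'a pair_pre_digraph \<Rightarrow> 'a \<Rightarrow> 'a set" where
  "neighbors G x = {z. (x, z) \<in> parcs G}"

definition regular_graph :: "'a pair_pre_digraph \<Rightarrow> nat \<Rightarrow> bool" where
  "regular_graph G k \<longleftrightarrow> (\<forall>x\<in>pverts G. card (neighbors G x) = k)"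

text \<open>Vertices in different components are at distance \<open>\<infinity>\<close>, the infimum of the empty set.\<close>

definition graph_distance :: "'a pair_pre_digraph \<Rightarrow> 'a \<Rightarrow> 'a \<Rightarrow> enat" where
  "graph_distance G x y = (INF p\<in>{p. pre_digraph.awalk (with_proj G) x p y}. enat (length p))"

definition graph_diameter :: "'a pair_pre_digraph \<Rightarrow> enat" where
  "graph_diameter G = (SUP x\<in>pverts G. SUP y\<in>pverts G. graph_distance G x y)"

definition amply_regular ::
  "'a pair_pre_digraph \<Rightarrow> nat \<Rightarrow> nat \<Rightarrow> nat \<Rightarrow> nat \<Rightarrow> bool" where
  "amply_regular G v k lam mu \<longleftrightarrow>
     pair_graph G \<and> card (pverts G) = v \<and> regular_graph G k \<and>
     (\<forall>x\<in>pverts G. \<forall>y\<in>pverts G. (x, y) \<in> parcs G \<longrightarrow>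
        card (neighbors G x \<inter> neighbors G y) = lam) \<and>
     (\<forall>x\<in>pverts G. \<forall>y\<in>pverts G. graph_distance G x y = 2 \<longrightarrow>
        card (neighbors G x \<inter> neighbors G y) = mu)"

definition zero_two_graph :: "'a pair_pre_digraph \<Rightarrow> bool" where
  "zero_two_graph G \<longleftrightarrow> pair_graph G \<and> connected_graph G \<and>
     (\<forall>x\<in>pverts G. \<forall>y\<in>pverts G. x \<noteq> y \<longrightarrow>
        card (neighbors G x \<inter> neighbors G y) \<in> {0, 2})"

definition bipartite_graph :: "'a pair_pre_digraph \<Rightarrow> bool" where
  "bipartite_graph G \<longleftrightarrow>
     (\<exists>U W. pverts G = U \<union> W \<and> U \<inter> W = {} \<and> parcs G \<subseteq> U \<times> W \<union> W \<times> U)"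

definition K2_graph :: "bool pair_pre_digraph" where
  "K2_graph = \<lparr> pverts = UNIV, parcs = {(x, y). x \<noteq> y} \<rparr>"

definition cube_graph :: "nat \<Rightarrow> bool list pair_pre_digraph" where
  "cube_graph n =
     \<lparr> pverts = {xs. length xs = n},
       parcs = {(xs, ys). length xs = n \<and> length ys = n \<and>
                  card {i. i < n \<and> xs ! i \<noteq> ys ! i} = 1} \<rparr>"

definition cartesian_graph_product ::
  "'a pair_pre_digraph \<Rightarrow> 'b pair_pre_digraph \<Rightarrow> ('a \<times> 'b) pair_pre_digraph" where
  "cartesian_graph_product G H =
     \<lparr> pverts = pverts G \<times> pverts H,
       parcs = {((x, y), (x', y')).
                  x \<in> pverts G \<and> x = x' \<and> (y, y') \<in> parcs H \<or>
                  (x, x') \<in> parcs G \<and> y \<in> pverts H \<and> y = y'} \<rparr>"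

text \<open>
  The blocks of a design are represented by abstract labels, each identified with the set of
  points incident with it. In this way a point can serve as a block of the dual structure, and
  a collection of blocks may contain the same point set several times.
\<close>

record ('p, 'b) incidence_structure =
  points :: "'p set"
  blocks :: "'b set"
  incident :: "'p \<Rightarrow> 'b \<Rightarrow> bool"

definition points_on :: "('p, 'b) incidence_structure \<Rightarrow> 'b \<Rightarrow> 'p set" where
  "points_on D b = {p \<in> points D. incident D p b}"

definition blocks_through :: "('p, 'b) incidence_structure \<Rightarrow> 'p \<Rightarrow> 'p \<Rightarrow> 'b set" where
  "blocks_through D p q = {b \<in> blocks D. p \<in> points_on D b \<and> q \<in> points_on D b}"

definition dual_structure ::
  "('p, 'b) incidence_structure \<Rightarrow> ('b, 'p) incidence_structure" where
  "dual_structure D =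
     \<lparr> points = blocks D, blocks = points D, incident = (\<lambda>b p. incident D p b) \<rparr>"

definition incidence_graph ::
  "('p, 'b) incidence_structure \<Rightarrow> ('p + 'b) pair_pre_digraph" where
  "incidence_graph D =
     \<lparr> pverts = points D <+> blocks D,
       parcs = {(Inl p, Inr b) | p b. p \<in> points D \<and> b \<in> blocks D \<and> incident D p b} \<union>
               {(Inr b, Inl p) | p b. p \<in> points D \<and> b \<in> blocks D \<and> incident D p b} \<rparr>"

definition square_2_design ::
  "('p, 'b) incidence_structure \<Rightarrow> nat \<Rightarrow> nat \<Rightarrow> nat \<Rightarrow> bool" where
  "square_2_design D v k lam \<longleftrightarrow>
     finite (points D) \<and> finite (blocks D) \<and>
     card (points D) = v \<and> card (blocks D) = v \<and>
     (\<forall>b\<in>blocks D. card (points_on D b) = k) \<and>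
     (\<forall>p\<in>points D. \<forall>q\<in>points D. p \<noteq> q \<longrightarrow> card (blocks_through D p q) = lam)"

text \<open>\<open>GDD D \<G> n m k l1 l2\<close>: \<open>D\<close> with the groups \<open>\<G>\<close> is a \<open>GDD(n, m; k; l1, l2)\<close>.\<close>

definition GDD ::
  "('p, 'b) incidence_structure \<Rightarrow> 'p set set \<Rightarrow> nat \<Rightarrow> nat \<Rightarrow> nat \<Rightarrow> nat \<Rightarrow> nat \<Rightarrow> bool" where
  "GDD D \<G> n m k l1 l2 \<longleftrightarrow>
     finite (points D) \<and> finite (blocks D) \<and>
     partition_on (points D) \<G> \<and> card \<G> = m \<and> (\<forall>S\<in>\<G>. card S = n) \<and>
     (\<forall>b\<in>blocks D. card (points_on D b) = k) \<and>
     (\<forall>S\<in>\<G>. \<forall>p\<in>S. \<forall>q\<in>S. p \<noteq> q \<longrightarrow> card (blocks_through D p q) = l1) \<and>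
     (\<forall>S\<in>\<G>. \<forall>T\<in>\<G>. S \<noteq> T \<longrightarrow> (\<forall>p\<in>S. \<forall>q\<in>T. card (blocks_through D p q) = l2))"

definition GDDDP ::
  "('p, 'b) incidence_structure \<Rightarrow> 'p set set \<Rightarrow> nat \<Rightarrow> nat \<Rightarrow> nat \<Rightarrow> nat \<Rightarrow> nat \<Rightarrow> bool" where
  "GDDDP D \<G> n m k l1 l2 \<longleftrightarrow>
     GDD D \<G> n m k l1 l2 \<and> (\<exists>\<G>'. GDD (dual_structure D) \<G>' n m k l1 l2)"

definition exactly_one_of_three :: "bool \<Rightarrow> bool \<Rightarrow> bool \<Rightarrow> bool" where
  "exactly_one_of_three A B C \<longleftrightarrow>
     (A \<or> B \<or> C) \<and> \<not> (A \<and> B) \<and> \<not> (A \<and> C) \<and> \<not> (B \<and> C)"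

end

theory Submission
  imports Defs
begin

text \<open>
  Let \<open>x\<close> and \<open>y\<close> be at distance four. As \<open>k = 2\<mu> + 1\<close>, a vertex \<open>m\<close> at distance two from both
  has \<open>\<mu>\<close> neighbours next to \<open>x\<close>, \<open>\<mu>\<close> next to \<open>y\<close> and exactly one more, \<open>w(m)\<close>. Counting edges
  around \<open>m\<close> forces \<open>\<lambda> = 0\<close>. Counting edges around a neighbour \<open>p\<close> of \<open>x\<close> that has neighbours in
  the set \<open>M\<close> of all such \<open>m\<close> shows that \<open>p\<close> has \<open>2\<mu>\<close> or \<open>\<mu> + 1\<close> of them, the latter only if
  \<open>\<mu> = 2\<close>. If \<open>2\<mu>\<close> is the only value, the vertices \<open>w(m)\<close> reduce to two and \<open>\<Gamma>\<close> is bipartite with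
  halves of size \<open>2k + 2\<close>, in which every vertex has a unique mate without common neighbours: a
  group divisible design. If \<open>k = 5\<close>, the vertices at distance two from \<open>x\<close> correspond to the pairs
  of neighbours of \<open>x\<close>, and \<open>M\<close> is the edge set of a graph on four or five neighbours of \<open>x\<close> with
  all degrees 3 or 4. The complete graph on four vertices gives the 5-cube, and the complete graph
  on five vertices minus two disjoint edges gives \<open>K\<^sub>2 \<box> \<Lambda>\<close>; removing one edge is impossible.
\<close>

section \<open>Walks, distances and isomorphisms\<close>

text \<open>The diameter is only bounded from below, so nothing global is known at the start. Each
  case therefore ends with an explicit set of vertices around x and y that is closed under taking
  neighbours, and connectivity makes it the whole graph. The recurring tool for identifying vertices
  is that distinct vertices have at most \<mu> common neighbours; for \<mu> = 2, three common
  neighbours force equality. For \<mu> = 2 a vertex at distance two from x is determined by its two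
  neighbours next to x, which is where the graph on the neighbours of x comes from. Seen from y, the
  same set M is the edge set of a second graph, and most of the work for k = 5 consists in matching
  the two descriptions. The link is the map w, which is symmetric in x and y: its fibres are the
  same partition of M from both sides. The three outcomes exclude each other by their numbers of
  vertices.\<close>

definition walk_le :: "'a pair_pre_digraph \<Rightarrow> nat \<Rightarrow> 'a \<Rightarrow> 'a \<Rightarrow> bool" where
  "walk_le G n x y \<longleftrightarrow> (\<exists>m\<le>n. (x, y) \<in> parcs G ^^ m)"

lemma walk_le_0: "walk_le G 0 x y \<longleftrightarrow> x = y"
  by (auto simp: walk_le_def)

lemma walk_le_refl: "walk_le G n x x"
  unfolding walk_le_def by (intro exI[of _ 0]) simp

lemma walk_le_mono: "walk_le G m x y \<Longrightarrow> m \<le> n \<Longrightarrow> walk_le G n x y"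
  unfolding walk_le_def by (meson order_trans)

lemma walk_le_step:
  assumes "walk_le G n x z" "y \<in> neighbors G z"
  shows "walk_le G (Suc n) x y"
proof -
  obtain m where "m \<le> n" "(x, z) \<in> parcs G ^^ m" using assms(1) unfolding walk_le_def by blast
  moreover have "(z, y) \<in> parcs G" using assms(2) unfolding neighbors_def by simp
  ultimately have "Suc m \<le> Suc n" "(x, y) \<in> parcs G ^^ Suc m" by auto
  then show ?thesis unfolding walk_le_def by blast
qed

lemma walk_le_SucE:
  assumes "walk_le G (Suc n) x y"
  obtains "x = y" | z where "walk_le G n x z" "y \<in> neighbors G z"
proof -
  obtain m where m: "m \<le> Suc n" "(x, y) \<in> parcs G ^^ m" using assms unfolding walk_le_def by blast
  show thesis
  proof (cases m)
    case 0
    then show thesis using m that(1) by simp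
  next
    case (Suc m')
    then obtain z where "(x, z) \<in> parcs G ^^ m'" "(z, y) \<in> parcs G" using m(2) by auto
    then show thesis using that(2)[of z] m(1) Suc unfolding walk_le_def neighbors_def by auto
  qed
qed

lemma walk_le_Suc: "walk_le G (Suc n) x y \<longleftrightarrow> x = y \<or> (\<exists>z. walk_le G n x z \<and> y \<in> neighbors G z)"
  using walk_le_SucE[of G n x y] walk_le_step[of G n x] walk_le_refl[of G "Suc n"] by metis

lemma walk_le_Suc_front:
  "walk_le G (Suc n) x y \<longleftrightarrow> x = y \<or> (\<exists>z\<in>neighbors G x. walk_le G n z y)"
proof
  assume "walk_le G (Suc n) x y"
  then obtain m where m: "m \<le> Suc n" "(x, y) \<in> parcs G ^^ m" unfolding walk_le_def by blast
  show "x = y \<or> (\<exists>z\<in>neighbors G x. walk_le G n z y)"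
  proof (cases m)
    case 0
    then show ?thesis using m by simp
  next
    case (Suc m')
    then obtain z where "(x, z) \<in> parcs G" "(z, y) \<in> parcs G ^^ m'" using m(2) by (metis relpow_Suc_D2)
    then show ?thesis using m(1) Suc unfolding walk_le_def neighbors_def by auto
  qed
next
  assume "x = y \<or> (\<exists>z\<in>neighbors G x. walk_le G n z y)"
  then show "walk_le G (Suc n) x y"
  proof
    assume "\<exists>z\<in>neighbors G x. walk_le G n z y"
    then obtain z m where "(x, z) \<in> parcs G" "m \<le> n" "(z, y) \<in> parcs G ^^ m"
      unfolding walk_le_def neighbors_def by blast
    then have "Suc m \<le> Suc n" "(x, y) \<in> parcs G ^^ Suc m"
      using relpow_Suc_I2 by (simp, metis)
    then show ?thesis unfolding walk_le_def by blast
  qed (simp add: walk_le_refl)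
qed

text \<open>The hypothesis on \<open>x\<close> matters for \<open>n = 0\<close>: an empty walk has
  to start in a vertex, whereas the zeroth power relates everything to itself.\<close>

lemma awalk_relpow:
  assumes "pair_wf_digraph G" "x \<in> pverts G"
  shows "(\<exists>p. pre_digraph.awalk (with_proj G) x p y \<and> length p = n) \<longleftrightarrow> (x, y) \<in> parcs G ^^ n"
  using assms(2)
proof (induction n arbitrary: x)
  case 0
  interpret pair_wf_digraph G by fact
  show ?case using 0 by (auto simp: awalk_Nil_iff)
next
  case (Suc n)
  interpret pair_wf_digraph G by fact
  show ?case
  proof
    assume "\<exists>p. awalk x p y \<and> length p = Suc n"
    then obtain e es where p: "awalk x (e # es) y" "length es = n" by (auto simp: length_Suc_conv)
    then have e: "e \<in> parcs G" "fst e = x" "awalk (snd e) es y" by (simp_all add: awalk_Cons_iff)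
    then have "(snd e, y) \<in> parcs G ^^ n" using Suc.IH[of "snd e"] p(2) arc_snd_in_verts by metis
    moreover have "(x, snd e) \<in> parcs G" using e(1,2) by (cases e) simp
    ultimately show "(x, y) \<in> parcs G ^^ Suc n" by (rule relpow_Suc_I2[rotated])
  next
    assume "(x, y) \<in> parcs G ^^ Suc n"
    then obtain z where z: "(x, z) \<in> parcs G" "(z, y) \<in> parcs G ^^ n" by (meson relpow_Suc_D2)
    then obtain p where "awalk z p y" "length p = n" using Suc.IH[of z] in_arcsD2 by metis
    then have "awalk x ((x, z) # p) y \<and> length ((x, z) # p) = Suc n"
      using z(1) by (simp add: awalk_Cons_iff)
    then show "\<exists>p. awalk x p y \<and> length p = Suc n" by (rule exI)
  qed
qed

lemma distance_le_iff:
  assumes "pair_wf_digraph G" "x \<in> pverts G"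
  shows "graph_distance G x y \<le> enat n \<longleftrightarrow> walk_le G n x y"
proof
  let ?S = "(\<lambda>p. enat (length p)) ` {p. pre_digraph.awalk (with_proj G) x p y}"
  assume le: "graph_distance G x y \<le> enat n"
  have "?S \<noteq> {}"
  proof
    assume "?S = {}"
    then have "graph_distance G x y = \<infinity>" unfolding graph_distance_def by (simp add: Inf_enat_def)
    then show False using le by simp
  qed
  \<comment> \<open>\<open>enat\<close> is well-ordered, so the infimum of a nonempty set of lengths
    is attained by an actual walk.\<close>
  then have "Inf ?S \<in> ?S" by (metis ex_in_conv wellorder_InfI)
  then obtain p where "pre_digraph.awalk (with_proj G) x p y" "graph_distance G x y = enat (length p)"
    unfolding graph_distance_def by auto
  then show "walk_le G n x y" using le awalk_relpow[OF assms, of y "length p"] unfolding walk_le_def by auto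
next
  assume "walk_le G n x y"
  then obtain m where m: "m \<le> n" "(x, y) \<in> parcs G ^^ m" unfolding walk_le_def by (elim exE conjE)
  obtain p where p: "pre_digraph.awalk (with_proj G) x p y" "length p \<le> n"
    using iffD2[OF awalk_relpow[OF assms] m(2)] m(1) by (elim exE conjE) simp
  have "graph_distance G x y \<le> enat (length p)"
    unfolding graph_distance_def using p(1) by (intro INF_lower) simp
  then show "graph_distance G x y \<le> enat n" using p(2) by (meson enat_ord_simps(1) order_trans)
qed

lemma distance_eq_2_iff:
  assumes "pair_wf_digraph G" "x \<in> pverts G"
  shows "graph_distance G x y = 2 \<longleftrightarrow>
    y \<noteq> x \<and> y \<notin> neighbors G x \<and> (\<exists>z\<in>neighbors G x. y \<in> neighbors G z)"
proof -
  have "graph_distance G x y = 2 \<longleftrightarrow> graph_distance G x y \<le> enat 2 \<and> \<not> graph_distance G x y \<le> enat 1"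
    by (cases "graph_distance G x y") (auto simp: numeral_eq_enat one_enat_def)
  then show ?thesis unfolding distance_le_iff[OF assms]
    by (auto simp: numeral_2_eq_2 walk_le_Suc_front walk_le_0)
qed

lemma pair_graphI:
  assumes "finite (pverts G)" "parcs G \<subseteq> pverts G \<times> pverts G" "sym (parcs G)" "irrefl (parcs G)"
  shows "pair_graph G"
proof -
  have "finite (parcs G)" using assms(1,2) finite_subset by blast
  then show ?thesis using assms
    by unfold_locales (auto simp: irrefl_def symmetric_def)
qed

lemma pair_graphD:
  assumes "pair_graph G"
  shows "finite (pverts G)" "pair_wf_digraph G" "y \<in> neighbors G x \<Longrightarrow> y \<in> pverts G"
    "y \<in> neighbors G x \<Longrightarrow> x \<in> pverts G" "y \<in> neighbors G x \<longleftrightarrow> x \<in> neighbors G y"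
    "x \<notin> neighbors G x" "finite (neighbors G x)"
proof -
  interpret pair_graph G by fact
  show "finite (pverts G)" by (rule pair_finite_verts)
  show "pair_wf_digraph G" by unfold_locales
  show 1: "y \<in> neighbors G x \<Longrightarrow> y \<in> pverts G" for y unfolding neighbors_def using in_arcsD2 by auto
  show "y \<in> neighbors G x \<Longrightarrow> x \<in> pverts G" unfolding neighbors_def using in_arcsD1 by auto
  show "y \<in> neighbors G x \<longleftrightarrow> x \<in> neighbors G y"
    unfolding neighbors_def using pair_sym_arcs by (auto simp: symmetric_def dest: symD)
  show "x \<notin> neighbors G x" unfolding neighbors_def using pair_no_loops by force
  show "finite (neighbors G x)" using 1 finite_subset[OF _ pair_finite_verts] by blast
qed

text \<open>The form in which connectivity enters the classification: a set of vertices is shown to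
  be everything by checking that no arc leaves it.\<close>

lemma connected_closure:
  assumes G: "pair_graph G" and con: "connected_graph G"
    and S: "S \<noteq> {}" "S \<subseteq> pverts G" "\<And>s. s \<in> S \<Longrightarrow> neighbors G s \<subseteq> S"
  shows "S = pverts G"
proof -
  interpret pair_graph G by fact
  obtain s where s: "s \<in> S" using S by blast
  have "v \<in> S" if "v \<in> pverts G" for v
  proof -
    have "(s, v) \<in> rtrancl_on (pverts G) ((parcs G)\<^sup>s)"
      using con s S(2) that unfolding connected_conv by auto
    moreover have "(parcs G)\<^sup>s = parcs G"
      using pair_sym_arcs by (auto simp: symcl_def symmetric_def dest: symD)
    ultimately have "(s, v) \<in> rtrancl_on (pverts G) (parcs G)" by simp
    then show ?thesis
    proof (induction rule: rtrancl_on_induct)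
      case (step y z)
      then show ?case using S(3)[of y] unfolding neighbors_def by blast
    qed (rule s)
  qed
  then show ?thesis using S(2) by blast
qed

lemma walk_le_rtrancl_on:
  assumes "pair_wf_digraph G" "x \<in> pverts G" "walk_le G n x y"
  shows "(x, y) \<in> rtrancl_on (pverts G) (parcs G)"
  using assms(3)
proof (induction n arbitrary: y)
  case 0
  then show ?case using assms(2) by (simp add: walk_le_0)
next
  case (Suc n)
  show ?case
  proof (rule walk_le_SucE[OF Suc.prems])
    assume "x = y"
    then show ?thesis using assms(2) by simp
  next
    fix z assume z: "walk_le G n x z" "y \<in> neighbors G z"
    then have zy: "(z, y) \<in> parcs G" by (simp add: neighbors_def)
    then have "y \<in> pverts G" by (rule pair_wf_digraph.in_arcsD2[OF assms(1)])
    then show ?thesis using Suc.IH[OF z(1)] zy by (metis rtrancl_on_into_rtrancl_on)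
  qed
qed

lemma connectedI:
  assumes G: "pair_graph G" and ne: "pverts G \<noteq> {}"
    and w: "\<And>x y. x \<in> pverts G \<Longrightarrow> y \<in> pverts G \<Longrightarrow> walk_le G n x y"
  shows "connected_graph G"
proof -
  interpret pair_graph G by fact
  have s: "(parcs G)\<^sup>s = parcs G"
    using pair_sym_arcs by (auto simp: symcl_def symmetric_def dest: symD)
  have "(x, y) \<in> rtrancl_on (pverts G) (parcs G)" if "x \<in> pverts G" "y \<in> pverts G" for x y
    using walk_le_rtrancl_on[OF pair_graphD(2)[OF G] that(1) w[OF that]] .
  then show ?thesis unfolding connected_conv using ne s by simp
qed

section \<open>Isomorphisms and what they preserve\<close>

lemma graph_iso_sym:
  assumes "pair_wf_digraph G" "pair_wf_digraph H" "graph_iso G H"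
  shows "graph_iso H G"
proof -
  obtain f where f: "bij_betw f (pverts G) (pverts H)"
    "\<And>x y. x \<in> pverts G \<Longrightarrow> y \<in> pverts G \<Longrightarrow> (x, y) \<in> parcs G \<longleftrightarrow> (f x, f y) \<in> parcs H"
    using assms by (auto simp: graph_iso_iff)
  let ?g = "inv_into (pverts G) f"
  have "bij_betw ?g (pverts H) (pverts G)" using f(1) by (rule bij_betw_inv_into)
  moreover have "(x, y) \<in> parcs H \<longleftrightarrow> (?g x, ?g y) \<in> parcs G" if "x \<in> pverts H" "y \<in> pverts H" for x y
  proof -
    have "f (?g x) = x" "f (?g y) = y" "?g x \<in> pverts G" "?g y \<in> pverts G"
      using that f(1) by (auto simp: bij_betw_def f_inv_into_f inv_into_into)
    then show ?thesis using f(2)[of "?g x" "?g y"] by simp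
  qed
  ultimately show ?thesis using assms by (auto simp: graph_iso_iff)
qed

text \<open>Explicit graphs are given by neighbour lists, so neighbourhoods are compared instead of
  arcs; injectivity of \<open>f\<close> turns this back into a statement on single arcs.\<close>

lemma graph_isoI:
  assumes G: "pair_wf_digraph G" and H: "pair_wf_digraph H"
    and f: "bij_betw f (pverts H) (pverts G)"
    and nbr: "\<And>u. u \<in> pverts H \<Longrightarrow> neighbors G (f u) = f ` neighbors H u"
  shows "graph_iso G H" "graph_iso H G"
proof -
  have inj: "inj_on f (pverts H)" using f by (simp add: bij_betw_def)
  have "(x, y) \<in> parcs H \<longleftrightarrow> (f x, f y) \<in> parcs G" if xy: "x \<in> pverts H" "y \<in> pverts H" for x y
  proof -
    have sub: "neighbors H x \<subseteq> pverts H"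
      unfolding neighbors_def using pair_wf_digraph.in_arcsD2[OF H] by blast
    have "(f x, f y) \<in> parcs G \<longleftrightarrow> f y \<in> f ` neighbors H x"
      using nbr[OF xy(1)] unfolding neighbors_def by blast
    also have "\<dots> \<longleftrightarrow> y \<in> neighbors H x" using inj xy(2) sub by (rule inj_on_image_mem_iff)
    finally show ?thesis unfolding neighbors_def by simp
  qed
  then show iso: "graph_iso H G" using f G H by (auto simp: graph_iso_iff)
  show "graph_iso G H" by (rule graph_iso_sym[OF H G iso])
qed

lemma graph_iso_card:
  assumes "pair_wf_digraph G" "pair_wf_digraph H" "graph_iso G H"
  shows "card (pverts G) = card (pverts H)"
  using assms by (auto simp: graph_iso_iff intro: bij_betw_same_card)

lemma graph_iso_regular:
  assumes G: "pair_wf_digraph G" and H: "pair_wf_digraph H" and iso: "graph_iso G H"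
    and r: "regular_graph G k"
  shows "regular_graph H k"
proof -
  obtain f where f: "bij_betw f (pverts G) (pverts H)"
    and a: "\<And>x y. x \<in> pverts G \<Longrightarrow> y \<in> pverts G \<Longrightarrow> (x, y) \<in> parcs G \<longleftrightarrow> (f x, f y) \<in> parcs H"
    using assms by (auto simp: graph_iso_iff)
  show ?thesis unfolding regular_graph_def
  proof
    fix v assume "v \<in> pverts H"
    then obtain x where x: "x \<in> pverts G" "v = f x" using f by (auto simp: bij_betw_def)
    have "bij_betw f (neighbors G x) (neighbors H v)" unfolding bij_betw_def
    proof
      have sub: "neighbors G x \<subseteq> pverts G"
        unfolding neighbors_def using pair_wf_digraph.in_arcsD2[OF G] by blast
      then show "inj_on f (neighbors G x)" using f inj_on_subset by (auto simp: bij_betw_def)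
      show "f ` neighbors G x = neighbors H v"
      proof (intro equalityI subsetI)
        fix z assume "z \<in> neighbors H v"
        then have z: "(f x, z) \<in> parcs H" unfolding neighbors_def x(2) by simp
        then have "z \<in> pverts H" using pair_wf_digraph.in_arcsD2[OF H] by blast
        then obtain y where y: "y \<in> pverts G" "z = f y" using f by (auto simp: bij_betw_def)
        then show "z \<in> f ` neighbors G x" using a[OF x(1) y(1)] z unfolding neighbors_def by blast
      qed (use sub a x in \<open>auto simp: neighbors_def\<close>)
    qed
    then show "card (neighbors H v) = k"
      using r x(1) unfolding regular_graph_def by (metis bij_betw_same_card)
  qed
qed

section \<open>The graph \<open>\<Lambda>\<close>\<close>

text \<open>
  The vertex 0 has the neighbours 1 to 4; the points 5 to 10 are the pairs 12, 13, 14, 23, 24, 34,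
  and the blocks 11, 12, 13 consist of the pairs outside \<open>{12, 34}\<close>, \<open>{13, 24}\<close>, \<open>{14, 23}\<close>.
\<close>

definition lam_nbrs :: "nat \<Rightarrow> nat list" where
  "lam_nbrs i = [[1, 2, 3, 4], [0, 5, 6, 7], [0, 5, 8, 9], [0, 6, 8, 10], [0, 7, 9, 10],
    [1, 2, 12, 13], [1, 3, 11, 13], [1, 4, 11, 12], [2, 3, 11, 12], [2, 4, 11, 13], [3, 4, 12, 13],
    [6, 7, 8, 9], [5, 10, 7, 8], [5, 10, 6, 9]] ! i"

text \<open>One colour class of the bipartition. Vertex 0 counts as a point and its neighbours 1 to
  4 as blocks.\<close>

definition lam_point :: "nat \<Rightarrow> bool" where
  "lam_point i \<longleftrightarrow> i = 0 \<or> 5 \<le> i \<and> i \<le> 10"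

lemma less_14_cases:
  assumes "i < (14::nat)"
  shows "i \<in> {0, 1, 2, 3, 4, 5, 6, 7, 8, 9, 10, 11, 12, 13}"
  using assms by (simp, presburger)

lemma lam_nbrs_props:
  assumes "i < 14"
  shows "distinct (lam_nbrs i)" "length (lam_nbrs i) = 4"
    "j \<in> set (lam_nbrs i) \<Longrightarrow> j < 14 \<and> i \<in> set (lam_nbrs j) \<and> (lam_point i \<longleftrightarrow> \<not> lam_point j)"
  using less_14_cases[OF assms] unfolding lam_nbrs_def lam_point_def
  by (elim insertE emptyE; simp; fail | elim insertE emptyE; force)+

text \<open>A finite check that covers the design axiom, its dual and bipartiteness at once.\<close>

lemma lam_nbrs_common:
  assumes "i < 14" "j < 14" "i \<noteq> j"
  shows "card (set (lam_nbrs i) \<inter> set (lam_nbrs j)) = (if lam_point i \<longleftrightarrow> lam_point j then 2 else 0)"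
  using less_14_cases[OF assms(1)] less_14_cases[OF assms(2)] assms(3)
  unfolding lam_nbrs_def lam_point_def
  by (elim insertE emptyE; simp add: Int_insert_left)

definition Lam :: "nat pair_pre_digraph" where
  "Lam = \<lparr> pverts = {..<14}, parcs = {(i, j). i < 14 \<and> j \<in> set (lam_nbrs i)} \<rparr>"

lemma pverts_Lam [simp]: "pverts Lam = {..<14}"
  by (simp add: Lam_def)

lemma neighbors_Lam: "neighbors Lam i = (if i < 14 then set (lam_nbrs i) else {})"
  by (auto simp: neighbors_def Lam_def)

lemma pair_graph_Lam: "pair_graph Lam"
proof (rule pair_graphI)
  show "parcs Lam \<subseteq> pverts Lam \<times> pverts Lam" "sym (parcs Lam)" "irrefl (parcs Lam)"
    unfolding Lam_def using lam_nbrs_props(3) by (auto simp: sym_def irrefl_def)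
qed simp

lemma regular_Lam: "regular_graph Lam 4"
  unfolding regular_graph_def neighbors_Lam using lam_nbrs_props(1,2) by (simp add: distinct_card)

lemma bipartite_Lam: "bipartite_graph Lam"
  unfolding bipartite_graph_def
proof (intro exI conjI)
  show "pverts Lam = {i \<in> {..<14}. lam_point i} \<union> {i \<in> {..<14}. \<not> lam_point i}" by auto
  show "parcs Lam \<subseteq> {i \<in> {..<14}. lam_point i} \<times> {i \<in> {..<14}. \<not> lam_point i} \<union>
      {i \<in> {..<14}. \<not> lam_point i} \<times> {i \<in> {..<14}. lam_point i}"
    unfolding Lam_def using lam_nbrs_props(3) by auto
qed auto

lemma walk_le_Lam_same:
  assumes "i < 14" "j < 14" "lam_point i \<longleftrightarrow> lam_point j"
  shows "walk_le Lam 2 i j"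
proof (cases "i = j")
  case False
  then have "card (set (lam_nbrs i) \<inter> set (lam_nbrs j)) = 2" using lam_nbrs_common assms by simp
  then have "set (lam_nbrs i) \<inter> set (lam_nbrs j) \<noteq> {}" by auto
  then obtain z where z: "z \<in> set (lam_nbrs i)" "z \<in> set (lam_nbrs j)" by blast
  then have "z < 14" "j \<in> set (lam_nbrs z)"
    using lam_nbrs_props(3)[OF assms(1) z(1)] lam_nbrs_props(3)[OF assms(2) z(2)] by simp_all
  then have "z \<in> neighbors Lam i" "j \<in> neighbors Lam z"
    using z assms by (auto simp: neighbors_Lam)
  then show ?thesis
    by (metis numeral_2_eq_2 walk_le_refl walk_le_step)
qed (simp add: walk_le_refl)

lemma walk_le_Lam:
  assumes "i < 14" "j < 14"
  shows "walk_le Lam 3 i j"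
proof (cases "lam_point i \<longleftrightarrow> lam_point j")
  case True
  then show ?thesis using walk_le_Lam_same assms walk_le_mono by (metis eval_nat_numeral(3) le_add2 numeral_3_eq_3 plus_1_eq_Suc)
next
  case False
  obtain z where z: "z \<in> set (lam_nbrs j)" using lam_nbrs_props(2)[OF assms(2)] by (metis length_0_conv last_in_set zero_neq_numeral)
  then have z': "z < 14" "j \<in> set (lam_nbrs z)" "lam_point i \<longleftrightarrow> lam_point z"
    using lam_nbrs_props(3)[OF assms(2)] False by auto
  have "j \<in> neighbors Lam z" using z' by (simp add: neighbors_Lam)
  then show ?thesis
    using walk_le_Lam_same[OF assms(1) z'(1,3)] by (metis eval_nat_numeral(3) walk_le_step)
qed

lemma connected_Lam: "connected_graph Lam"
  by (rule connectedI[OF pair_graph_Lam, of 3]) (use walk_le_Lam in \<open>auto simp: lessThan_empty_iff\<close>)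

lemma zero_two_Lam: "zero_two_graph Lam"
  unfolding zero_two_graph_def
  using pair_graph_Lam connected_Lam lam_nbrs_common by (auto simp: neighbors_Lam)

section \<open>The product of an edge with \<open>Lam\<close>\<close>

definition KLam :: "(bool \<times> nat) pair_pre_digraph" where
  "KLam = cartesian_graph_product K2_graph Lam"

lemma pverts_KLam: "pverts KLam = UNIV \<times> {..<14}"
  by (simp add: KLam_def cartesian_graph_product_def K2_graph_def)

lemma neighbors_KLam:
  "i < 14 \<Longrightarrow> neighbors KLam (t, i) = insert (\<not> t, i) (Pair t ` set (lam_nbrs i))"
  unfolding neighbors_def KLam_def cartesian_graph_product_def K2_graph_def Lam_def by auto

lemma pair_graph_KLam: "pair_graph KLam"
proof (rule pair_graphI)
  show "parcs KLam \<subseteq> pverts KLam \<times> pverts KLam" "sym (parcs KLam)" "irrefl (parcs KLam)"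
    unfolding KLam_def cartesian_graph_product_def K2_graph_def Lam_def
    using lam_nbrs_props(3) by (auto simp: sym_def irrefl_def)
qed (simp add: pverts_KLam)

text \<open>Inside a layer everything is inherited from \<open>Lam\<close>. Across the layers a
  common neighbour has to copy one coordinate of each vertex, so the only candidates are
  \<open>(t, j)\<close> and \<open>(s, i)\<close>, and both require an edge between \<open>i\<close>
  and \<open>j\<close>.\<close>

lemma KLam_common:
  assumes "i < 14" "j < 14" "(t, i) \<noteq> (s, j)"
  shows "card (neighbors KLam (t, i) \<inter> neighbors KLam (s, j)) =
    (if t = s then if lam_point i \<longleftrightarrow> lam_point j then 2 else 0
     else if j \<in> set (lam_nbrs i) then 2 else 0)"
proof (cases "t = s")
  case True
  then have "i \<noteq> j" using assms by simp
  then have "neighbors KLam (t, i) \<inter> neighbors KLam (s, j) = Pair t ` (set (lam_nbrs i) \<inter> set (lam_nbrs j))"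
    using assms True by (auto simp: neighbors_KLam)
  then show ?thesis using lam_nbrs_common[OF assms(1,2) \<open>i \<noteq> j\<close>] True
    by (simp add: card_image inj_on_def)
next
  case False
  have sym: "i \<in> set (lam_nbrs j) \<longleftrightarrow> j \<in> set (lam_nbrs i)" using lam_nbrs_props(3) assms(1,2) by blast
  have irr: "j \<notin> set (lam_nbrs j)" using lam_nbrs_props(3)[OF assms(2), of j] by blast
  have "neighbors KLam (t, i) \<inter> neighbors KLam (s, j) = (if j \<in> set (lam_nbrs i) then {(t, j), (s, i)} else {})"
    using assms(1,2) False sym irr by (cases t; cases s) (auto simp: neighbors_KLam)
  then show ?thesis using False by simp
qed

lemma regular_KLam: "regular_graph KLam 5"
  unfolding regular_graph_def
proof
  fix v assume "v \<in> pverts KLam"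
  then obtain t i where v: "v = (t, i)" "i < 14" by (auto simp: pverts_KLam)
  have "card (Pair t ` set (lam_nbrs i)) = 4"
    using lam_nbrs_props(1,2)[OF v(2)] by (simp add: card_image inj_on_def distinct_card)
  then show "card (neighbors KLam v) = 5" using v by (subst v, subst neighbors_KLam) (auto simp: card_insert_if)
qed

lemma amply_regular_KLam: "amply_regular KLam 28 5 0 2"
  unfolding amply_regular_def
proof (intro conjI ballI impI)
  show "pair_graph KLam" by (rule pair_graph_KLam)
  show "card (pverts KLam) = 28" by (simp add: pverts_KLam card_cartesian_product card_UNIV_bool)
  show "regular_graph KLam 5" by (rule regular_KLam)
next
  fix x y assume xy: "x \<in> pverts KLam" "y \<in> pverts KLam" "(x, y) \<in> parcs KLam"
  then obtain t i s j where v: "x = (t, i)" "i < 14" "y = (s, j)" "j < 14" by (auto simp: pverts_KLam)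
  have "y \<in> neighbors KLam x" using xy unfolding neighbors_def by simp
  then have "s = (\<not> t) \<and> j = i \<or> s = t \<and> j \<in> set (lam_nbrs i)"
    using v by (auto simp: neighbors_KLam)
  moreover from this have "(t, i) \<noteq> (s, j)" "i \<notin> set (lam_nbrs i)"
    using lam_nbrs_props(3)[OF v(2)] by blast+
  moreover note KLam_common[OF v(2,4) this(1)] lam_nbrs_props(3)[OF v(2), of j]
  ultimately show "card (neighbors KLam x \<inter> neighbors KLam y) = 0" unfolding v by auto
next
  fix x y assume xy: "x \<in> pverts KLam" "y \<in> pverts KLam" "graph_distance KLam x y = 2"
  then obtain t i s j where v: "x = (t, i)" "i < 14" "y = (s, j)" "j < 14" by (auto simp: pverts_KLam)
  have d: "y \<noteq> x" "y \<notin> neighbors KLam x" "\<exists>z\<in>neighbors KLam x. y \<in> neighbors KLam z"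
    using xy distance_eq_2_iff[OF pair_graphD(2)[OF pair_graph_KLam]] by auto
  then have "neighbors KLam x \<inter> neighbors KLam y \<noteq> {}"
    using pair_graphD(5)[OF pair_graph_KLam] by blast
  then have "card (neighbors KLam x \<inter> neighbors KLam y) \<noteq> 0"
    using pair_graphD(7)[OF pair_graph_KLam] by simp
  then show "card (neighbors KLam x \<inter> neighbors KLam y) = 2"
    using KLam_common[of i j t s] v d(1) by (auto split: if_splits)
qed

lemma walk_le_KLam_layer:
  "walk_le Lam n i j \<Longrightarrow> i < 14 \<Longrightarrow> walk_le KLam n (t, i) (t, j)"
proof (induction n arbitrary: j)
  case (Suc n)
  from Suc.prems(1) show ?case
  proof (rule walk_le_SucE)
    fix z assume z: "walk_le Lam n i z" "j \<in> neighbors Lam z"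
    then have "(t, j) \<in> neighbors KLam (t, z)"
      by (auto simp: neighbors_Lam neighbors_KLam split: if_splits)
    then show ?thesis using Suc.IH[OF z(1) Suc.prems(2)] by (rule walk_le_step[rotated])
  qed (simp add: walk_le_refl)
qed (simp add: walk_le_0)

lemma diameter_KLam: "graph_diameter KLam = 4"
proof (rule antisym)
  note wf = pair_graphD(2)[OF pair_graph_KLam]
  have "graph_distance KLam x y \<le> enat 4" if xy: "x \<in> pverts KLam" "y \<in> pverts KLam" for x y
  proof -
    obtain t i s j where v: "x = (t, i)" "i < 14" "y = (s, j)" "j < 14"
      using xy by (auto simp: pverts_KLam)
    have w: "walk_le KLam 3 (t, i) (t, j)" using walk_le_KLam_layer walk_le_Lam v by blast
    have "walk_le KLam 4 (t, i) (s, j)"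
    proof (cases "s = t")
      case True
      then show ?thesis using walk_le_mono[OF w, of 4] by simp
    next
      case False
      then have "(s, j) \<in> neighbors KLam (t, j)" using v by (simp add: neighbors_KLam)
      then show ?thesis using walk_le_step[OF w] by (simp add: eval_nat_numeral)
    qed
    then show ?thesis using distance_le_iff[OF wf xy(1)] v by simp
  qed
  then show "graph_diameter KLam \<le> 4"
    unfolding graph_diameter_def by (intro SUP_least) (simp add: numeral_eq_enat)
  \<comment> \<open>The blocks 11 to 13 are not adjacent to the point 0, hence at distance three
    from it in \<open>Lam\<close>; changing the layer costs a fourth step.\<close>
  have "\<not> walk_le KLam 3 (False, 0) (True, 11)"
    by (simp add: numeral_3_eq_3 walk_le_Suc_front walk_le_0 neighbors_KLam lam_nbrs_def)
  then have "\<not> graph_distance KLam (False, 0) (True, 11) \<le> enat 3"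
    using distance_le_iff[OF wf] by (simp add: pverts_KLam)
  then have "4 \<le> graph_distance KLam (False, 0) (True, 11)"
    by (cases "graph_distance KLam (False, 0) (True, 11)") (auto simp: numeral_eq_enat)
  then show "4 \<le> graph_diameter KLam"
    unfolding graph_diameter_def
    by (intro SUP_upper2[of "(False, 0)"] SUP_upper2[of "(True, 11)"]) (auto simp: pverts_KLam)
qed

section \<open>Uniqueness of \<open>Lam\<close>\<close>

lemma sum_card_swap:
  assumes "finite A" "finite B"
  shows "(\<Sum>a\<in>A. card {b \<in> B. R a b}) = (\<Sum>b\<in>B. card {a \<in> A. R a b})"
proof -
  have "(\<Sum>a\<in>A. card {b \<in> B. R a b}) = (\<Sum>a\<in>A. \<Sum>b\<in>B. if R a b then 1 else 0)"
    using assms by (simp add: sum.If_cases Collect_conj_eq[symmetric] Int_def)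
  also have "\<dots> = (\<Sum>b\<in>B. \<Sum>a\<in>A. if R a b then 1 else 0)" by (rule sum.swap)
  also have "\<dots> = (\<Sum>b\<in>B. card {a \<in> A. R a b})"
    using assms by (simp add: sum.If_cases Collect_conj_eq[symmetric] Int_def)
  finally show ?thesis .
qed

text \<open>Covers both a bipartite (0,2)-graph as in the uniqueness statement and the incidence
  graph of an arbitrary square 2-(7,4,2) design, so that one reconstruction serves for both.\<close>

locale lam_like =
  fixes G :: "'a pair_pre_digraph" and U W :: "'a set"
  assumes pg: "pair_graph G" and card14: "card (pverts G) = 14" and reg4: "regular_graph G 4"
    and V: "pverts G = U \<union> W" "U \<inter> W = {}" "parcs G \<subseteq> U \<times> W \<union> W \<times> U"
    and common: "\<And>x y. x \<in> pverts G \<Longrightarrow> y \<in> pverts G \<Longrightarrow> x \<noteq> y \<Longrightarrow>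
      card (neighbors G x \<inter> neighbors G y) \<in> {0, 2}"
begin

abbreviation "N \<equiv> neighbors G"

lemma fin: "finite U" "finite W" "finite (N x)"
  using pair_graphD(1,7)[OF pg] V(1) by auto

lemma symN: "y \<in> N x \<longleftrightarrow> x \<in> N y"
  using pair_graphD(5)[OF pg] .

lemma NU: "x \<in> U \<Longrightarrow> N x \<subseteq> W" and NW: "x \<in> W \<Longrightarrow> N x \<subseteq> U"
  using V(2,3) unfolding neighbors_def by auto

lemma deg: "x \<in> U \<union> W \<Longrightarrow> card (N x) = 4"
  using reg4 V(1) unfolding regular_graph_def by auto

lemma flip: "lam_like G W U"
  by (rule lam_like.intro) (use pg card14 reg4 V common in auto)

text \<open>The four neighbours of \<open>x\<close> send 4 * 3 edges to the other vertices of
  \<open>U\<close> that share a neighbour with \<open>x\<close>, and each of these receives two. So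
  there are six of them, and if \<open>U\<close> has only seven elements they are all the
  others.\<close>

lemma part_large:
  assumes x: "x \<in> U"
  shows "7 \<le> card U" and "card U = 7 \<Longrightarrow> y \<in> U \<Longrightarrow> y \<noteq> x \<Longrightarrow> card (N x \<inter> N y) = 2"
proof -
  let ?D = "{z \<in> U - {x}. N x \<inter> N z \<noteq> {}}"
  have c2: "card (N z \<inter> N x) = 2" if "z \<in> ?D" for z
    using common[of z x] that x V(1) fin by (auto simp: Int_commute)
  have "(\<Sum>p\<in>N x. card {z \<in> ?D. z \<in> N p}) = (\<Sum>z\<in>?D. card {p \<in> N x. z \<in> N p})"
    using fin by (intro sum_card_swap) auto
  moreover have "card {z \<in> ?D. z \<in> N p} = 3" if p: "p \<in> N x" for p
  proof -
    have "p \<in> W" using NU[OF x] p by blast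
    have "{z \<in> ?D. z \<in> N p} = N p - {x}"
      using NW[OF \<open>p \<in> W\<close>] p symN by blast
    moreover have "x \<in> N p" using p symN by blast
    ultimately show ?thesis using deg \<open>p \<in> W\<close> by simp
  qed
  moreover have "card {p \<in> N x. z \<in> N p} = 2" if z: "z \<in> ?D" for z
  proof -
    have "{p \<in> N x. z \<in> N p} = N z \<inter> N x" using symN by blast
    then show ?thesis using c2[OF z] by simp
  qed
  ultimately have D6: "card ?D = 6" using deg x by simp
  have sub: "?D \<subseteq> U - {x}" by blast
  have cU: "card U = Suc (card (U - {x}))" using card.remove[OF fin(1) x] .
  then show "7 \<le> card U" using card_mono[OF _ sub] fin(1) D6 by simp
  assume "card U = 7" and y: "y \<in> U" "y \<noteq> x"
  then have "?D = U - {x}" using cU D6 fin(1) sub by (intro card_subset_eq) auto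
  then have "y \<in> ?D" using y by simp
  from c2[OF this] show "card (N x \<inter> N y) = 2" by (simp add: Int_commute)
qed

lemma ex_vertex: "\<exists>x. x \<in> U" "\<exists>x. x \<in> W"
proof -
  have "U \<union> W \<noteq> {}" using card14 V(1) by auto
  then obtain x where x: "x \<in> U \<union> W" by blast
  then obtain y where "y \<in> N x" using deg by (metis all_not_in_conv card.empty zero_neq_numeral)
  then show "\<exists>x. x \<in> U" "\<exists>x. x \<in> W" using x NU NW by blast+
qed

lemma card_parts: "card U = 7" "card W = 7"
proof -
  interpret W: lam_like G W U by (rule flip)
  obtain x y where "x \<in> U" "y \<in> W" using ex_vertex by blast
  then have "7 \<le> card U" "7 \<le> card W" using part_large(1) W.part_large(1) by blast+
  moreover have "card U + card W = 14"
    using card14 V(1,2) fin by (simp add: card_Un_disjoint)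
  ultimately show "card U = 7" "card W = 7" by auto
qed

lemma common_U: "x \<in> U \<Longrightarrow> y \<in> U \<Longrightarrow> x \<noteq> y \<Longrightarrow> card (N x \<inter> N y) = 2"
  using part_large(2)[of x y] card_parts by auto

lemma common_W: "x \<in> W \<Longrightarrow> y \<in> W \<Longrightarrow> x \<noteq> y \<Longrightarrow> card (N x \<inter> N y) = 2"
proof -
  interpret W: lam_like G W U by (rule flip)
  show "x \<in> W \<Longrightarrow> y \<in> W \<Longrightarrow> x \<noteq> y \<Longrightarrow> card (N x \<inter> N y) = 2" by (rule W.common_U)
qed

text \<open>The six vertices of \<open>U\<close> other than \<open>x\<close> are labelled by the
  pairs of neighbours of \<open>x\<close>, as in the table \<open>lam_nbrs\<close>. It remains to
  see that the three vertices of \<open>W\<close> not adjacent to \<open>x\<close> can only be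
  attached as in that table.\<close>

lemma iso_Lam: "graph_iso G Lam" "graph_iso Lam G"
proof -
  obtain x where x: "x \<in> U" using ex_vertex by blast
  have "card (N x) = Suc 3" using deg x by simp
  then obtain a A3 where A3: "N x = insert a A3" "a \<notin> A3" "card A3 = 3"
    by (auto simp only: card_Suc_eq)
  then obtain b c d where Nx: "N x = {a, b, c, d}" and di: "distinct [a, b, c, d]"
    by (auto simp: card_3_iff)
  define pt where "pt s t = (THE z. z \<in> N s \<inter> N t - {x})" for s t
  have pt: "N s \<inter> N t = {x, pt s t} \<and> pt s t \<noteq> x \<and> N (pt s t) \<inter> N x = {s, t} \<and> pt s t \<in> U"
    if st: "s \<in> N x" "t \<in> N x" "s \<noteq> t" for s t
  proof -
    have W: "s \<in> W" "t \<in> W" using st NU[OF x] by auto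
    have xst: "x \<in> N s \<inter> N t" using st symN by blast
    have "card (N s \<inter> N t - {x}) = 1" using common_W[OF W st(3)] xst by simp
    then obtain z where z: "N s \<inter> N t - {x} = {z}" by (rule card_1_singletonE)
    then have "pt s t = z" unfolding pt_def by simp
    then have 1: "N s \<inter> N t = {x, pt s t}" "pt s t \<noteq> x" using z xst by blast+
    then have zU: "pt s t \<in> U" using NW[OF W(1)] by blast
    have "{s, t} \<subseteq> N (pt s t) \<inter> N x" using 1 st symN by blast
    moreover have "card (N (pt s t) \<inter> N x) = 2" using common_U[OF zU x 1(2)] .
    ultimately have "N (pt s t) \<inter> N x = {s, t}"
      using st(3) fin by (intro card_subset_eq[symmetric]) auto
    then show ?thesis using 1 zU by blast
  qed
  define p5 where "p5 = pt a b"
  define p6 where "p6 = pt a c"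
  define p7 where "p7 = pt a d"
  define p8 where "p8 = pt b c"
  define p9 where "p9 = pt b d"
  define p10 where "p10 = pt c d"
  note P5 = pt[of a b, folded p5_def] and P6 = pt[of a c, folded p6_def] and P7 = pt[of a d, folded p7_def]
    and P8 = pt[of b c, folded p8_def] and P9 = pt[of b d, folded p9_def] and P10 = pt[of c d, folded p10_def]
  have Px: "N p5 \<inter> N x = {a, b}" "N p6 \<inter> N x = {a, c}" "N p7 \<inter> N x = {a, d}"
    "N p8 \<inter> N x = {b, c}" "N p9 \<inter> N x = {b, d}" "N p10 \<inter> N x = {c, d}"
    using P5 P6 P7 P8 P9 P10 Nx di by auto
  have PU: "p5 \<in> U" "p6 \<in> U" "p7 \<in> U" "p8 \<in> U" "p9 \<in> U" "p10 \<in> U"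
    using P5 P6 P7 P8 P9 P10 Nx di by auto
  have dP: "distinct [x, p5, p6, p7, p8, p9, p10]"
  proof -
    have "x \<noteq> p5" "x \<noteq> p6" "x \<noteq> p7" "x \<noteq> p8" "x \<noteq> p9" "x \<noteq> p10"
      using P5 P6 P7 P8 P9 P10 Nx di by auto
    moreover have "distinct [p5, p6, p7, p8, p9, p10]"
    proof -
      have "distinct [{a, b}, {a, c}, {a, d}, {b, c}, {b, d}, {c, d}]"
        using di by (auto simp: doubleton_eq_iff)
      then have "distinct (map (\<lambda>p. N p \<inter> N x) [p5, p6, p7, p8, p9, p10])" by (simp only: list.map Px)
      then show ?thesis unfolding distinct_map by blast
    qed
    ultimately show ?thesis by auto
  qed
  have Ueq: "U = {x, p5, p6, p7, p8, p9, p10}"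
    by (rule card_subset_eq[symmetric]) (use x PU dP card_parts fin in auto)
  have four: "N v = {q, r, s, t}" if "{q, r, s, t} \<subseteq> N v" "v \<in> U \<union> W" "distinct [q, r, s, t]" for v q r s t
    by (rule card_subset_eq[symmetric]) (use that fin deg in auto)
  have abcd: "a \<in> N x" "b \<in> N x" "c \<in> N x" "d \<in> N x" using Nx by auto
  have inW: "a \<in> W" "b \<in> W" "c \<in> W" "d \<in> W" using abcd NU[OF x] by auto
  have in_p': "a \<in> N p5" "b \<in> N p5" "a \<in> N p6" "c \<in> N p6" "a \<in> N p7" "d \<in> N p7"
    "b \<in> N p8" "c \<in> N p8" "b \<in> N p9" "d \<in> N p9" "c \<in> N p10" "d \<in> N p10"
  proof -
    have "s \<in> A \<and> t \<in> A" if "A \<inter> A' = {s, t}" for A A' and s t :: 'a using that by blast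
    note this[OF Px(1)] this[OF Px(2)] this[OF Px(3)] this[OF Px(4)] this[OF Px(5)] this[OF Px(6)]
    then show "a \<in> N p5" "b \<in> N p5" "a \<in> N p6" "c \<in> N p6" "a \<in> N p7" "d \<in> N p7"
      "b \<in> N p8" "c \<in> N p8" "b \<in> N p9" "d \<in> N p9" "c \<in> N p10" "d \<in> N p10" by simp_all
  qed
  have in_p: "p5 \<in> N a" "p5 \<in> N b" "p6 \<in> N a" "p6 \<in> N c" "p7 \<in> N a" "p7 \<in> N d"
    "p8 \<in> N b" "p8 \<in> N c" "p9 \<in> N b" "p9 \<in> N d" "p10 \<in> N c" "p10 \<in> N d"
    by (rule iffD1[OF symN]; fact in_p')+
  have in_x: "x \<in> N a" "x \<in> N b" "x \<in> N c" "x \<in> N d" using abcd symN by blast+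
  have Na: "N a = {x, p5, p6, p7}" and Nb: "N b = {x, p5, p8, p9}"
    and Nc: "N c = {x, p6, p8, p10}" and Nd: "N d = {x, p7, p9, p10}"
    by (rule four; use in_p in_x inW dP in auto)+
  let ?S5 = "{p6, p7, p8, p9}" and ?S6 = "{p5, p10, p7, p8}" and ?S7 = "{p5, p10, p6, p9}"
  have types: "N B = ?S5 \<or> N B = ?S6 \<or> N B = ?S7" if B: "B \<in> W - N x" for B
  proof -
    have sub: "N B \<subseteq> {p5, p6, p7, p8, p9, p10}" using NW[of B] B symN Ueq by blast
    have cnt: "card (N B \<inter> N s) = 2" if "s \<in> N x" for s
      using common_W[of B s] B that NU[OF x] by blast
    have xB: "x \<notin> N B" using B symN by blast
    have i3: "of_bool (u \<in> N B) + of_bool (v \<in> N B) + of_bool (z \<in> N B) = (2 :: nat)"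
      if "s \<in> N x" "N s = {x, u, v, z}" "distinct [u, v, z]" for s u v z
    proof -
      have "N B \<inter> N s = (if u \<in> N B then {u} else {}) \<union> (if v \<in> N B then {v} else {}) \<union> (if z \<in> N B then {z} else {})"
        using xB that(2) by auto
      then show ?thesis using cnt[OF that(1)] that(3) by (auto split: if_splits)
    qed
    \<comment> \<open>Read \<open>p5\<close> to \<open>p10\<close> as the edges of the complete
      graph on \<open>a, b, c, d\<close>. The equations say that \<open>N B\<close> has degree two
      everywhere, so it is one of the three four-cycles.\<close>
    have e: "of_bool (p5 \<in> N B) + of_bool (p6 \<in> N B) + of_bool (p7 \<in> N B) = (2 :: nat)"
      "of_bool (p5 \<in> N B) + of_bool (p8 \<in> N B) + of_bool (p9 \<in> N B) = (2 :: nat)"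
      "of_bool (p6 \<in> N B) + of_bool (p8 \<in> N B) + of_bool (p10 \<in> N B) = (2 :: nat)"
      "of_bool (p7 \<in> N B) + of_bool (p9 \<in> N B) + of_bool (p10 \<in> N B) = (2 :: nat)"
      using i3[OF abcd(1) Na] i3[OF abcd(2) Nb] i3[OF abcd(3) Nc] i3[OF abcd(4) Nd] dP by auto
    have "N B = {p \<in> {p5, p6, p7, p8, p9, p10}. p \<in> N B}" using sub by blast
    then show ?thesis using e
      by (cases "p5 \<in> N B"; cases "p6 \<in> N B"; cases "p7 \<in> N B"; cases "p8 \<in> N B";
          cases "p9 \<in> N B"; cases "p10 \<in> N B"; simp) (use sub in blast)+
  qed
  have inj: "inj_on N (W - N x)"
  proof (rule inj_onI, rule ccontr)
    fix B C assume "B \<in> W - N x" "C \<in> W - N x" "N B = N C" "B \<noteq> C"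
    then show False using common_W[of B C] deg[of C] by auto
  qed
  have "card (W - N x) = 3"
    using NU[OF x] card_parts fin deg x by (subst card_Diff_subset) auto
  then have c3: "card (N ` (W - N x)) = 3" using card_image[OF inj] by simp
  have "N ` (W - N x) = {?S5, ?S6, ?S7}"
  proof (rule card_subset_eq)
    show "N ` (W - N x) \<subseteq> {?S5, ?S6, ?S7}" using types by blast
    have "card {?S5, ?S6, ?S7} \<le> 3" by (simp add: card_insert_if)
    moreover have "card (N ` (W - N x)) \<le> card {?S5, ?S6, ?S7}"
      using types by (intro card_mono) auto
    ultimately show "card (N ` (W - N x)) = card {?S5, ?S6, ?S7}" using c3 by simp
  qed simp
  then have "?S5 \<in> N ` (W - N x)" "?S6 \<in> N ` (W - N x)" "?S7 \<in> N ` (W - N x)" by simp_all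
  then obtain B11 B12 B13 where B: "B11 \<in> W - N x" "N B11 = ?S5" "B12 \<in> W - N x" "N B12 = ?S6"
    "B13 \<in> W - N x" "N B13 = ?S7" by (elim imageE) auto
  have "p6 \<in> N B11" "p6 \<notin> N B12" "p7 \<in> N B11" "p7 \<notin> N B13" "p7 \<in> N B12"
    unfolding B(2,4,6) using dP by auto
  then have dB: "B11 \<noteq> B12" "B11 \<noteq> B13" "B12 \<noteq> B13" by metis+
  have dall: "distinct [a, b, c, d, B11, B12, B13]" using di dB B(1,3,5) Nx by auto
  have Weq: "W = {a, b, c, d, B11, B12, B13}"
    by (rule card_subset_eq[symmetric]) (use B inW dall card_parts fin in auto)
  have in_B': "p5 \<in> N B12" "p5 \<in> N B13" "p6 \<in> N B11" "p6 \<in> N B13" "p7 \<in> N B11" "p7 \<in> N B12"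
    "p8 \<in> N B11" "p8 \<in> N B12" "p9 \<in> N B11" "p9 \<in> N B13" "p10 \<in> N B12" "p10 \<in> N B13"
    unfolding B(2,4,6) by simp_all
  have in_B: "B12 \<in> N p5" "B13 \<in> N p5" "B11 \<in> N p6" "B13 \<in> N p6" "B11 \<in> N p7" "B12 \<in> N p7"
    "B11 \<in> N p8" "B12 \<in> N p8" "B11 \<in> N p9" "B13 \<in> N p9" "B12 \<in> N p10" "B13 \<in> N p10"
    by (rule iffD1[OF symN]; fact in_B')+
  have Np: "N p5 = {a, b, B12, B13}" "N p6 = {a, c, B11, B13}" "N p7 = {a, d, B11, B12}"
    "N p8 = {b, c, B11, B12}" "N p9 = {b, d, B11, B13}" "N p10 = {c, d, B12, B13}"
    by (rule four; use in_p' in_B PU dall in auto)+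
  define vs where "vs = [x, a, b, c, d, p5, p6, p7, p8, p9, p10, B11, B12, B13]"
  have set_vs: "set vs = pverts G" unfolding V(1) Ueq Weq vs_def by auto
  have len: "length vs = 14" unfolding vs_def by simp
  have "distinct vs" by (rule card_distinct) (simp add: set_vs card14 len)
  then have bij: "bij_betw ((!) vs) (pverts Lam) (pverts G)"
    using len set_vs by (intro bij_betw_nth) auto
  have nbr: "N (vs ! i) = (!) vs ` neighbors Lam i" if "i \<in> pverts Lam" for i
  proof -
    have "i < 14" using that by simp
    from less_14_cases[OF this] show ?thesis
      by (elim insertE emptyE; simp add: neighbors_Lam lam_nbrs_def vs_def Nx Na Nb Nc Nd Np B insert_commute)
  qed
  show "graph_iso G Lam"
    by (rule graph_isoI(1)[OF pair_graphD(2)[OF pg] pair_graphD(2)[OF pair_graph_Lam] bij]) (rule nbr)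
  show "graph_iso Lam G"
    by (rule graph_isoI(2)[OF pair_graphD(2)[OF pg] pair_graphD(2)[OF pair_graph_Lam] bij]) (rule nbr)
qed

end

lemma Lam_unique:
  assumes "bipartite_graph G" "zero_two_graph G" "card (pverts G) = 14" "regular_graph G 4"
  shows "graph_iso G Lam"
proof -
  obtain U W where "pverts G = U \<union> W" "U \<inter> W = {}" "parcs G \<subseteq> U \<times> W \<union> W \<times> U"
    using assms(1) unfolding bipartite_graph_def by blast
  then have "lam_like G U W"
    using assms(2-4) unfolding zero_two_graph_def by (intro lam_like.intro) auto
  then show ?thesis by (rule lam_like.iso_Lam)
qed

section \<open>Incidence graphs and the square 2-(7,4,2) design\<close>

lemma neighbors_incidence:
  "neighbors (incidence_graph D) (Inl p) = (if p \<in> points D then Inr ` {b \<in> blocks D. incident D p b} else {})"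
  "neighbors (incidence_graph D) (Inr b) = (if b \<in> blocks D then Inl ` points_on D b else {})"
  unfolding neighbors_def incidence_graph_def points_on_def by auto

lemma pair_graph_incidence:
  assumes "finite (points D)" "finite (blocks D)"
  shows "pair_graph (incidence_graph D)"
proof (rule pair_graphI)
  show "finite (pverts (incidence_graph D))" using assms by (simp add: incidence_graph_def)
  show "parcs (incidence_graph D) \<subseteq> pverts (incidence_graph D) \<times> pverts (incidence_graph D)"
    "sym (parcs (incidence_graph D))" "irrefl (parcs (incidence_graph D))"
    unfolding incidence_graph_def by (auto simp: sym_def irrefl_def)
qed

lemma card_pairs: "finite S \<Longrightarrow> card {(p, q). p \<in> S \<and> q \<in> S \<and> p \<noteq> q} = card S * (card S - 1)"
proof -
  assume fin: "finite S"
  have "{(p, q). p \<in> S \<and> q \<in> S \<and> p \<noteq> q} = S \<times> S - (\<lambda>p. (p, p)) ` S" by auto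
  moreover have "card (S \<times> S - (\<lambda>p. (p, p)) ` S) = card S * card S - card S"
    using fin by (subst card_Diff_subset) (auto simp: card_image inj_on_def card_cartesian_product)
  ultimately show ?thesis by (simp add: diff_mult_distrib2)
qed

text \<open>Two blocks meet in two points because the intersection sizes with a fixed block have mean 2 and
  variance 0.\<close>

lemma square_design_lam_like:
  assumes D: "square_2_design D 7 4 2"
  shows "lam_like (incidence_graph D) (Inl ` points D) (Inr ` blocks D)"
proof -
  let ?G = "incidence_graph D"
  have fin: "finite (points D)" "finite (blocks D)" and c7: "card (points D) = 7" "card (blocks D) = 7"
    and c4: "\<And>b. b \<in> blocks D \<Longrightarrow> card (points_on D b) = 4"
    and l2: "\<And>p q. p \<in> points D \<Longrightarrow> q \<in> points D \<Longrightarrow> p \<noteq> q \<Longrightarrow> card (blocks_through D p q) = 2"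
    using D unfolding square_2_design_def by auto
  have finp: "finite (points_on D b)" for b unfolding points_on_def using fin by simp
  let ?B = "\<lambda>p. {b \<in> blocks D. p \<in> points_on D b}"
  \<comment> \<open>The replication number: the six other points, each on two blocks with
    \<open>p\<close>, fill the blocks through \<open>p\<close> three at a time.\<close>
  have r4: "card (?B p) = 4" if p: "p \<in> points D" for p
  proof -
    have "(\<Sum>q\<in>points D - {p}. card {b \<in> ?B p. q \<in> points_on D b}) =
        (\<Sum>b\<in>?B p. card {q \<in> points D - {p}. q \<in> points_on D b})"
      using fin by (intro sum_card_swap) auto
    moreover have "card {b \<in> ?B p. q \<in> points_on D b} = 2" if q: "q \<in> points D - {p}" for q
    proof -
      have "{b \<in> ?B p. q \<in> points_on D b} = blocks_through D p q" unfolding blocks_through_def by auto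
      then show ?thesis using l2[of p q] p q by auto
    qed
    moreover have "card {q \<in> points D - {p}. q \<in> points_on D b} = 3" if b: "b \<in> ?B p" for b
    proof -
      have "{q \<in> points D - {p}. q \<in> points_on D b} = points_on D b - {p}" unfolding points_on_def by auto
      then show ?thesis using c4 b by simp
    qed
    ultimately have "(card (points D) - 1) * 2 = card (?B p) * 3" using p fin by simp
    then show ?thesis using c7 by simp
  qed
  have b2: "card (points_on D b \<inter> points_on D b') = 2"
    if b: "b \<in> blocks D" "b' \<in> blocks D" "b \<noteq> b'" for b b'
  proof -
    let ?O = "blocks D - {b}" and ?P = "points_on D b"
    let ?n = "\<lambda>b'. int (card (?P \<inter> points_on D b'))"
    have Ps: "?P \<subseteq> points D" unfolding points_on_def by blast
    have "(\<Sum>c\<in>?O. card {p \<in> ?P. p \<in> points_on D c}) = (\<Sum>p\<in>?P. card {c \<in> ?O. p \<in> points_on D c})"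
      using fin finp by (intro sum_card_swap) auto
    moreover have "card {c \<in> ?O. p \<in> points_on D c} = 3" if p: "p \<in> ?P" for p
    proof -
      have "{c \<in> ?O. p \<in> points_on D c} = ?B p - {b}" by auto
      moreover have "b \<in> ?B p" using b p by simp
      ultimately show ?thesis using r4[of p] p Ps by auto
    qed
    moreover have "{p \<in> ?P. p \<in> points_on D c} = ?P \<inter> points_on D c" for c by auto
    ultimately have s1: "(\<Sum>c\<in>?O. card (?P \<inter> points_on D c)) = 12" using c4 b by simp
    let ?Q = "\<lambda>S. {(p, q). p \<in> S \<and> q \<in> S \<and> p \<noteq> q}"
    have fQ: "finite (?Q ?P)"
      by (rule finite_subset[of _ "?P \<times> ?P"]) (use finp in auto)
    have "(\<Sum>c\<in>?O. card {z \<in> ?Q ?P. fst z \<in> points_on D c \<and> snd z \<in> points_on D c}) =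
        (\<Sum>z\<in>?Q ?P. card {c \<in> ?O. fst z \<in> points_on D c \<and> snd z \<in> points_on D c})"
      using fin fQ by (intro sum_card_swap) auto
    moreover have "card {c \<in> ?O. fst z \<in> points_on D c \<and> snd z \<in> points_on D c} = 1" if z: "z \<in> ?Q ?P" for z
    proof -
      have "{c \<in> ?O. fst z \<in> points_on D c \<and> snd z \<in> points_on D c} = blocks_through D (fst z) (snd z) - {b}"
        unfolding blocks_through_def by auto
      moreover have "b \<in> blocks_through D (fst z) (snd z)"
        unfolding blocks_through_def using b z by auto
      moreover have "card (blocks_through D (fst z) (snd z)) = 2"
        by (rule l2) (use z Ps in auto)
      ultimately show ?thesis by simp
    qed
    ultimately have "(\<Sum>c\<in>?O. card {z \<in> ?Q ?P. fst z \<in> points_on D c \<and> snd z \<in> points_on D c}) =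
        (\<Sum>z\<in>?Q ?P. 1)"
      by (simp only: cong: sum.cong)
    also have "\<dots> = card (?Q ?P)" by (rule card_eq_sum[symmetric])
    also have "\<dots> = 12" using card_pairs[OF finp, of b] c4[OF b(1)] by simp
    also have "(\<Sum>c\<in>?O. card {z \<in> ?Q ?P. fst z \<in> points_on D c \<and> snd z \<in> points_on D c}) =
        (\<Sum>c\<in>?O. card (?P \<inter> points_on D c) * (card (?P \<inter> points_on D c) - 1))"
    proof (rule sum.cong[OF refl])
      fix c
      have "{z \<in> ?Q ?P. fst z \<in> points_on D c \<and> snd z \<in> points_on D c} = ?Q (?P \<inter> points_on D c)"
        by auto
      then show "card {z \<in> ?Q ?P. fst z \<in> points_on D c \<and> snd z \<in> points_on D c} =
          card (?P \<inter> points_on D c) * (card (?P \<inter> points_on D c) - 1)"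
        using card_pairs[of "?P \<inter> points_on D c"] finp by simp
    qed
    finally have s2: "(\<Sum>c\<in>?O. card (?P \<inter> points_on D c) * (card (?P \<inter> points_on D c) - 1)) = 12" .
    \<comment> \<open>Summed over the six other blocks, the right-hand side is 12 - 3 * 12 + 4 * 6 =
      0.\<close>
    have id: "(?n c - 2) ^ 2 = int (card (?P \<inter> points_on D c) * (card (?P \<inter> points_on D c) - 1)) -
        3 * int (card (?P \<inter> points_on D c)) + 4" for c
      by (cases "card (?P \<inter> points_on D c)") (auto simp: power2_eq_square algebra_simps)
    have "(\<Sum>c\<in>?O. (?n c - 2) ^ 2) = int 12 - 3 * int 12 + 4 * int (card ?O)"
    proof -
      have "(\<Sum>c\<in>?O. int (g c) - 3 * int (h c) + 4) = int (sum g ?O) - 3 * int (sum h ?O) + 4 * int (card ?O)"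
        for g h :: "_ \<Rightarrow> nat"
        by (simp add: sum.distrib sum_subtractf sum_distrib_left)
      from this[of "\<lambda>c. card (?P \<inter> points_on D c) * (card (?P \<inter> points_on D c) - 1)"
          "\<lambda>c. card (?P \<inter> points_on D c)"]
      show ?thesis unfolding id s1 s2 .
    qed
    also have "\<dots> = 0" using c7 b fin by simp
    finally have "\<forall>c\<in>?O. (?n c - 2) ^ 2 = 0"
      using fin by (subst (asm) sum_nonneg_eq_0_iff) auto
    then have "?n b' = 2" using b by auto
    then show ?thesis by simp
  qed
  show ?thesis
  proof (rule lam_like.intro)
    show "pair_graph ?G" using pair_graph_incidence fin by blast
    show "card (pverts ?G) = 14" using fin c7 by (simp add: incidence_graph_def card_Plus)
    have Bp: "{b \<in> blocks D. incident D p b} = ?B p" if "p \<in> points D" for p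
      using that unfolding points_on_def by auto
    have "pverts ?G = points D <+> blocks D" by (simp add: incidence_graph_def)
    then show "regular_graph ?G 4" unfolding regular_graph_def
      using r4 c4 Bp by (auto simp: neighbors_incidence card_image)
    show "pverts ?G = Inl ` points D \<union> Inr ` blocks D" by (simp add: incidence_graph_def Plus_def)
    show "Inl ` points D \<inter> Inr ` blocks D = {}" by auto
    show "parcs ?G \<subseteq> Inl ` points D \<times> Inr ` blocks D \<union> Inr ` blocks D \<times> Inl ` points D"
      unfolding incidence_graph_def by auto
    fix u v assume uv: "u \<in> pverts ?G" "v \<in> pverts ?G" "u \<noteq> v"
    consider p q where "u = Inl p" "v = Inl q" | p b where "u = Inl p" "v = Inr b"
      | b p where "u = Inr b" "v = Inl p" | b c where "u = Inr b" "v = Inr c"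
      by (metis sum.exhaust)
    then show "card (neighbors ?G u \<inter> neighbors ?G v) \<in> {0, 2}"
    proof cases
      case (1 p q)
      then have pq: "p \<in> points D" "q \<in> points D" "p \<noteq> q" using uv by (auto simp: incidence_graph_def)
      have "neighbors ?G u \<inter> neighbors ?G v = Inr ` blocks_through D p q"
        unfolding 1 neighbors_incidence blocks_through_def using pq Bp by auto
      then show ?thesis using l2[OF pq] by (simp add: card_image)
    next
      case (4 b c)
      then have bc: "b \<in> blocks D" "c \<in> blocks D" "b \<noteq> c" using uv by (auto simp: incidence_graph_def)
      have "neighbors ?G u \<inter> neighbors ?G v = Inl ` (points_on D b \<inter> points_on D c)"
        unfolding 4 neighbors_incidence using bc by auto
      then show ?thesis using b2[OF bc] by (simp add: card_image)
    next
      case (2 p b)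
      then have "neighbors ?G u \<inter> neighbors ?G v = {}" by (auto simp: neighbors_incidence)
      then show ?thesis by simp
    next
      case (3 b p)
      then have "neighbors ?G u \<inter> neighbors ?G v = {}" by (auto simp: neighbors_incidence)
      then show ?thesis by simp
    qed
  qed
qed

lemma Lam_iso_design: "square_2_design D 7 4 2 \<Longrightarrow> graph_iso Lam (incidence_graph D)"
  by (rule lam_like.iso_Lam(2)[OF square_design_lam_like])

text \<open>The design is read off \<open>Lam\<close> itself: its two colour classes serve as points
  and blocks.\<close>

lemma ex_design: "\<exists>D :: (nat, nat) incidence_structure. square_2_design D 7 4 2"
proof -
  define D :: "(nat, nat) incidence_structure" where
    "D = \<lparr> points = {i. i < 14 \<and> lam_point i}, blocks = {i. i < 14 \<and> \<not> lam_point i},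
      incident = (\<lambda>p b. p \<in> set (lam_nbrs b)) \<rparr>"
  have P: "points D = {0, 5, 6, 7, 8, 9, 10}" and B: "blocks D = {1, 2, 3, 4, 11, 12, 13}"
    unfolding D_def lam_point_def by auto
  have on: "points_on D b = set (lam_nbrs b)" if "b \<in> blocks D" for b
    using that lam_nbrs_props(3)[of b] unfolding points_on_def D_def by auto
  have "card (blocks_through D p q) = 2" if pq: "p \<in> points D" "q \<in> points D" "p \<noteq> q" for p q
  proof -
    have pq': "p < 14" "q < 14" "lam_point p" "lam_point q" using pq unfolding D_def by auto
    have "blocks_through D p q = set (lam_nbrs p) \<inter> set (lam_nbrs q)"
    proof (intro equalityI subsetI)
      fix b assume "b \<in> blocks_through D p q"
      then show "b \<in> set (lam_nbrs p) \<inter> set (lam_nbrs q)"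
        unfolding blocks_through_def using on[of b] lam_nbrs_props(3)[of b] unfolding D_def by auto
    next
      fix b assume "b \<in> set (lam_nbrs p) \<inter> set (lam_nbrs q)"
      then have "b < 14" "\<not> lam_point b" "p \<in> set (lam_nbrs b)" "q \<in> set (lam_nbrs b)"
        using lam_nbrs_props(3) pq' by blast+
      moreover from this have "b \<in> blocks D" unfolding D_def by simp
      ultimately show "b \<in> blocks_through D p q" unfolding blocks_through_def using on by simp
    qed
    then show ?thesis using lam_nbrs_common[OF pq'(1,2) pq(3)] pq' by simp
  qed
  moreover have "card (points_on D b) = 4" if "b \<in> blocks D" for b
    using on[OF that] that lam_nbrs_props(1,2)[of b] unfolding D_def by (simp add: distinct_card)
  ultimately have "square_2_design D 7 4 2" unfolding square_2_design_def P B by simp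
  then show ?thesis by blast
qed

section \<open>Counting around two vertices at distance four\<close>

text \<open>Used against \<open>lam = 1\<close>: in a graph in which every edge lies in exactly one
  triangle, the neighbours of a vertex are paired off.\<close>

lemma odd_card_fixpoint:
  assumes "finite A" and "odd (card A)" and "\<And>a. a \<in> A \<Longrightarrow> f a \<in> A \<and> f (f a) = a"
  shows "\<exists>a\<in>A. f a = a"
  using assms
proof (induction "card A" arbitrary: A rule: less_induct)
  case less
  then obtain a where a: "a \<in> A" by fastforce
  show ?case
  proof (cases "f a = a")
    case False
    let ?B = "A - {a, f a}"
    have fa: "f a \<in> A" "f (f a) = a" using less.prems(3)[OF a] by auto
    have "card {a, f a} = 2" using False by simp
    then have c: "card A = card ?B + 2"
      using card_mono[of A "{a, f a}"] less.prems(1) a fa by (simp add: card_Diff_subset)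
    have "\<exists>b\<in>?B. f b = b"
    proof (rule less(1))
      show "card ?B < card A" "finite ?B" "odd (card ?B)" using c less.prems(1,2) by auto
      fix b assume b: "b \<in> ?B"
      then have fb: "f b \<in> A" "f (f b) = b" using less.prems(3)[of b] by auto
      have "f b \<noteq> a" using b fb(2) by (metis Diff_iff insertCI)
      moreover have "f b \<noteq> f a"
      proof
        assume "f b = f a"
        then have "b = a" using fb(2) fa(2) by metis
        then show False using b by simp
      qed
      ultimately show "f b \<in> ?B \<and> f (f b) = b" using fb by simp
    qed
    then show ?thesis by blast
  next
    case True
    then show ?thesis using a by (rule bexI)
  qed
qed

lemma card_ge_2_ex:
  assumes "2 \<le> card S"
  shows "\<exists>b\<in>S. b \<noteq> a"
proof (rule ccontr)
  assume "\<not> ?thesis"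
  then have "S \<subseteq> {a}" by blast
  from card_mono[OF _ this] show False using assms by simp
qed

text \<open>Only neighbourhoods are kept, and distance two becomes: distinct, nonadjacent, with a
  common neighbour. The counting then needs neither arcs nor walks. \<open>k_eq\<close> and
  \<open>mu2\<close> encode that the valency is odd and at least five.\<close>

locale amply_regular_nbhd =
  fixes V :: "'a set" and N :: "'a \<Rightarrow> 'a set" and k lam mu :: nat
  assumes finV: "finite V"
    and NV: "y \<in> N x \<Longrightarrow> y \<in> V"
    and symN: "y \<in> N x \<Longrightarrow> x \<in> N y"
    and irr: "x \<notin> N x"
    and deg: "x \<in> V \<Longrightarrow> card (N x) = k"
    and adj: "y \<in> N x \<Longrightarrow> card (N x \<inter> N y) = lam"
    and nonadj: "x \<noteq> y \<Longrightarrow> y \<notin> N x \<Longrightarrow> N x \<inter> N y \<noteq> {} \<Longrightarrow> card (N x \<inter> N y) = mu"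
    and k_eq: "k = 2 * mu + 1" and mu2: "2 \<le> mu"
begin

lemma finN [simp, intro]: "finite (N x)"
  using finV NV by (meson finite_subset subsetI)

lemma symN_iff: "y \<in> N x \<longleftrightarrow> x \<in> N y"
  using symN by blast

lemma edge_count:
  assumes "finite A" "finite B"
  shows "(\<Sum>a\<in>A. card (N a \<inter> B)) = (\<Sum>b\<in>B. card (N b \<inter> A))"
  using sum_card_swap[OF assms, of "\<lambda>a b. b \<in> N a"] symN_iff
  by (simp add: Int_def conj_commute)

definition D2 :: "'a \<Rightarrow> 'a set" where
  "D2 x = {z. z \<noteq> x \<and> z \<notin> N x \<and> N x \<inter> N z \<noteq> {}}"

text \<open>\<open>far x y\<close> excludes walks of length at most three, so \<open>dist4\<close> means distance exactly four.\<close>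

definition far :: "'a \<Rightarrow> 'a \<Rightarrow> bool" where
  "far x y \<longleftrightarrow> x \<noteq> y \<and> y \<notin> N x \<and> N x \<inter> N y = {} \<and> (\<forall>p\<in>N x. N p \<inter> N y = {})"

definition M :: "'a \<Rightarrow> 'a \<Rightarrow> 'a set" where
  "M x y = D2 x \<inter> D2 y"

definition dist4 :: "'a \<Rightarrow> 'a \<Rightarrow> bool" where
  "dist4 x y \<longleftrightarrow> far x y \<and> M x y \<noteq> {}"

lemma D2_sym: "z \<in> D2 x \<longleftrightarrow> x \<in> D2 z"
  unfolding D2_def using symN by auto

lemma D2_V: "z \<in> D2 x \<Longrightarrow> z \<in> V \<and> x \<in> V"
  unfolding D2_def using symN NV by blast

lemma finD2 [simp, intro]: "finite (D2 x)"
  using D2_V finV by (meson finite_subset subsetI)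

lemma finM [simp, intro]: "finite (M x y)"
  by (simp add: M_def)

lemma far_sym: "far x y \<Longrightarrow> far y x"
  unfolding far_def using symN by blast

lemma M_sym: "M x y = M y x"
  by (auto simp: M_def)

lemma dist4_sym: "dist4 x y \<Longrightarrow> dist4 y x"
  unfolding dist4_def using far_sym M_sym by metis

lemma dist4_far: "dist4 x y \<Longrightarrow> far x y"
  unfolding dist4_def by blast

lemma dist4_V: "dist4 x y \<Longrightarrow> x \<in> V \<and> y \<in> V"
  unfolding dist4_def M_def using D2_V by blast

lemma card_common: "z \<in> D2 x \<Longrightarrow> card (N x \<inter> N z) = mu"
  unfolding D2_def by (auto intro!: nonadj)

text \<open>This is where the relation between \<mu> and the valency enters: the neighbours of
  \<open>m\<close> next to \<open>x\<close> and next to \<open>y\<close> are disjoint sets of size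
  \<open>mu\<close> each, and \<open>k - 2 * mu = 1\<close>.\<close>

lemma M_rest:
  assumes "far x y" and m: "m \<in> M x y"
  shows "\<exists>w. N m = (N m \<inter> N x) \<union> (N m \<inter> N y) \<union> {w} \<and> w \<notin> N x \<and> w \<notin> N y"
proof -
  have "card (N m \<inter> N x) = mu" "card (N m \<inter> N y) = mu" "card (N m) = 2 * mu + 1"
    using m card_common D2_V deg k_eq unfolding M_def by (auto simp: Int_commute)
  moreover have "(N m \<inter> N x) \<inter> (N m \<inter> N y) = {}"
    using assms unfolding far_def by blast
  ultimately have "card (N m - ((N m \<inter> N x) \<union> (N m \<inter> N y))) = 1"
    by (subst card_Diff_subset) (auto simp: card_Un_disjoint)
  then obtain w where "N m - ((N m \<inter> N x) \<union> (N m \<inter> N y)) = {w}"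
    by (auto simp: card_1_singleton_iff)
  then show ?thesis by (intro exI[of _ w]) blast
qed

text \<open>Let \<open>a\<close> be a common neighbour of \<open>m\<close> and \<open>x\<close>.
  Nothing next to \<open>y\<close> is adjacent to \<open>a\<close>, so the common neighbours of
  \<open>a\<close> and \<open>m\<close> are among the \<open>mu - 1\<close> other ones next to
  \<open>x\<close> and the extra neighbour \<open>w\<close>.\<close>

lemma lam_le_mu:
  assumes "dist4 x y"
  shows "lam \<le> mu"
proof -
  obtain m where far: "far x y" and m: "m \<in> M x y"
    using assms unfolding dist4_def by blast
  obtain w where w: "N m = (N m \<inter> N x) \<union> (N m \<inter> N y) \<union> {w}"
    using M_rest[OF far m] by blast
  have cA: "card (N m \<inter> N x) = mu"
    using m card_common unfolding M_def by (auto simp: Int_commute)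
  then have "N m \<inter> N x \<noteq> {}" using mu2 by auto
  then obtain a where a: "a \<in> N m \<inter> N x" by blast
  have "N a \<inter> N m \<subseteq> insert w ((N m \<inter> N x) - {a})"
    using w far a irr symN unfolding far_def by blast
  then have "card (N a \<inter> N m) \<le> card (insert w ((N m \<inter> N x) - {a}))"
    by (intro card_mono) auto
  also have "\<dots> \<le> Suc (card ((N m \<inter> N x) - {a}))" by (simp add: card_insert_if)
  also have "\<dots> = mu" using a cA mu2 by (subst card_Diff_singleton) auto
  finally show ?thesis
    using adj[of a m] a symN by (auto simp: Int_commute)
qed

text \<open>A vertex of one of the two sets shares exactly \<open>mu\<close> neighbours with the
  opposite end, and these all lie in the other set. So the edges between the sets form a bipartite
  graph that is regular of degree \<open>mu\<close> on both sides.\<close>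

lemma card_dist3_swap:
  assumes "z \<noteq> x" "z \<notin> N x" "N x \<inter> N z = {}"
  shows "card (N x \<inter> D2 z) = card (N z \<inter> D2 x)"
proof -
  have *: "(\<Sum>a\<in>N x \<inter> D2 z. card (N a \<inter> (N z \<inter> D2 x))) = mu * card (N x \<inter> D2 z)"
    if "z \<noteq> x" "z \<notin> N x" "N x \<inter> N z = {}" for x z
  proof -
    have "card (N a \<inter> (N z \<inter> D2 x)) = mu" if a: "a \<in> N x \<inter> D2 z" for a
    proof -
      have "N a \<inter> (N z \<inter> D2 x) = N z \<inter> N a"
        using a \<open>z \<noteq> x\<close> \<open>z \<notin> N x\<close> \<open>N x \<inter> N z = {}\<close> symN unfolding D2_def by blast
      then show ?thesis using card_common a by simp
    qed
    then show ?thesis by simp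
  qed
  have "mu * card (N x \<inter> D2 z) = mu * card (N z \<inter> D2 x)"
    using *[of z x] *[of x z] edge_count[of "N x \<inter> D2 z" "N z \<inter> D2 x"] assms symN
    by (auto simp: Int_commute)
  then show ?thesis using mu2 by simp
qed

text \<open>If \<open>?C\<close> had only \<open>mu\<close> elements, every vertex of
  \<open>N x \<inter> D2 z\<close> would be adjacent to all of them. Two such vertices would then
  share \<open>?C\<close> and \<open>x\<close>, which is one common neighbour too many.\<close>

lemma card_dist3_gt:
  assumes l: "lam \<le> mu" and z: "z \<noteq> x" "z \<notin> N x" "N x \<inter> N z = {}" and ne: "N x \<inter> D2 z \<noteq> {}"
  shows "mu + 1 \<le> card (N z \<inter> D2 x)"
proof (rule ccontr)
  let ?C = "N z \<inter> D2 x"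
  assume "\<not> mu + 1 \<le> card ?C"
  then have le: "card ?C \<le> mu" by simp
  have eq: "N z \<inter> N a = ?C" if a: "a \<in> N x \<inter> D2 z" for a
  proof -
    have "N z \<inter> N a \<subseteq> ?C" using a z symN unfolding D2_def by blast
    moreover have "card (N z \<inter> N a) = mu" using a card_common by blast
    ultimately show ?thesis using le by (intro card_seteq) auto
  qed
  obtain a where a: "a \<in> N x \<inter> D2 z" using ne by blast
  have c: "card ?C = mu" using eq[OF a] card_common[of a z] a by auto
  then have "card (N x \<inter> D2 z) = mu" using card_dist3_swap[of z x] z by simp
  then obtain a' where a': "a' \<in> N x \<inter> D2 z" "a' \<noteq> a"
    using card_ge_2_ex[of "N x \<inter> D2 z" a] mu2 by auto
  have sub: "insert x ?C \<subseteq> N a \<inter> N a'" using eq[OF a] eq[OF a'(1)] a a' symN by blast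
  have "mu + 1 = card (insert x ?C)" using c by (simp add: D2_def)
  also have "\<dots> \<le> card (N a \<inter> N a')" using sub by (intro card_mono) auto
  also have "\<dots> \<le> mu"
    using l adj[of a' a] nonadj[of a a'] a'(2) by (cases "a' \<in> N a"; cases "N a \<inter> N a' = {}") auto
  finally show False by simp
qed

text \<open>For a neighbour \<open>q\<close> of \<open>y\<close>, the more than \<open>lam\<close> neighbours of \<open>q\<close> in \<open>M x y\<close> each see at least
  \<open>lam - 1\<close> of the \<open>lam\<close> common neighbours of \<open>q\<close> and \<open>y\<close>, which each see at most \<open>lam - 1\<close> of the
  former. So \<open>lam \<le> 1\<close>, and \<open>lam = 1\<close> would be a perfect matching on an odd number of vertices.\<close>

lemma lam_zero:
  assumes d: "dist4 x y"
  shows "lam = 0"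
proof -
  obtain m where far: "far x y" and m: "m \<in> M x y"
    using d unfolding dist4_def by blast
  have lm: "lam \<le> mu" using lam_le_mu d by blast
  obtain q where q: "q \<in> N m" "q \<in> N y" using m unfolding M_def D2_def by blast
  let ?C = "N q \<inter> M x y" and ?L = "N q \<inter> N y"
  have CD: "N q \<inter> D2 x = ?C"
    using q far symN unfolding M_def D2_def far_def by blast
  have "mu + 1 \<le> card ?C" unfolding CD[symmetric]
  proof (rule card_dist3_gt[OF lm])
    show "q \<noteq> x" "q \<notin> N x" "N x \<inter> N q = {}" using far q symN unfolding far_def by blast+
    have "N x \<inter> N m \<noteq> {}" using m unfolding M_def D2_def by blast
    then obtain p where "p \<in> N x" "p \<in> N m" by blast
    then have "p \<in> N x \<inter> D2 q" using far q symN unfolding far_def D2_def by blast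
    then show "N x \<inter> D2 q \<noteq> {}" by blast
  qed
  have cL: "card ?L = lam" using adj[of q y] q by (simp add: Int_commute)
  have up: "card (N c \<inter> ?L) \<ge> lam - 1" if c: "c \<in> ?C" for c
  proof -
    obtain w where w: "N c = (N c \<inter> N x) \<union> (N c \<inter> N y) \<union> {w}"
      using M_rest[OF far, of c] c by blast
    have "N c \<inter> N q \<subseteq> insert w (N c \<inter> ?L)"
      using w far q symN unfolding far_def by blast
    then have "card (N c \<inter> N q) \<le> card (insert w (N c \<inter> ?L))" by (intro card_mono) auto
    also have "\<dots> \<le> Suc (card (N c \<inter> ?L))" by (simp add: card_insert_if)
    finally show ?thesis using adj[of c q] c by (auto simp: Int_commute)
  qed
  have low: "card (N l \<inter> ?C) \<le> lam - 1" if l: "l \<in> ?L" for l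
  proof -
    have "N l \<inter> ?C \<subseteq> (N l \<inter> N q) - {y}"
      unfolding M_def D2_def by blast
    moreover have "y \<in> N l \<inter> N q" using l q symN by blast
    moreover have "card (N l \<inter> N q) = lam" using adj[of l q] l by (simp add: Int_commute)
    ultimately show ?thesis
      by (metis card_Diff_singleton card_mono finN finite_Diff finite_Int)
  qed
  have "card ?C * (lam - 1) \<le> (\<Sum>c\<in>?C. card (N c \<inter> ?L))"
    using sum_bounded_below[of ?C "lam - 1" "\<lambda>c. card (N c \<inter> ?L)"] up by simp
  also have "\<dots> = (\<Sum>l\<in>?L. card (N l \<inter> ?C))" by (rule edge_count) auto
  also have "\<dots> \<le> lam * (lam - 1)"
    using sum_bounded_above[of ?L "\<lambda>l. card (N l \<inter> ?C)" "lam - 1"] low cL by simp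
  finally have "(mu + 1) * (lam - 1) \<le> lam * (lam - 1)"
    using \<open>mu + 1 \<le> card ?C\<close> by (meson le_trans mult_le_mono1)
  also have "\<dots> \<le> mu * (lam - 1)" using lm by (rule mult_le_mono1)
  finally have "lam - 1 = 0" by simp
  then have "lam \<le> 1" by simp
  moreover have "lam \<noteq> 1"
  proof
    assume 1: "lam = 1"
    define g where "g u = (THE v. v \<in> N m \<inter> N u)" for u
    have g: "N m \<inter> N u = {g u}" if "u \<in> N m" for u
    proof -
      have "card (N m \<inter> N u) = 1" using adj that 1 by simp
      then obtain v where "N m \<inter> N u = {v}" by (auto simp: card_1_singleton_iff)
      then show ?thesis unfolding g_def by simp
    qed
    have g1: "g u \<in> N m \<and> g u \<in> N u" if "u \<in> N m" for u using g[OF that] by blast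
    moreover have "g (g u) = u" if "u \<in> N m" for u
    proof -
      have "u \<in> N m \<inter> N (g u)" using g1[OF that] symN that by simp
      then show ?thesis using g[of "g u"] g1[OF that] by simp
    qed
    moreover have "odd (card (N m))" using deg[of m] m D2_V[of m x] k_eq unfolding M_def by simp
    ultimately have "\<exists>u\<in>N m. g u = u" by (intro odd_card_fixpoint) auto
    then show False using g1 irr by metis
  qed
  ultimately show ?thesis by simp
qed

end

section \<open>Triangle-free graphs: how many neighbours of a vertex next to x lie in M\<close>

locale triangle_free_nbhd = amply_regular_nbhd +
  assumes lam0: "lam = 0"
    and conn: "S \<noteq> {} \<Longrightarrow> S \<subseteq> V \<Longrightarrow> (\<And>s. s \<in> S \<Longrightarrow> N s \<subseteq> S) \<Longrightarrow> S = V"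
begin

lemma tri: "y \<in> N x \<Longrightarrow> N x \<inter> N y = {}"
  using adj[of y x] lam0 by simp

lemma tri': "y \<in> N x \<Longrightarrow> z \<in> N x \<Longrightarrow> z \<notin> N y"
  using tri by blast

lemma NV': "y \<in> N x \<Longrightarrow> x \<in> V"
  using symN NV by blast

lemma mem_D2I: "z \<noteq> x \<Longrightarrow> p \<in> N x \<Longrightarrow> p \<in> N z \<Longrightarrow> z \<in> D2 x"
  unfolding D2_def using tri symN by blast

lemma card_common': "z \<in> D2 x \<Longrightarrow> card (N z \<inter> N x) = mu"
  using card_common[of z x] by (simp add: Int_commute)

lemma nbr_D2: "p \<in> N x \<Longrightarrow> N p \<inter> D2 x = N p - {x}"
  using mem_D2I symN unfolding D2_def by blast

lemma card_D2:
  assumes "x \<in> V"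
  shows "card (D2 x) = 2 * k"
proof -
  have "card (N p \<inter> D2 x) = 2 * mu" if "p \<in> N x" for p
    using nbr_D2[OF that] deg[OF NV[OF that]] symN[OF that] k_eq by simp
  then have "2 * mu * k = (\<Sum>p\<in>N x. card (N p \<inter> D2 x))"
    using deg[OF assms] by simp
  also have "\<dots> = (\<Sum>z\<in>D2 x. card (N z \<inter> N x))" by (rule edge_count) auto
  also have "\<dots> = mu * card (D2 x)" using card_common' by simp
  finally show ?thesis using mu2 by simp
qed

definition w :: "'a \<Rightarrow> 'a \<Rightarrow> 'a \<Rightarrow> 'a" where
  "w x y m = (THE v. v \<in> N m - (N x \<union> N y))"

lemma w_sym: "w x y m = w y x m"
  by (simp add: w_def Un_commute)

lemma w_eq:
  assumes "far x y" "m \<in> M x y"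
  shows "N m - (N x \<union> N y) = {w x y m}"
proof -
  obtain v where v: "N m = (N m \<inter> N x) \<union> (N m \<inter> N y) \<union> {v} \<and> v \<notin> N x \<and> v \<notin> N y"
    using M_rest[OF assms] by blast
  have "N m - (N x \<union> N y) = {v}" by (subst v) (use v in blast)
  then show ?thesis unfolding w_def by simp
qed

lemma wD:
  assumes "far x y" "m \<in> M x y"
  shows "w x y m \<in> N m" "w x y m \<notin> N x" "w x y m \<notin> N y"
    "m \<in> N (w x y m)"
  using w_eq[OF assms] symN by blast+

lemma w_unique:
  assumes "far x y" "m \<in> M x y" "v \<in> N m" "v \<notin> N x" "v \<notin> N y"
  shows "v = w x y m"
  using w_eq[OF assms(1,2)] assms(3-5) by blast

lemma M_common:
  assumes "m \<in> M x y"
  shows "card (N m \<inter> N x) = mu" "card (N m \<inter> N y) = mu"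
  using assms card_common' unfolding M_def by auto

lemma M_notin:
  assumes "far x y" "m \<in> M x y"
  shows "m \<notin> N x" "m \<notin> N y" "m \<noteq> x" "m \<noteq> y" "m \<in> D2 x" "m \<in> D2 y" "m \<in> V"
  using assms D2_V[of m x] unfolding M_def D2_def by auto

lemma farD:
  assumes "far x y"
  shows "x \<noteq> y" "y \<notin> N x" "x \<notin> N y" "N x \<inter> N y = {}" "x \<notin> D2 y" "y \<notin> D2 x"
    "p \<in> N x \<Longrightarrow> p \<notin> N y" "p \<in> N x \<Longrightarrow> N p \<inter> N y = {}" "p \<in> N x \<Longrightarrow> p \<notin> D2 y"
    "p \<in> N y \<Longrightarrow> p \<notin> D2 x"
  using assms symN unfolding far_def D2_def by blast+

lemma D2_nbrs_in_M:
  assumes "far x y" "p \<in> N x"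
  shows "N p \<inter> D2 y = N p \<inter> M x y"
  using assms farD[OF assms(1)] nbr_D2[of p x] unfolding M_def by blast

text \<open>The vertices \<open>p\<close> and \<open>y\<close> are at distance three, and the
  neighbours of \<open>p\<close> at distance two from \<open>y\<close> are exactly those in
  \<open>M x y\<close>; so both claims are instances of the counts at distance three.\<close>

lemma M_degree_lower:
  assumes far: "far x y" and p: "p \<in> N x" and ne: "N p \<inter> M x y \<noteq> {}"
  shows "mu + 1 \<le> card (N p \<inter> M x y)"
    and "card (N y \<inter> D2 p) = card (N p \<inter> M x y)"
proof -
  have y: "y \<noteq> p" "y \<notin> N p" "N p \<inter> N y = {}"
    using farD[OF far] p symN by blast+
  show eq: "card (N y \<inter> D2 p) = card (N p \<inter> M x y)"
    using card_dist3_swap[OF y] D2_nbrs_in_M[OF far p] by simp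
  have "N y \<inter> D2 p \<noteq> {}"
    using eq ne by (metis card_eq_0_iff finN finite_Int)
  then have "mu + 1 \<le> card (N p \<inter> D2 y)"
    using card_dist3_gt[of p y] y symN lam0 by (metis Int_commute le0)
  then show "mu + 1 \<le> card (N p \<inter> M x y)" using D2_nbrs_in_M[OF far p] by simp
qed

lemma M_degree_upper:
  assumes far: "far x y" and p: "p \<in> N x"
  shows "card (N p \<inter> M x y) + card (N p - {x} - M x y) = 2 * mu"
proof -
  have x: "x \<in> N p" "x \<notin> M x y" using p symN M_notin(3)[OF far, of x] by auto
  have "card (N p - {x}) = 2 * mu" using deg[OF NV[OF p]] k_eq x by simp
  moreover have "N p - {x} = (N p \<inter> M x y) \<union> (N p - {x} - M x y)" using x by blast
  ultimately show ?thesis by (metis (no_types, lifting) Diff_disjoint Int_Diff Int_commute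
      card_Un_disjoint finN finite_Diff finite_Int inf_assoc inf_bot_right)
qed

text \<open>With \<open>e\<close> the number of neighbours of \<open>p\<close> in \<open>M x y\<close>, the set \<open>T\<close> below has \<open>2 * mu + 2 - e\<close>
  elements, each adjacent to at least \<open>e - mu\<close> of these neighbours, while each of them is adjacent to
  only one element of \<open>T\<close>. Hence \<open>(2 * mu + 2 - e) * (e - mu) \<le> e\<close>.\<close>

lemma M_degree_dichotomy:
  assumes far: "far x y" and p: "p \<in> N x" and ne: "N p \<inter> M x y \<noteq> {}"
  shows "card (N p \<inter> M x y) = mu + 1 \<or> card (N p \<inter> M x y) = 2 * mu"
    and "card (N p \<inter> M x y) = mu + 1 \<Longrightarrow> inj_on (w x y) (N p \<inter> M x y)"
    and "card (N p \<inter> M x y) = mu + 1 \<Longrightarrow> m \<in> N p \<inter> M x y \<Longrightarrow> N p - {x} - M x y \<subseteq> N (w x y m)"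
    and "card (N p \<inter> M x y) = mu + 1 \<Longrightarrow> mu = 2"
proof -
  let ?E = "N p \<inter> M x y" and ?R = "N p - {x} - M x y"
  let ?e = "card ?E"
  define T where "T = D2 p - N x - N y"
  have xp: "x \<in> N p" and pV: "p \<in> V" and xV: "x \<in> V" using p symN NV NV' by blast+
  have sum: "?e + card ?R = 2 * mu" using M_degree_upper[OF far p] .
  have lo: "mu + 1 \<le> ?e" using M_degree_lower(1)[OF far p ne] .
  have sub: "N x - {p} \<subseteq> D2 p" using nbr_D2[of x p] xp by blast
  have "card (N x - {p}) = 2 * mu" using deg[OF xV] p k_eq by simp
  moreover have "(N x - {p}) \<inter> (N y \<inter> D2 p) = {}" using farD(4)[OF far] by blast
  ultimately have c: "card ((N x - {p}) \<union> (N y \<inter> D2 p)) = 2 * mu + ?e"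
    using M_degree_lower(2)[OF far p ne] by (subst card_Un_disjoint) auto
  have T_eq: "T = D2 p - ((N x - {p}) \<union> (N y \<inter> D2 p))"
    unfolding T_def D2_def by blast
  \<comment> \<open>Of the \<open>4 * mu + 2\<close> vertices of \<open>D2 p\<close>,
    \<open>2 * mu\<close> are next to \<open>x\<close> and \<open>?e\<close> are next to
    \<open>y\<close>.\<close>
  have cT: "card T = 2 * mu + 2 - ?e"
  proof -
    have "card T = card (D2 p) - (2 * mu + ?e)"
      unfolding T_eq using sub c by (subst card_Diff_subset) auto
    then show ?thesis using card_D2[OF pV] k_eq by simp
  qed
  have finT: "finite T" unfolding T_def by simp
  have wT: "N m \<inter> T = {w x y m}" if m: "m \<in> ?E" for m
  proof -
    have m': "m \<in> M x y" "p \<in> N m" "m \<in> N p" using m symN by auto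
    have wm: "w x y m \<in> N m" "w x y m \<notin> N x" "w x y m \<notin> N y" "m \<in> N (w x y m)"
      using wD[OF far m'(1)] by auto
    have "w x y m \<noteq> p" using wm(2) p by metis
    then have "w x y m \<in> D2 p" using mem_D2I[of "w x y m" p m] m' wm by blast
    then have "w x y m \<in> N m \<inter> T" using wm unfolding T_def by blast
    moreover have "v = w x y m" if "v \<in> N m \<inter> T" for v
      using w_unique[OF far m'(1), of v] that unfolding T_def by blast
    ultimately show ?thesis by blast
  qed
  have "(\<Sum>m\<in>?E. card (N m \<inter> T)) = ?e" using wT by simp
  then have sumT: "(\<Sum>t\<in>T. card (N t \<inter> ?E)) = ?e"
    using edge_count[of ?E T] finT by simp
  have split: "card (N t \<inter> ?E) + card (N t \<inter> ?R) = mu" if t: "t \<in> T" for t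
  proof -
    have "N t \<inter> N p = (N t \<inter> ?E) \<union> (N t \<inter> ?R)"
      using t symN unfolding T_def by blast
    moreover have "card (N t \<inter> N p) = mu" using t card_common' unfolding T_def by blast
    ultimately show ?thesis by (subst card_Un_disjoint[symmetric]) auto
  qed
  have cR: "card (N t \<inter> ?R) \<le> card ?R" for t by (intro card_mono) auto
  have low: "?e - mu \<le> card (N t \<inter> ?E)" if t: "t \<in> T" for t
    using split[OF t] cR[of t] sum by linarith
  have "card T * (?e - mu) \<le> ?e"
    using sum_bounded_below[of T "?e - mu" "\<lambda>t. card (N t \<inter> ?E)"] low sumT by simp
  then have ineq: "(2 * mu + 2 - ?e) * (?e - mu) \<le> ?e" using cT by simp
  \<comment> \<open>With \<open>?e = mu + j\<close> and \<open>mu = j + i\<close> the factors become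
    \<open>i + 2\<close> and \<open>j\<close>, and the bound reduces to
    \<open>i * j \<le> i\<close>. Here \<open>i = 0\<close> is the case \<open>2 * mu\<close> and
    \<open>j = 1\<close> the case \<open>mu + 1\<close>.\<close>
  obtain j where j: "?e = mu + j" "1 \<le> j" using lo by (metis add_le_cancel_left le_Suc_ex le_add1 add.assoc)
  obtain i where i: "mu = j + i" using sum j by (metis add_left_cancel le_add1 le_Suc_ex mult_2 nat_add_left_cancel_le)
  have "(i + 2) * j \<le> 2 * j + i" using ineq unfolding j(1) i by simp
  then have "i * j \<le> i * 1" by (simp add: algebra_simps)
  then have "i = 0 \<or> j = 1" using j(2) by (subst (asm) mult_le_cancel1) auto
  then show "?e = mu + 1 \<or> ?e = 2 * mu" using j i by auto
  assume e1: "?e = mu + 1"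
  \<comment> \<open>Now \<open>T\<close> has as many elements as there are edges between
    \<open>T\<close> and \<open>?E\<close>. So every \<open>t\<close> in \<open>T\<close> has just
    one neighbour in \<open>?E\<close>, and its other \<open>mu - 1\<close> common neighbours with
    \<open>p\<close> exhaust \<open>?R\<close>.\<close>
  have cT1: "card T = mu + 1" using cT e1 by simp
  have ge1: "1 \<le> card (N t \<inter> ?E)" if "t \<in> T" for t using low[OF that] e1 by simp
  have eq1: "card (N t \<inter> ?E) = 1" if t: "t \<in> T" for t
  proof (rule ccontr)
    assume "card (N t \<inter> ?E) \<noteq> 1"
    then have "1 < card (N t \<inter> ?E)" using ge1[OF t] by simp
    then have "(\<Sum>t\<in>T. 1) < (\<Sum>t\<in>T. card (N t \<inter> ?E))"
      using ge1 t by (intro sum_strict_mono_ex1[OF finT]) auto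
    then show False using sumT cT1 e1 by simp
  qed
  have RT: "?R \<subseteq> N t" if t: "t \<in> T" for t
  proof -
    have "card (N t \<inter> ?R) = card ?R" using split[OF t] eq1[OF t] sum e1 by simp
    then have "N t \<inter> ?R = ?R" by (intro card_subset_eq) auto
    then show ?thesis by blast
  qed
  show "inj_on (w x y) ?E"
  proof (rule inj_onI)
    fix a b assume a: "a \<in> ?E" and b: "b \<in> ?E" and ab: "w x y a = w x y b"
    have t: "w x y a \<in> T" using wT[OF a] by blast
    obtain c where c: "N (w x y a) \<inter> ?E = {c}" using eq1[OF t] by (auto simp: card_1_singleton_iff)
    have "a \<in> N (w x y a)" using wD(4)[OF far, of a] a by blast
    moreover have "b \<in> N (w x y a)" unfolding ab using wD(4)[OF far, of b] b by blast
    ultimately have "a = c" "b = c" using c a b by blast+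
    then show "a = b" by simp
  qed
  show "?R \<subseteq> N (w x y m)" if "m \<in> ?E" using RT wT[OF that] by blast
  \<comment> \<open>For larger \<open>mu\<close>, the set \<open>?R\<close> of size
    \<open>mu - 1\<close> contains two vertices, and these would share all \<open>mu + 1\<close>
    elements of \<open>T\<close>.\<close>
  show "mu = 2"
  proof (rule ccontr)
    assume "mu \<noteq> 2"
    then have R2: "2 \<le> card ?R" using sum e1 mu2 by linarith
    then obtain r where r: "r \<in> ?R" using card_ge_2_ex by metis
    obtain s where s: "s \<in> ?R" "s \<noteq> r" using card_ge_2_ex[OF R2, of r] by (elim bexE)
    have sub: "T \<subseteq> N r \<inter> N s" using RT r s symN by blast
    moreover have "T \<noteq> {}" using cT1 by auto
    ultimately have "s \<in> D2 r" using s mem_D2I[of s r] by blast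
    then have "card (N r \<inter> N s) = mu" by (rule card_common)
    moreover have "card T \<le> card (N r \<inter> N s)" using sub by (intro card_mono) auto
    ultimately show False using cT1 by simp
  qed
qed

text \<open>For \<open>far x y\<close> these are the neighbours of \<open>x\<close> at distance
  three from \<open>y\<close>, that is, those on a shortest path from \<open>x\<close> to
  \<open>y\<close>.\<close>

definition P :: "'a \<Rightarrow> 'a \<Rightarrow> 'a set" where
  "P x y = {p \<in> N x. N p \<inter> M x y \<noteq> {}}"

lemma finP [simp, intro]: "finite (P x y)"
  unfolding P_def by simp

lemma sum_P:
  assumes "far x y"
  shows "(\<Sum>p\<in>P x y. card (N p \<inter> M x y)) = mu * card (M x y)"
proof -
  have "N m \<inter> P x y = N m \<inter> N x" if "m \<in> M x y" for m
    unfolding P_def using that symN by blast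
  then have "card (N m \<inter> P x y) = mu" if "m \<in> M x y" for m
    using that M_common by simp
  then show ?thesis using edge_count[of "P x y" "M x y"] by simp
qed

text \<open>Count edges between \<open>?E\<close> and \<open>?Q\<close>. Each \<open>m\<close> in
  \<open>?E\<close> has \<open>mu - 1\<close> neighbours next to \<open>x\<close> besides
  \<open>p\<close>, all in \<open>?Q\<close>, whereas each \<open>q\<close> in \<open>?Q\<close>
  shares only \<open>mu - 1\<close> neighbours with \<open>p\<close> besides \<open>x\<close>. Hence
  \<open>?Q\<close> is at least as large as \<open>?E\<close>.\<close>

lemma card_P_gt:
  assumes far: "far x y" and p: "p \<in> P x y"
  shows "card (N p \<inter> M x y) + 1 \<le> card (P x y)"
proof -
  let ?E = "N p \<inter> M x y" and ?Q = "P x y - {p}"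
  have px: "p \<in> N x" using p unfolding P_def by simp
  have c1: "card (N m \<inter> ?Q) = mu - 1" if m: "m \<in> ?E" for m
  proof -
    have "N m \<inter> ?Q = (N m \<inter> N x) - {p}" unfolding P_def using m symN by blast
    moreover have "p \<in> N m \<inter> N x" using m px symN by blast
    ultimately show ?thesis using M_common(1)[of m x y] m by simp
  qed
  have c2: "card (N q \<inter> ?E) \<le> mu - 1" if q: "q \<in> ?Q" for q
  proof -
    have qx: "q \<in> N x" "q \<noteq> p" using q unfolding P_def by auto
    then have "q \<in> D2 p" using px symN mem_D2I by blast
    then have "card (N q \<inter> N p) = mu" by (rule card_common')
    moreover have "N q \<inter> ?E \<subseteq> (N q \<inter> N p) - {x}" using M_notin(3)[OF far] by blast
    moreover have "x \<in> N q \<inter> N p" using qx px symN by blast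
    ultimately show ?thesis
      by (metis card_Diff_singleton card_mono finN finite_Diff finite_Int)
  qed
  have "card ?E * (mu - 1) = (\<Sum>m\<in>?E. card (N m \<inter> ?Q))" using c1 by simp
  also have "\<dots> = (\<Sum>q\<in>?Q. card (N q \<inter> ?E))" by (rule edge_count) auto
  also have "\<dots> \<le> card ?Q * (mu - 1)"
    using sum_bounded_above[of ?Q "\<lambda>q. card (N q \<inter> ?E)" "mu - 1"] c2 by simp
  finally have "card ?E \<le> card ?Q" using mu2 by simp
  then show ?thesis using card.remove[OF finP p] by linarith
qed

lemma card_P_ge4:
  assumes "dist4 x y"
  shows "4 \<le> card (P x y)"
proof -
  obtain m where far: "far x y" and m: "m \<in> M x y"
    using assms unfolding dist4_def by blast
  then obtain p where p: "p \<in> N x" "p \<in> N m" unfolding M_def D2_def by blast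
  then have pP: "p \<in> P x y" and ne: "N p \<inter> M x y \<noteq> {}" unfolding P_def using m symN by blast+
  show ?thesis using card_P_gt[OF far pP] M_degree_lower(1)[OF far p(1) ne] mu2 by simp
qed

text \<open>If \<open>w x y m\<close> were in \<open>M x y\<close>, its own extra neighbour would be
  \<open>m\<close>. But it is at distance two from a common neighbour \<open>p\<close> of
  \<open>m\<close> and \<open>x\<close>, and their second common neighbour \<open>u\<close> is next
  to neither \<open>x\<close>, which would give a triangle, nor \<open>y\<close>, which would be too
  close.\<close>

lemma w_notin_M:
  assumes far: "far x y" and m: "m \<in> M x y"
  shows "w x y m \<notin> M x y"
proof
  assume wM: "w x y m \<in> M x y"
  have ww: "u = m" if "u \<in> N (w x y m)" "u \<notin> N x" "u \<notin> N y" for u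
    using w_unique[OF far wM that] w_unique[OF far wM wD(4)[OF far m]] M_notin[OF far m] by simp
  obtain p where p: "p \<in> N x" "p \<in> N m" using m unfolding M_def D2_def by blast
  have mE: "m \<in> N p \<inter> M x y" using p m symN by blast
  have "\<exists>u. u \<in> N (w x y m) \<and> u \<in> N p \<and> u \<noteq> x \<and> u \<noteq> m"
  proof -
    have "w x y m \<noteq> p" using wD(2)[OF far m] p by metis
    then have d: "w x y m \<in> D2 p" using wD(4)[OF far m] mE mem_D2I by blast
    then have c2: "2 \<le> card (N (w x y m) \<inter> N p)" using card_common' mu2 by simp
    obtain u where u: "u \<in> N (w x y m) \<inter> N p" "u \<noteq> m"
      using card_ge_2_ex[OF c2, of m] by blast
    moreover have "x \<notin> N (w x y m)" using wD(2)[OF far m] symN by blast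
    ultimately show ?thesis by blast
  qed
  then obtain u where u: "u \<in> N (w x y m)" "u \<in> N p" "u \<noteq> x" "u \<noteq> m" by blast
  have "u \<notin> N x" using u p tri symN by blast
  moreover have "u \<notin> N y" using u p farD(8)[OF far] by blast
  ultimately show False using ww u by blast
qed

end

section \<open>All degrees equal to 2 * mu: the bipartite case\<close>

context triangle_free_nbhd
begin

text \<open>Full degrees force \<open>P x y = N x\<close> and \<open>M x y = D2 x = D2 y\<close>.
  Only the set \<open>W\<close> of values of \<open>w\<close> is then left to control: it turns out
  to consist of two nonadjacent vertices, which with \<open>N x\<close> and \<open>N y\<close> form
  the second half.\<close>

lemma bipartite_halves:
  assumes d: "dist4 x y" and full: "\<And>p. p \<in> P x y \<Longrightarrow> card (N p \<inter> M x y) = 2 * mu"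
  shows "\<exists>U X. V = U \<union> X \<and> U \<inter> X = {} \<and> card U = 2 * k + 2 \<and> card X = 2 * k + 2 \<and>
    (\<forall>u\<in>U. N u \<subseteq> X) \<and> (\<forall>v\<in>X. N v \<subseteq> U)"
proof -
  let ?M = "M x y"
  define W where "W = w x y ` ?M"
  have far: "far x y" using dist4_far[OF d] .
  have xV: "x \<in> V" and yV: "y \<in> V" using dist4_V[OF d] by auto
  obtain p where p: "p \<in> P x y" using card_P_ge4[OF d] by fastforce
  have "k \<le> card (P x y)" using card_P_gt[OF far p] full[OF p] k_eq by simp
  then have PN: "P x y = N x" using deg[OF xV] unfolding P_def by (intro card_seteq) auto
  have "(\<Sum>p\<in>P x y. card (N p \<inter> ?M)) = k * (2 * mu)" using full PN deg[OF xV] by simp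
  moreover have "k * (2 * mu) = mu * (2 * k)" by simp
  ultimately have "mu * (2 * k) = mu * card ?M" using sum_P[OF far] by presburger
  then have cM: "card ?M = 2 * k" using mu2 by simp
  have Mx: "?M = D2 x"
    by (rule card_subset_eq) (use card_D2[OF xV] cM in \<open>auto simp: M_def\<close>)
  have My: "?M = D2 y"
    by (rule card_subset_eq) (use card_D2[OF yV] cM in \<open>auto simp: M_def\<close>)
  have Nx: "N p \<subseteq> insert x ?M" if "p \<in> N x" for p using nbr_D2[OF that] Mx by blast
  have Ny: "N p \<subseteq> insert y ?M" if "p \<in> N y" for p using nbr_D2[OF that] My by blast
  have NM: "N m \<subseteq> N x \<union> N y \<union> W" if "m \<in> ?M" for m
    using w_eq[OF far that] that unfolding W_def by blast
  have finW: "finite W" unfolding W_def by simp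
  have W1: "v \<notin> N x" "v \<notin> N y" "v \<notin> ?M" "v \<noteq> x" "v \<noteq> y" "v \<in> V" if v: "v \<in> W" for v
  proof -
    obtain m where m: "m \<in> ?M" "v = w x y m" using v unfolding W_def by blast
    show "v \<notin> N x" "v \<notin> N y" "v \<notin> ?M" using wD[OF far m(1)] w_notin_M[OF far m(1)] m(2) by simp_all
    have "v \<in> N m" using wD(1)[OF far m(1)] m(2) by simp
    then show "v \<noteq> x" "v \<noteq> y" "v \<in> V" using M_notin(1,2)[OF far m(1)] symN NV by blast+
  qed
  \<comment> \<open>A value of \<open>w\<close> is at distance three from \<open>x\<close>, and
    \<open>D2 x\<close> is all of \<open>?M\<close>.\<close>
  have W3: "mu + 1 \<le> card (N v \<inter> ?M)" if v: "v \<in> W" for v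
  proof -
    obtain m where m: "m \<in> ?M" "v = w x y m" using v unfolding W_def by blast
    have vm: "m \<in> N v" using wD(4)[OF far m(1)] m(2) by simp
    obtain p where p: "p \<in> N x" "p \<in> N m" using m(1) unfolding M_def D2_def by blast
    have "N x \<inter> N v = {}" using W1(3,4)[OF v] mem_D2I unfolding Mx by blast
    moreover have "p \<in> N x \<inter> D2 v"
      using p vm W1(1)[OF v] mem_D2I[of p v m] symN by blast
    ultimately have "mu + 1 \<le> card (N v \<inter> D2 x)"
      using card_dist3_gt[of v x] W1(1,4)[OF v] lam0 by blast
    then show ?thesis using Mx by simp
  qed
  have "N m \<inter> W = {w x y m}" if m: "m \<in> ?M" for m
  proof -
    have "w x y m \<in> N m \<inter> W" using wD(1)[OF far m] m unfolding W_def by blast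
    moreover have "v = w x y m" if "v \<in> N m \<inter> W" for v
      using w_unique[OF far m, of v] W1(1,2)[of v] that by blast
    ultimately show ?thesis by blast
  qed
  then have "(\<Sum>m\<in>?M. card (N m \<inter> W)) = 2 * k" using cM by simp
  then have sumW: "(\<Sum>v\<in>W. card (N v \<inter> ?M)) = 2 * k"
    using edge_count[of ?M W] finW by simp
  have NvM: "card (N v \<inter> ?M) \<le> k" if "v \<in> W" for v
    using deg[OF W1(6)[OF that]] by (metis card_mono finN inf_le1)
  \<comment> \<open>There are \<open>2 * k\<close> edges between \<open>?M\<close> and
    \<open>W\<close>, and each element of \<open>W\<close> is on at least \<open>mu + 1\<close> and
    at most \<open>k\<close> of them. This leaves two or three elements.\<close>
  have "card W * (mu + 1) \<le> 4 * mu + 2"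
    using sum_bounded_below[of W "mu + 1" "\<lambda>v. card (N v \<inter> ?M)"] W3 sumW k_eq by simp
  then have W_le: "card W \<le> 3"
  proof (rule contrapos_pp)
    assume "\<not> card W \<le> 3"
    then have "4 * (mu + 1) \<le> card W * (mu + 1)" by (intro mult_le_mono1) simp
    then show "\<not> card W * (mu + 1) \<le> 4 * mu + 2" by simp
  qed
  have "2 * k \<le> card W * k"
    using sum_bounded_above[of W "\<lambda>v. card (N v \<inter> ?M)" k] NvM sumW by simp
  then have W_ge: "2 \<le> card W" using k_eq by (simp only: mult_le_cancel2)
  \<comment> \<open>A neighbour \<open>z\<close> of \<open>v\<close> outside
    \<open>?M \<union> W\<close> would be at distance four from \<open>x\<close> with
    \<open>P z x\<close> inside \<open>W\<close>, but \<open>P z x\<close> has at least four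
    elements.\<close>
  have NW: "N v \<subseteq> ?M \<union> W" if v: "v \<in> W" for v
  proof (rule subsetI, rule ccontr)
    fix z assume z: "z \<in> N v" "z \<notin> ?M \<union> W"
    have zx: "z \<notin> N x" "z \<noteq> x"
      using Nx[of z] W1(1,3,4)[OF v] z(1) symN by blast+
    have zy: "z \<notin> N y" "z \<noteq> y" using Ny[of z] W1(2,3,5)[OF v] z(1) symN by blast+
    have zD: "N x \<inter> N z = {}" using mem_D2I[of z x] zx z(2) Mx by blast
    have "N p \<inter> N z = {}" if "p \<in> N x" for p
      using Nx[OF that] zx zy z(2) NM symN by blast
    then have farz: "far x z" unfolding far_def using zx zD by blast
    obtain m where m: "m \<in> ?M" "m \<in> N v" using W3[OF v] by (metis Int_iff card.empty
        equals0I le_add2 not_one_le_zero order_trans)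
    have "m \<noteq> z" using m z by blast
    then have "m \<in> D2 z" using m z symN mem_D2I[of m z v] by blast
    then have d4: "dist4 z x" using farz m Mx dist4_sym unfolding dist4_def M_def by blast
    have "P z x \<subseteq> W"
    proof
      fix u assume "u \<in> P z x"
      then have uz: "u \<in> N z" and ne: "N u \<inter> M z x \<noteq> {}" unfolding P_def by auto
      from ne obtain n where n: "n \<in> N u" "n \<in> M z x" by blast
      have "M z x \<subseteq> ?M" unfolding Mx by (simp add: M_def)
      then have u: "u \<in> N z" "n \<in> N u" "n \<in> ?M" using uz n by auto
      have "u \<in> N x \<union> N y \<union> W" using NM[OF u(3)] u(2) symN by blast
      moreover have "u \<notin> N x" using u(1) zD by blast
      moreover have "u \<notin> N y" using Ny[of u] u(1) z(2) zy symN by blast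
      ultimately show "u \<in> W" by blast
    qed
    then have "card (P z x) \<le> 3" using W_le card_mono[OF finW] by (meson order_trans)
    then show False using card_P_ge4[OF d4] by simp
  qed
  have split: "card (N v \<inter> W) + card (N v \<inter> ?M) = k" if v: "v \<in> W" for v
  proof -
    have "N v = (N v \<inter> W) \<union> (N v \<inter> ?M)" using NW[OF v] by blast
    moreover have "(N v \<inter> W) \<inter> (N v \<inter> ?M) = {}" using W1(3) by blast
    ultimately show ?thesis using deg[OF W1(6)[OF v]] by (metis card_Un_disjoint finN finite_Int)
  qed
  have "(\<Sum>v\<in>W. card (N v \<inter> W) + card (N v \<inter> ?M)) = card W * k" using split by simp
  then have sumWW: "(\<Sum>v\<in>W. card (N v \<inter> W)) + 2 * k = card W * k"
    using sumW by (simp add: sum.distrib)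
  \<comment> \<open>With three elements, the degrees inside \<open>W\<close> would sum to
    \<open>3 * k - 2 * k\<close>, which is at least five. A triangle-free graph on three vertices
    has at most two edges, so degree sum at most four.\<close>
  have "card W \<noteq> 3"
  proof
    assume 3: "card W = 3"
    then obtain a b c where abc: "W = {a, b, c}" "a \<noteq> b" "a \<noteq> c" "b \<noteq> c"
      by (auto simp: card_3_iff)
    have s: "card (N a \<inter> W) + card (N b \<inter> W) + card (N c \<inter> W) = k"
      using sumWW 3 abc by simp
    have tr: "\<not> (a \<in> N b \<and> b \<in> N c \<and> c \<in> N a)" using tri' symN by blast
    have "N a \<inter> W = (if b \<in> N a then {b} else {}) \<union> (if c \<in> N a then {c} else {})"
      "N b \<inter> W = (if a \<in> N b then {a} else {}) \<union> (if c \<in> N b then {c} else {})"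
      "N c \<inter> W = (if a \<in> N c then {a} else {}) \<union> (if b \<in> N c then {b} else {})"
      using abc(1) irr by auto
    then have "card (N a \<inter> W) + card (N b \<inter> W) + card (N c \<inter> W) \<le> 4"
      using tr abc symN_iff[of a b] symN_iff[of a c] symN_iff[of b c] by auto
    then show False using s k_eq mu2 by simp
  qed
  then have W2: "card W = 2" using W_le W_ge by simp
  then have "(\<Sum>v\<in>W. card (N v \<inter> W)) = 0" using sumWW by simp
  then have "card (N v \<inter> W) = 0" if "v \<in> W" for v using finW that by simp
  then have "N v \<inter> W = {}" if "v \<in> W" for v using that by simp
  then have NWM: "N v \<subseteq> ?M" if "v \<in> W" for v using that NW by blast
  let ?U = "insert x (insert y ?M)" and ?X = "N x \<union> N y \<union> W"
  have UX: "N u \<subseteq> ?X" if "u \<in> ?U" for u using that NM by blast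
  have XU: "N v \<subseteq> ?U" if "v \<in> ?X" for v using that Nx Ny NWM by blast
  have MV: "?M \<subseteq> V" using M_notin(7)[OF far] by blast
  have "?U \<union> ?X = V"
  proof (rule conn)
    show "?U \<union> ?X \<subseteq> V" using xV yV MV NV W1(6) by blast
    show "N s \<subseteq> ?U \<union> ?X" if "s \<in> ?U \<union> ?X" for s using that UX XU by blast
  qed simp
  moreover have "?U \<inter> ?X = {}"
    using W1 M_notin[OF far] farD[OF far] irr by blast
  moreover have "card ?U = 2 * k + 2"
    using M_notin(3,4)[OF far] farD(1)[OF far] cM by (subst card_insert_disjoint; auto)+
  moreover have "card ?X = 2 * k + 2"
  proof -
    have "card (N x \<union> N y) = 2 * k"
      using deg[OF xV] deg[OF yV] farD(4)[OF far] by (simp add: card_Un_disjoint)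
    moreover have "(N x \<union> N y) \<inter> W = {}" using W1 by blast
    ultimately show ?thesis using W2 finW by (simp add: card_Un_disjoint)
  qed
  ultimately show ?thesis using UX XU by (intro exI[of _ ?U] exI[of _ ?X]) auto
qed

end

section \<open>Valency five\<close>

locale valency5_nbhd = triangle_free_nbhd +
  assumes mu_eq: "mu = 2"
begin

lemma k5: "k = 5"
  using k_eq mu_eq by simp

lemma three_common:
  assumes "a \<in> N x" "b \<in> N x" "c \<in> N x" "a \<in> N z" "b \<in> N z" "c \<in> N z"
    and "a \<noteq> b" "a \<noteq> c" "b \<noteq> c"
  shows "x = z"
proof (rule ccontr)
  assume "x \<noteq> z"
  then have "z \<in> D2 x" using assms(1,4) mem_D2I by metis
  then have "card (N x \<inter> N z) = 2" using card_common mu_eq by simp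
  moreover have "card {a, b, c} \<le> card (N x \<inter> N z)" using assms by (intro card_mono) auto
  ultimately show False using assms(7-9) by simp
qed

text \<open>As \<open>mu = 2\<close>, two neighbours of \<open>x\<close> have one further common
  neighbour. This labels the vertices of \<open>D2 x\<close> by the pairs of neighbours of
  \<open>x\<close>, in both directions (\<open>pt_D2\<close>, \<open>D2_pt\<close>).\<close>

definition pt :: "'a \<Rightarrow> 'a \<Rightarrow> 'a \<Rightarrow> 'a" where
  "pt x a b = (THE z. z \<in> N a \<inter> N b - {x})"

lemma pt_sym: "pt x a b = pt x b a"
  by (simp add: pt_def Int_commute)

lemma pt_Int:
  assumes "a \<in> N x" "b \<in> N x" "a \<noteq> b"
  shows "N a \<inter> N b = {x, pt x a b}" "pt x a b \<noteq> x"
proof -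
  have x: "x \<in> N a \<inter> N b" using assms symN by blast
  have "b \<in> D2 a" using x assms(3) mem_D2I[of b a x] by blast
  then have "card (N a \<inter> N b) = 2" using card_common mu_eq by simp
  then have "card (N a \<inter> N b - {x}) = 1" using x by simp
  then obtain z where z: "N a \<inter> N b - {x} = {z}" by (auto simp: card_1_singleton_iff)
  then have "pt x a b = z" unfolding pt_def by simp
  then show "N a \<inter> N b = {x, pt x a b}" "pt x a b \<noteq> x" using z x by blast+
qed

lemma pt_adj:
  assumes "a \<in> N x" "b \<in> N x" "a \<noteq> b"
  shows "pt x a b \<in> N a" "pt x a b \<in> N b" "a \<in> N (pt x a b)" "b \<in> N (pt x a b)"
  using pt_Int[OF assms] symN by blast+

lemma pt_unique:
  assumes "a \<in> N x" "b \<in> N x" "a \<noteq> b" "z \<in> N a" "z \<in> N b" "z \<noteq> x"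
  shows "z = pt x a b"
  using pt_Int[OF assms(1-3)] assms(4-6) by blast

lemma pt_D2:
  assumes "a \<in> N x" "b \<in> N x" "a \<noteq> b"
  shows "pt x a b \<in> D2 x" "N (pt x a b) \<inter> N x = {a, b}"
proof -
  show d: "pt x a b \<in> D2 x"
    using mem_D2I[of "pt x a b" x a] pt_Int(2)[OF assms] pt_adj[OF assms] assms by blast
  have "card (N (pt x a b) \<inter> N x) = 2" using card_common'[OF d] mu_eq by simp
  moreover have "{a, b} \<subseteq> N (pt x a b) \<inter> N x" using pt_adj[OF assms] assms by blast
  ultimately show "N (pt x a b) \<inter> N x = {a, b}"
    using assms(3) by (intro card_subset_eq[symmetric]) auto
qed

lemma D2_pt:
  assumes "z \<in> D2 x"
  obtains a b where "a \<in> N x" "b \<in> N x" "a \<noteq> b" "z = pt x a b" "N z \<inter> N x = {a, b}"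
proof -
  have "card (N z \<inter> N x) = 2" using card_common'[OF assms] mu_eq by simp
  then obtain a b where ab: "N z \<inter> N x = {a, b}" "a \<noteq> b" by (auto simp: card_2_iff)
  then have "a \<in> N x" "b \<in> N x" "a \<in> N z" "b \<in> N z" by blast+
  moreover have "z \<noteq> x" using assms unfolding D2_def by blast
  ultimately show thesis using that[of a b] ab pt_unique[of a x b z] symN by metis
qed

lemma pt_inj:
  assumes "a \<in> N x" "b \<in> N x" "a \<noteq> b" "c \<in> N x" "d \<in> N x" "c \<noteq> d" "pt x a b = pt x c d"
  shows "{a, b} = {c, d}"
  using pt_D2(2)[OF assms(1-3)] pt_D2(2)[OF assms(4-6)] assms(7) by metis

lemma N_first:
  assumes N: "N x = {a, b, c, d, e}" and dist: "distinct [a, b, c, d, e]"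
  shows "N a = {x, pt x a b, pt x a c, pt x a d, pt x a e}"
proof
  have mem: "a \<in> N x" "b \<in> N x" "c \<in> N x" "d \<in> N x" "e \<in> N x"
    "a \<noteq> b" "a \<noteq> c" "a \<noteq> d" "a \<noteq> e" using N dist by auto
  then show "{x, pt x a b, pt x a c, pt x a d, pt x a e} \<subseteq> N a"
    using pt_adj(1)[of a x] symN by blast
  show "N a \<subseteq> {x, pt x a b, pt x a c, pt x a d, pt x a e}"
  proof
    fix z assume z: "z \<in> N a"
    show "z \<in> {x, pt x a b, pt x a c, pt x a d, pt x a e}"
    proof (cases "z = x")
      case False
      then have "z \<in> D2 x" using mem_D2I[of z x a] mem(1) z symN by blast
      then obtain s t where st: "s \<in> N x" "t \<in> N x" "s \<noteq> t" "z = pt x s t" "N z \<inter> N x = {s, t}"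
        by (rule D2_pt)
      have "a \<in> {s, t}" using st(5) z mem(1) symN by blast
      then have "\<exists>t. t \<in> N x \<and> t \<noteq> a \<and> z = pt x a t" using st pt_sym by auto
      then show ?thesis using N by blast
    qed simp
  qed
qed

section \<open>Vertices at distance two from x that are missing from M\<close>

lemma M_degree_34:
  assumes "far x y" "p \<in> P x y"
  shows "card (N p \<inter> M x y) = 3 \<or> card (N p \<inter> M x y) = 4"
  using M_degree_dichotomy(1)[of x y p] assms mu_eq unfolding P_def by auto

text \<open>As \<open>r\<close> is missing, \<open>p\<close> is in the equality case of
  \<open>M_degree_dichotomy\<close>, with \<open>r\<close> as its only neighbour besides
  \<open>x\<close> outside \<open>M x y\<close>. There \<open>w\<close> is injective on the three
  neighbours of \<open>p\<close> in \<open>M x y\<close>, and its values are adjacent to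
  \<open>r\<close>. Together with the two neighbours next to \<open>x\<close> they make up
  \<open>N r\<close>, so by \<open>w_notin_M\<close> none of them is in
  \<open>M x y\<close>.\<close>

lemma missing_point:
  assumes far: "far x y" and r: "r \<in> D2 x" "r \<notin> M x y" and p: "p \<in> P x y" "p \<in> N r"
  shows "card (N p \<inter> M x y) = 3"
    and "N p = insert x (insert r (N p \<inter> M x y))"
    and "inj_on (w x y) (N p \<inter> M x y)"
    and "N r = (N r \<inter> N x) \<union> w x y ` (N p \<inter> M x y)"
    and "N r - N x = w x y ` (N p \<inter> M x y)"
    and "card (N r - N x) = 3"
    and "N r \<inter> M x y = {}"
proof -
  let ?E = "N p \<inter> M x y" and ?R = "N p - {x} - M x y"
  have px: "p \<in> N x" and ne: "?E \<noteq> {}" using p unfolding P_def by auto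
  have "r \<noteq> x" using r unfolding D2_def by blast
  then have rR: "r \<in> ?R" using r p symN by blast
  then have "card ?R \<noteq> 0" by auto
  then show e3: "card ?E = 3" using M_degree_34[OF far p(1)] M_degree_upper[OF far px] mu_eq by auto
  then have "card ?R = 1" using M_degree_upper[OF far px] mu_eq by simp
  then obtain u where u: "?R = {u}" by (rule card_1_singletonE)
  have R: "?R = {r}" using rR unfolding u by simp
  moreover have "x \<in> N p" using px symN by blast
  ultimately show "N p = insert x (insert r ?E)" by blast
  have e3': "card ?E = mu + 1" using e3 mu_eq by simp
  show inj: "inj_on (w x y) ?E" using M_degree_dichotomy(2)[OF far px ne e3'] .
  have sub: "w x y ` ?E \<subseteq> N r"
  proof
    fix v assume "v \<in> w x y ` ?E"
    then obtain m where m: "m \<in> ?E" "v = w x y m" by blast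
    then have "?R \<subseteq> N v" using M_degree_dichotomy(3)[OF far px ne e3' m(1)] by simp
    then show "v \<in> N r" using rR symN by blast
  qed
  have dis: "w x y ` ?E \<inter> N x = {}" using wD(2)[OF far] by blast
  have c3: "card (w x y ` ?E) = 3" using card_image[OF inj] e3 by simp
  have "card (N r \<inter> N x) = 2" using card_common' r mu_eq by simp
  moreover have "r \<in> V" using r D2_V by blast
  ultimately have c3': "card (N r - N x) = 3"
    using deg k5 card_Diff_subset_Int[of "N r" "N x"] by simp
  then show "card (N r - N x) = 3" .
  show T: "N r - N x = w x y ` ?E"
    by (rule card_subset_eq[symmetric]) (use sub dis c3 c3' in auto)
  then show "N r = (N r \<inter> N x) \<union> w x y ` ?E" by blast
  show "N r \<inter> M x y = {}"
  proof (rule ccontr)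
    assume "N r \<inter> M x y \<noteq> {}"
    then obtain z where z: "z \<in> N r" "z \<in> M x y" by blast
    then have "z \<in> w x y ` ?E" using T M_notin(1)[OF far] by blast
    then show False using w_notin_M[OF far] z(2) by blast
  qed
qed

text \<open>At most one of the five neighbours of \<open>x\<close> is outside \<open>P x y\<close>,
  and \<open>r\<close> sees two of them.\<close>

lemma D2_meets_P:
  assumes d: "dist4 x y" and r: "r \<in> D2 x"
  obtains p where "p \<in> P x y" "p \<in> N r"
proof -
  have "card (N r \<inter> N x) = 2" using card_common'[OF r] mu_eq by simp
  moreover have "card (N x - P x y) \<le> 1"
    using card_P_ge4[OF d] deg[of x] dist4_V[OF d] k5
    by (subst card_Diff_subset) (auto simp: P_def)
  ultimately have "\<not> N r \<inter> N x \<subseteq> N x - P x y"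
    by (metis card_mono finN finite_Diff le_trans not_less_eq_eq numeral_2_eq_2 One_nat_def order_refl)
  then show thesis using that by blast
qed

text \<open>A value of \<open>w\<close> in \<open>D2 x\<close> would be a vertex missing from
  \<open>M x y\<close> with the neighbour \<open>m\<close> in \<open>M x y\<close>, against
  \<open>missing_point\<close>. So it is at distance three from \<open>x\<close>, where
  \<open>card_dist3_gt\<close> applies.\<close>

lemma w_at_dist3:
  assumes d: "dist4 x y" and m: "m \<in> M x y"
  shows "w x y m \<notin> D2 x" "N x \<inter> N (w x y m) = {}" "w x y m \<noteq> x"
    "3 \<le> card (N (w x y m) \<inter> D2 x)"
proof -
  have far: "far x y" using dist4_far[OF d] .
  let ?v = "w x y m"
  have wd: "?v \<in> N m" "?v \<notin> N x" "?v \<notin> N y" "m \<in> N ?v" by (rule wD[OF far m])+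
  show nD: "?v \<notin> D2 x"
  proof
    assume v: "?v \<in> D2 x"
    obtain p where "p \<in> P x y" "p \<in> N ?v" by (rule D2_meets_P[OF d v])
    then have "N ?v \<inter> M x y = {}" using missing_point(7)[OF far v w_notin_M[OF far m]] by blast
    then show False using wd(4) m by blast
  qed
  show nx: "?v \<noteq> x" using wd(4) M_notin(1)[OF far m] by metis
  show ne: "N x \<inter> N ?v = {}" using nD nx mem_D2I by blast
  obtain p where p: "p \<in> N x" "p \<in> N m" using m unfolding M_def D2_def by blast
  have "p \<noteq> ?v" using p(1) wd(2) by metis
  moreover have "m \<in> N p" using p(2) symN by blast
  ultimately have "p \<in> N x \<inter> D2 ?v" using p(1) wd(4) mem_D2I[of p ?v m] by blast
  then show "3 \<le> card (N ?v \<inter> D2 x)"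
    using card_dist3_gt[of ?v x] nx wd(2) ne lam0 mu_eq by auto
qed

lemma w_at_dist3':
  assumes "dist4 x y" and "m \<in> M x y"
  shows "w x y m \<notin> D2 y" "N y \<inter> N (w x y m) = {}" "w x y m \<noteq> y"
    "3 \<le> card (N (w x y m) \<inter> D2 y)"
  using w_at_dist3[OF dist4_sym[OF assms(1)], of m] assms(2) M_sym[of x y] w_sym[of x y] by auto

lemma missing_disjoint:
  assumes far: "far x y" and r: "r \<in> D2 x - M x y" and s: "s \<in> D2 x - M x y" and "r \<noteq> s"
    and P: "P x y = N x"
  shows "N r \<inter> N s \<inter> N x = {}"
proof (rule ccontr)
  assume "N r \<inter> N s \<inter> N x \<noteq> {}"
  then obtain p where p: "p \<in> N r" "p \<in> N s" "p \<in> P x y" using P by blast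
  have "N p = insert x (insert r (N p \<inter> M x y))" using missing_point(2)[OF far, of r p] r p by blast
  moreover have "s \<in> N p" "s \<noteq> x" using p s symN unfolding D2_def by blast+
  ultimately show False using s \<open>r \<noteq> s\<close> by blast
qed

text \<open>A vertex of \<open>P x y\<close> has at most one missing neighbour, so the missing
  vertices give disjoint pairs among five neighbours of \<open>x\<close>.\<close>

lemma card_missing_le_2:
  assumes d: "dist4 x y" and P: "P x y = N x"
  shows "card (D2 x - M x y) \<le> 2"
proof -
  have far: "far x y" using dist4_far[OF d] .
  let ?R = "D2 x - M x y"
  have "card (\<Union>r\<in>?R. N r \<inter> N x) = (\<Sum>r\<in>?R. card (N r \<inter> N x))"
  proof (rule card_UN_disjoint)
    show "\<forall>r\<in>?R. \<forall>s\<in>?R. r \<noteq> s \<longrightarrow> N r \<inter> N x \<inter> (N s \<inter> N x) = {}"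
    proof (intro ballI impI)
      fix r s assume "r \<in> ?R" "s \<in> ?R" "r \<noteq> s"
      from missing_disjoint[OF far this P] show "N r \<inter> N x \<inter> (N s \<inter> N x) = {}" by blast
    qed
  qed auto
  also have "\<dots> = 2 * card ?R" using card_common' mu_eq by simp
  finally have "2 * card ?R = card (\<Union>r\<in>?R. N r \<inter> N x)" by simp
  also have "\<dots> \<le> card (N x)" by (intro card_mono) auto
  also have "\<dots> = 5" using deg dist4_V[OF d] k5 by simp
  finally show ?thesis by simp
qed

lemma card_missing:
  assumes "dist4 x y"
  shows "card (D2 x - M x y) = 10 - card (M x y)"
  using card_D2[of x] dist4_V[OF assms] k5
  by (subst card_Diff_subset) (auto simp: M_def)

text \<open>At least eight vertices of \<open>M x y\<close> send at least 16 edges to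
  \<open>P y x\<close>. By \<open>card_P_gt\<close>, a set \<open>P y x\<close> of four elements
  could take only 4 * 3 of them.\<close>

lemma P_sym_full:
  assumes d: "dist4 x y" and P: "P x y = N x"
  shows "P y x = N y"
proof -
  have far: "far x y" "far y x" using d dist4_sym[OF d] unfolding dist4_def by auto
  have M8: "8 \<le> card (M x y)" using card_missing_le_2[OF d P] card_missing[OF d] by simp
  have "(\<Sum>p\<in>P y x. card (N p \<inter> M y x)) = 2 * card (M x y)"
    using sum_P[OF far(2)] mu_eq M_sym[of x y] by simp
  moreover have "(\<Sum>p\<in>P y x. card (N p \<inter> M y x)) \<le> card (P y x) * (card (P y x) - 1)"
    using sum_bounded_above[of "P y x" "\<lambda>p. card (N p \<inter> M y x)" "card (P y x) - 1"]
      card_P_gt[OF far(2)] by fastforce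
  ultimately have *: "16 \<le> card (P y x) * (card (P y x) - 1)" using M8 by simp
  have "5 \<le> card (P y x)"
  proof (rule ccontr)
    assume "\<not> 5 \<le> card (P y x)"
    then have "card (P y x) * (card (P y x) - 1) \<le> 4 * 3" by (intro mult_le_mono) auto
    then show False using * by simp
  qed
  then show ?thesis using deg[of y] dist4_V[OF d] k5
    by (intro card_seteq) (auto simp: P_def)
qed

lemma w_Int:
  assumes far: "far x y" and m: "m \<in> M x y"
  shows "N m \<inter> w x y ` M x y = {w x y m}"
proof -
  have "w x y m \<in> N m \<inter> w x y ` M x y" using wD(1)[OF far m] m by blast
  moreover have "v = w x y m" if v: "v \<in> N m \<inter> w x y ` M x y" for v
  proof -
    obtain m' where m': "m' \<in> M x y" "v = w x y m'" using v by blast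
    have "v \<notin> N x" "v \<notin> N y" using wD(2,3)[OF far m'(1)] m'(2) by auto
    then show ?thesis using w_unique[OF far m, of v] v by blast
  qed
  ultimately show ?thesis by blast
qed

lemma sum_w:
  assumes far: "far x y"
  shows "(\<Sum>v\<in>w x y ` M x y. card (N v \<inter> M x y)) = card (M x y)"
proof -
  have "(\<Sum>m\<in>M x y. card (N m \<inter> w x y ` M x y)) = card (M x y)"
    using w_Int[OF far] by simp
  then show ?thesis using edge_count[of "M x y" "w x y ` M x y"] by simp
qed

text \<open>If only \<open>r\<close> is missing on the side of \<open>x\<close> and \<open>r'\<close> on the side of \<open>y\<close>, then the three further
  neighbours \<open>T\<close> of \<open>r\<close> are all adjacent to \<open>r'\<close>, which is one common neighbour too many.\<close>

lemma not_one_missing: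
  assumes d: "dist4 x y" and P: "P x y = N x"
  shows "card (D2 x - M x y) \<noteq> 1"
proof
  assume "card (D2 x - M x y) = 1"
  then obtain r where R: "D2 x - M x y = {r}" by (auto simp: card_1_singleton_iff)
  have d': "dist4 y x" using dist4_sym d .
  have P': "P y x = N y" using P_sym_full d P .
  have far: "far x y" "far y x" using d d' unfolding dist4_def by auto
  let ?M = "M x y" and ?w = "w x y"
  let ?W = "?w ` ?M"
  have Ms: "M y x = ?M" and ws: "w y x = ?w" using M_sym w_sym by (auto simp: fun_eq_iff)
  have cM: "card ?M = 9" using card_missing[OF d] R by simp
  have "card (D2 y - ?M) = 1" using card_missing[OF d'] cM Ms by simp
  then obtain r' where R': "D2 y - ?M = {r'}" by (auto simp: card_1_singleton_iff)
  have r: "r \<in> D2 x" "r \<notin> ?M" and r': "r' \<in> D2 y" "r' \<notin> ?M" using R R' by auto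
  have rr: "r \<noteq> r'" using r r' unfolding M_def by blast
  have Dx: "D2 x = insert r ?M" and Dy: "D2 y = insert r' ?M" using R R' unfolding M_def by auto
  obtain a b where ab: "a \<in> N x" "b \<in> N x" "a \<noteq> b" "r = pt x a b" "N r \<inter> N x = {a, b}"
    using D2_pt[OF r(1)] by metis
  obtain a' b' where ab': "a' \<in> N y" "b' \<in> N y" "a' \<noteq> b'" "r' = pt y a' b'" "N r' \<inter> N y = {a', b'}"
    using D2_pt[OF r'(1)] by metis
  define T where "T = N r - N x"
  define T' where "T' = N r' - N y"
  have a: "a \<in> P x y" "a \<in> N r" and b: "b \<in> P x y" "b \<in> N r" using ab P by blast+
  have a': "a' \<in> P y x" "a' \<in> N r'" using ab' P' by blast+
  have Ta: "T = ?w ` (N a \<inter> ?M)" unfolding T_def using missing_point(5)[OF far(1) r a] .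
  have Tb: "T = ?w ` (N b \<inter> ?M)" unfolding T_def using missing_point(5)[OF far(1) r b] .
  have cT: "card T = 3" unfolding T_def using missing_point(6)[OF far(1) r a] .
  have cT': "card T' = 3" unfolding T'_def
    using missing_point(6)[OF far(2) r'(1) _ a'] r'(2) Ms by simp
  have T'W: "T' \<subseteq> ?W" unfolding T'_def
    using missing_point(5)[OF far(2) r'(1) _ a'] r'(2) Ms ws by auto
  have TW: "T \<subseteq> ?W" using Ta by blast
  have finT: "finite T" "finite T'" unfolding T_def T'_def by auto
  have noT: "\<not> T \<subseteq> N r'"
  proof
    assume "T \<subseteq> N r'"
    then have sub: "T \<subseteq> N r \<inter> N r'" unfolding T_def by blast
    then have "3 \<le> card (N r \<inter> N r')" using cT card_mono[OF _ sub] by simp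
    moreover have "r' \<in> D2 r"
    proof -
      obtain t where "t \<in> T" using cT by fastforce
      then show ?thesis using mem_D2I[of r' r t] rr sub by blast
    qed
    ultimately show False using card_common[of r' r] mu_eq by simp
  qed
  \<comment> \<open>\<open>T'\<close> is a three-element subset of \<open>?W\<close>, so
    \<open>?W = T\<close> would give \<open>T' = T\<close>, which is contained in
    \<open>N r'\<close>.\<close>
  have "T \<noteq> ?W"
  proof
    assume "T = ?W"
    then have "T' = T" using T'W cT cT' by (intro card_subset_eq[OF finT(1)]) auto
    then show False using noT unfolding T'_def by blast
  qed
  then obtain v0 where v0: "v0 \<in> ?W" "v0 \<notin> T" using TW by blast
  define M0 where "M0 = ?M - (N a \<union> N b)"
  have cM0: "card M0 = 3"
  proof -
    have "(N a \<inter> ?M) \<inter> (N b \<inter> ?M) = {}"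
      using pt_Int(1)[OF ab(1-3)] ab(4) r(2) M_notin(3)[OF far(1)] by blast
    moreover have "card (N a \<inter> ?M) = 3" "card (N b \<inter> ?M) = 3"
      using missing_point(1)[OF far(1) r a] missing_point(1)[OF far(1) r b] by auto
    ultimately have "card ((N a \<inter> ?M) \<union> (N b \<inter> ?M)) = 6" by (subst card_Un_disjoint) auto
    moreover have "M0 = ?M - ((N a \<inter> ?M) \<union> (N b \<inter> ?M))" unfolding M0_def by blast
    moreover have "card (?M - ((N a \<inter> ?M) \<union> (N b \<inter> ?M))) = card ?M - card ((N a \<inter> ?M) \<union> (N b \<inter> ?M))"
      by (rule card_Diff_subset) auto
    ultimately show ?thesis using cM by simp
  qed
  have finM0: "finite M0" unfolding M0_def by simp
  have c3: "3 \<le> card (N v \<inter> D2 x)" "3 \<le> card (N v \<inter> D2 y)" if v: "v \<in> ?W" for v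
    using v w_at_dist3(4)[OF d] w_at_dist3'(4)[OF d] by auto
  \<comment> \<open>A value \<open>v\<close> outside \<open>T\<close> is not adjacent to
    \<open>r\<close>, so its at least three neighbours in \<open>D2 x\<close> lie in
    \<open>?M\<close>. They avoid \<open>a\<close> and \<open>b\<close>, because \<open>?w\<close>
    maps the neighbours of \<open>a\<close> and \<open>b\<close> in \<open>?M\<close> into
    \<open>T\<close>. This leaves exactly the three vertices of \<open>M0\<close>.\<close>
  have out: "N v \<inter> ?M = M0" if v: "v \<in> ?W" "v \<notin> T" for v
  proof -
    obtain n where n: "n \<in> ?M" "v = ?w n" using v by blast
    have vx: "v \<notin> N x" "v \<notin> N y" using wD(2,3)[OF far(1) n(1)] n(2) by auto
    have "r \<notin> N v" using v(2) vx symN unfolding T_def by blast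
    then have "N v \<inter> D2 x = N v \<inter> ?M" unfolding Dx by blast
    then have 3: "3 \<le> card (N v \<inter> ?M)" using c3(1)[OF v(1)] by simp
    have "N v \<inter> ?M \<subseteq> M0"
    proof
      fix m assume m: "m \<in> N v \<inter> ?M"
      then have "v = ?w m" using w_unique[OF far(1), of m v] vx symN by blast
      then have "m \<notin> N a" "m \<notin> N b" using v(2) m Ta Tb by blast+
      then show "m \<in> M0" using m unfolding M0_def by blast
    qed
    then show ?thesis using 3 cM0 finM0 by (intro card_seteq) auto
  qed
  \<comment> \<open>Every value outside \<open>T\<close> is adjacent to all of \<open>M0\<close>,
    but a vertex of \<open>?M\<close> is adjacent to just one value.\<close>
  have Wv0: "?W = insert v0 T"
  proof -
    obtain m where m: "m \<in> M0" using cM0 by fastforce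
    have "v = v0" if v: "v \<in> ?W" "v \<notin> T" for v
    proof -
      have "v \<in> N m \<inter> ?W" using out[OF v] m v symN by blast
      moreover have "v0 \<in> N m \<inter> ?W" using out[OF v0] m v0 symN by blast
      moreover have "m \<in> ?M" using m unfolding M0_def by blast
      ultimately show ?thesis using w_Int[OF far(1), of m] by simp
    qed
    then show ?thesis using v0 TW by blast
  qed
  \<comment> \<open>Three of the nine edges between \<open>?M\<close> and \<open>?W\<close> end in
    \<open>v0\<close>. The other six give each element of \<open>T\<close> exactly two, as it has at
    least three neighbours in \<open>D2 x\<close> and \<open>r\<close> is the only one outside
    \<open>?M\<close>. From the side of \<open>y\<close>, the third one has to be
    \<open>r'\<close>.\<close>
  have "(\<Sum>v\<in>T. card (N v \<inter> ?M)) = 6"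
    using sum_w[OF far(1)] cM out[OF v0] cM0 v0(2) finT(1) unfolding Wv0 by simp
  have ge2: "2 \<le> card (N v \<inter> ?M)" if v: "v \<in> T" for v
  proof -
    have "N v \<inter> D2 x \<subseteq> insert r (N v \<inter> ?M)" using Dx by blast
    then have "card (N v \<inter> D2 x) \<le> card (insert r (N v \<inter> ?M))" by (intro card_mono) auto
    also have "\<dots> \<le> Suc (card (N v \<inter> ?M))" by (simp add: card_insert_if)
    finally show ?thesis using c3(1)[of v] v TW by auto
  qed
  have eq2: "card (N v \<inter> ?M) = 2" if v: "v \<in> T" for v
  proof (rule ccontr)
    assume "card (N v \<inter> ?M) \<noteq> 2"
    then have "2 < card (N v \<inter> ?M)" using ge2[OF v] by simp
    then have "(\<Sum>t\<in>T. 2) < (\<Sum>t\<in>T. card (N t \<inter> ?M))"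
      using ge2 v by (intro sum_strict_mono_ex1[OF finT(1)]) auto
    then show False using \<open>(\<Sum>v\<in>T. card (N v \<inter> ?M)) = 6\<close> cT by simp
  qed
  have "T \<subseteq> N r'"
  proof
    fix v assume v: "v \<in> T"
    show "v \<in> N r'"
    proof (rule ccontr)
      assume "v \<notin> N r'"
      then have "r' \<notin> N v" using symN by blast
      then have "N v \<inter> D2 y = N v \<inter> ?M" unfolding Dy by blast
      then show False using eq2[OF v] c3(2)[of v] v TW by auto
    qed
  qed
  then show False using noT by blast
qed

end

section \<open>Two missing pairs: the product of an edge with \<open>Lam\<close>\<close>

context valency5_nbhd
begin

lemma M_nbrs:
  assumes "far x y" "m \<in> M x y"
  shows "N m = (N m \<inter> N x) \<union> (N m \<inter> N y) \<union> {w x y m}"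
  using w_eq[OF assms] by blast

text \<open>The second common neighbour of \<open>m\<close> and \<open>m'\<close> is not next to
  \<open>x\<close>, and it cannot be the extra neighbour of both; so it is next to \<open>y\<close>.
  This transports incidences from \<open>x\<close> to \<open>y\<close>.\<close>

lemma M_share:
  assumes far: "far x y" and m: "m \<in> M x y" "m' \<in> M x y" and w: "w x y m \<noteq> w x y m'"
    and a: "N m \<inter> N m' \<inter> N x = {a}"
  obtains b where "b \<in> N y" "b \<in> N m" "b \<in> N m'"
proof -
  have "m \<noteq> m'" using w by metis
  moreover have am: "a \<in> N m" "a \<in> N m'" using a by blast+
  ultimately have "m' \<in> D2 m" using mem_D2I[of m' m a] by blast
  then have c2: "2 \<le> card (N m \<inter> N m')" using card_common mu_eq by simp
  obtain b where b: "b \<in> N m \<inter> N m'" "b \<noteq> a" using card_ge_2_ex[OF c2, of a] by blast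
  have "b \<notin> N x" using b a by blast
  moreover have "\<not> (b = w x y m \<and> b = w x y m')" using w by blast
  moreover have "b \<in> N x \<or> b \<in> N y \<or> b = w x y m" "b \<in> N x \<or> b \<in> N y \<or> b = w x y m'"
    using M_nbrs[OF far m(1)] M_nbrs[OF far m(2)] b by blast+
  ultimately show thesis using that b by blast
qed

lemma N_eq_five:
  assumes "v \<in> V" "distinct xs" "length xs = 5" "set xs \<subseteq> N v"
  shows "N v = set xs"
  by (rule card_subset_eq[symmetric]) (use assms deg k5 in \<open>auto simp: distinct_card\<close>)

lemma pt_neI:
  assumes "s \<in> N y" "u \<in> N y" "s \<noteq> u" "t \<in> N y" "t \<in> N p" "t \<noteq> s" "t \<noteq> u"
  shows "p \<noteq> pt y s u"
  using pt_D2(2)[OF assms(1-3)] assms(4-7) by blast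

text \<open>\<open>a, b, c, d, e\<close> label the neighbours of \<open>x\<close> such that the graph with edge set \<open>M x y\<close> lacks
  exactly the edges \<open>ab\<close> and \<open>cd\<close>.\<close>

definition lab :: "'a \<Rightarrow> 'a \<Rightarrow> 'a \<Rightarrow> 'a \<Rightarrow> 'a \<Rightarrow> 'a \<Rightarrow> 'a \<Rightarrow> bool" where
  "lab x y a b c d e \<longleftrightarrow> dist4 x y \<and> distinct [a, b, c, d, e] \<and> N x = {a, b, c, d, e} \<and>
     D2 x - M x y = {pt x a b, pt x c d}"

lemma lab_swap12: "lab x y a b c d e \<Longrightarrow> lab x y b a c d e"
  unfolding lab_def by (auto simp: pt_sym[of x b a])

lemma lab_swap34: "lab x y a b c d e \<Longrightarrow> lab x y a b d c e"
  unfolding lab_def by (auto simp: pt_sym[of x d c])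

lemma lab_swap: "lab x y a b c d e \<Longrightarrow> lab x y c d a b e"
  unfolding lab_def by (auto simp: insert_commute)

lemma lab_exists:
  assumes d: "dist4 x y" and P: "P x y = N x" and c2: "card (D2 x - M x y) = 2"
  shows "\<exists>a b c d e. lab x y a b c d e"
proof -
  have far: "far x y" using dist4_far[OF d] .
  obtain r s where rs: "D2 x - M x y = {r, s}" "r \<noteq> s" using c2 by (auto simp: card_2_iff)
  then have r: "r \<in> D2 x - M x y" and s: "s \<in> D2 x - M x y" by auto
  obtain a b where ab: "a \<in> N x" "b \<in> N x" "a \<noteq> b" "r = pt x a b" "N r \<inter> N x = {a, b}"
    using D2_pt[of r x] r by blast
  obtain a' b' where ab': "a' \<in> N x" "b' \<in> N x" "a' \<noteq> b'" "s = pt x a' b'" "N s \<inter> N x = {a', b'}"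
    using D2_pt[of s x] s by blast
  have dis: "{a, b} \<inter> {a', b'} = {}"
    using missing_disjoint[OF far r s rs(2) P] ab(5) ab'(5) by blast
  have "card (N x) = 5" using deg dist4_V[OF d] k5 by simp
  moreover have "card {a, b, a', b'} = 4" using ab(3) ab'(3) dis by auto
  ultimately have "card (N x - {a, b, a', b'}) = 1"
    using ab ab' by (subst card_Diff_subset) auto
  then obtain e where e: "N x - {a, b, a', b'} = {e}" by (rule card_1_singletonE)
  have "N x = {a, b, a', b', e}" using e ab(1,2) ab'(1,2) by blast
  moreover have "distinct [a, b, a', b', e]" using e ab(3) ab'(3) dis by auto
  ultimately have "lab x y a b a' b' e"
    unfolding lab_def using d rs ab(4) ab'(4) by simp
  then show ?thesis by blast
qed

lemma lab_pts:
  assumes l: "lab x y a b c d e"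
  shows "D2 x = {pt x a b, pt x a c, pt x a d, pt x a e, pt x b c, pt x b d, pt x b e,
      pt x c d, pt x c e, pt x d e}"
    and "distinct [pt x a b, pt x a c, pt x a d, pt x a e, pt x b c, pt x b d, pt x b e,
      pt x c d, pt x c e, pt x d e]"
    and "M x y = {pt x a c, pt x a d, pt x b c, pt x b d, pt x a e, pt x b e, pt x c e, pt x d e}"
proof -
  have N: "N x = {a, b, c, d, e}" and di: "distinct [a, b, c, d, e]"
    and R: "D2 x - M x y = {pt x a b, pt x c d}"
    using l unfolding lab_def by auto
  have mem: "a \<in> N x" "b \<in> N x" "c \<in> N x" "d \<in> N x" "e \<in> N x" using N by auto
  show D: "D2 x = {pt x a b, pt x a c, pt x a d, pt x a e, pt x b c, pt x b d, pt x b e,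
      pt x c d, pt x c e, pt x d e}"
  proof
    show "D2 x \<subseteq> {pt x a b, pt x a c, pt x a d, pt x a e, pt x b c, pt x b d, pt x b e,
      pt x c d, pt x c e, pt x d e}"
    proof
      fix z assume "z \<in> D2 x"
      then obtain s t where "s \<in> N x" "t \<in> N x" "s \<noteq> t" "z = pt x s t" by (rule D2_pt)
      then show "z \<in> {pt x a b, pt x a c, pt x a d, pt x a e, pt x b c, pt x b d, pt x b e,
        pt x c d, pt x c e, pt x d e}"
        using N pt_sym by auto
    qed
    show "{pt x a b, pt x a c, pt x a d, pt x a e, pt x b c, pt x b d, pt x b e,
      pt x c d, pt x c e, pt x d e} \<subseteq> D2 x"
      using mem di pt_D2(1)[of _ x] by simp
  qed
  have "card (D2 x) = 10" using card_D2 k5 dist4_V[of x y] l unfolding lab_def by auto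
  then show di': "distinct [pt x a b, pt x a c, pt x a d, pt x a e, pt x b c, pt x b d, pt x b e,
      pt x c d, pt x c e, pt x d e]"
    by (intro card_distinct) (simp only: list.set D[symmetric], simp)
  have "M x y = D2 x - {pt x a b, pt x c d}" using R unfolding M_def by blast
  moreover have "{p1, p2, p3, p4, p5, p6, p7, p8, p9, p10} - {p1, p8} =
      {p2, p3, p5, p6, p4, p7, p9, p10}"
    if "distinct [p1, p2, p3, p4, p5, p6, p7, p8, p9, p10]"
    for p1 p2 p3 p4 p5 p6 p7 p8 p9 p10 :: 'a
    using that by auto
  ultimately show "M x y = {pt x a c, pt x a d, pt x b c, pt x b d, pt x a e, pt x b e, pt x c e, pt x d e}"
    using di' unfolding D by metis
qed

text \<open>The fibres of \<open>w x y\<close> are the perfect matchings of the four-cycle on \<open>a, c, b, d\<close> and the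
  pairs joining \<open>e\<close> to the two nonadjacent pairs.\<close>

lemma lab_w:
  assumes l: "lab x y a b c d e"
  defines "r \<equiv> pt x a b" and "s \<equiv> pt x c d"
  defines "al \<equiv> w x y (pt x a c)" and "be \<equiv> w x y (pt x a d)"
    and "ga \<equiv> w x y (pt x a e)" and "de \<equiv> w x y (pt x c e)"
  shows "w x y (pt x b d) = al" "w x y (pt x b c) = be"
    "w x y (pt x b e) = ga" "w x y (pt x d e) = de"
    "distinct [al, be, ga, de]"
    "N r = {a, b, al, be, ga}" "N s = {c, d, al, be, de}"
proof -
  have d4: "dist4 x y" and N: "N x = {a, b, c, d, e}" and di: "distinct [a, b, c, d, e]"
    and R: "D2 x - M x y = {pt x a b, pt x c d}"
    using l unfolding lab_def by auto
  have far: "far x y" using dist4_far[OF d4] .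
  note D = lab_pts(1)[OF l] and di' = lab_pts(2)[OF l] and M = lab_pts(3)[OF l]
  have mem: "a \<in> N x" "b \<in> N x" "c \<in> N x" "d \<in> N x" "e \<in> N x" using N by auto
  have xM: "x \<notin> M x y" using M_notin(3)[OF far] by blast
  have rM: "pt x a b \<notin> M x y" "pt x c d \<notin> M x y" using R by blast+
  have E: "N a \<inter> M x y = {pt x a c, pt x a d, pt x a e}"
    "N b \<inter> M x y = {pt x b c, pt x b d, pt x b e}"
    "N c \<inter> M x y = {pt x a c, pt x b c, pt x c e}"
    "N d \<inter> M x y = {pt x a d, pt x b d, pt x d e}"
  proof -
    have "N a = {x, pt x a b, pt x a c, pt x a d, pt x a e}" using N_first[OF N di] .
    then show "N a \<inter> M x y = {pt x a c, pt x a d, pt x a e}" using M xM rM by auto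
    have "N b = {x, pt x b a, pt x b c, pt x b d, pt x b e}"
      by (rule N_first) (use N di in auto)
    then show "N b \<inter> M x y = {pt x b c, pt x b d, pt x b e}" using M xM rM pt_sym[of x b a] by auto
    have "N c = {x, pt x c a, pt x c b, pt x c d, pt x c e}"
      by (rule N_first) (use N di in auto)
    then show "N c \<inter> M x y = {pt x a c, pt x b c, pt x c e}"
      using M xM rM pt_sym[of x c a] pt_sym[of x c b] by auto
    have "N d = {x, pt x d a, pt x d b, pt x d c, pt x d e}"
      by (rule N_first) (use N di in auto)
    then show "N d \<inter> M x y = {pt x a d, pt x b d, pt x d e}"
      using M xM rM pt_sym[of x d a] pt_sym[of x d b] pt_sym[of x d c] by auto
  qed
  have P: "a \<in> P x y" "b \<in> P x y" "c \<in> P x y" "d \<in> P x y"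
    unfolding P_def using E mem by auto
  have rN: "N r \<inter> N x = {a, b}" and sN: "N s \<inter> N x = {c, d}" and rD: "r \<in> D2 x" "s \<in> D2 x"
    unfolding r_def s_def using pt_D2[of a x b] pt_D2[of c x d] mem di by auto
  have rM': "r \<notin> M x y" "s \<notin> M x y" unfolding r_def s_def using rM by auto
  have in_r: "a \<in> N r" "b \<in> N r" "c \<in> N s" "d \<in> N s" using rN sN by blast+
  note Ra = missing_point[OF far rD(1) rM'(1) P(1) in_r(1)]
  note Rb = missing_point[OF far rD(1) rM'(1) P(2) in_r(2)]
  note Rc = missing_point[OF far rD(2) rM'(2) P(3) in_r(3)]
  note Rd = missing_point[OF far rD(2) rM'(2) P(4) in_r(4)]
  let ?w = "w x y"
  have Ta: "N r - N x = {al, be, ga}" using Ra(5) unfolding E al_def be_def ga_def by simp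
  have Tb: "N r - N x = {?w (pt x b c), ?w (pt x b d), ?w (pt x b e)}" using Rb(5) unfolding E by simp
  have Tc: "N s - N x = {al, ?w (pt x b c), de}" using Rc(5) unfolding E al_def de_def by simp
  have Td: "N s - N x = {be, ?w (pt x b d), ?w (pt x d e)}" using Rd(5) unfolding E be_def by simp
  have card3: "u \<noteq> v \<and> u \<noteq> z \<and> v \<noteq> z" if "card {u, v, z} = 3" for u v z :: 'a
    using that by (auto simp: card_insert_if split: if_splits)
  have ia: "al \<noteq> be \<and> al \<noteq> ga \<and> be \<noteq> ga" using card3 Ra(6) unfolding Ta by blast
  have ib: "?w (pt x b c) \<noteq> ?w (pt x b d) \<and> ?w (pt x b c) \<noteq> ?w (pt x b e) \<and> ?w (pt x b d) \<noteq> ?w (pt x b e)"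
    using card3 Rb(6) unfolding Tb by blast
  have ic: "al \<noteq> ?w (pt x b c) \<and> al \<noteq> de \<and> ?w (pt x b c) \<noteq> de"
    using card3 Rc(6) unfolding Tc by blast
  have id: "be \<noteq> ?w (pt x b d) \<and> be \<noteq> ?w (pt x d e) \<and> ?w (pt x b d) \<noteq> ?w (pt x d e)"
    using card3 Rd(6) unfolding Td by blast
  have rs: "r \<noteq> s" using di' unfolding r_def s_def by simp
  \<comment> \<open>\<open>r\<close> and \<open>s\<close> already share \<open>al\<close> and
    \<open>be\<close>, and a third common neighbour would identify them. The vertices
    \<open>pt x b d\<close> and \<open>pt x b c\<close> lie next to one neighbour of
    \<open>r\<close> and one of \<open>s\<close>, so their values are such common
    neighbours.\<close>
  have com: "z = al \<or> z = be" if "z \<in> N r" "z \<in> N s" for z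
  proof (rule ccontr)
    assume "\<not> ?thesis"
    moreover have "al \<in> N r" "al \<in> N s" "be \<in> N r" "be \<in> N s" using Ta Tc Td by blast+
    ultimately have "r = s" using three_common[of al r be z s] that ia by blast
    then show False using rs by simp
  qed
  have "?w (pt x b d) = al \<or> ?w (pt x b d) = be" using com Tb Td by blast
  then show bd: "?w (pt x b d) = al" using id by metis
  have "?w (pt x b c) = al \<or> ?w (pt x b c) = be" using com Tb Tc by blast
  then show bc: "?w (pt x b c) = be" using ic by metis
  have "?w (pt x b e) \<in> {al, be, ga}" using Ta Tb by blast
  then show "?w (pt x b e) = ga" using ib bd bc by auto
  have "?w (pt x d e) \<in> {al, be, de}" using Tc Td bc by blast
  then show "?w (pt x d e) = de" using id bd by auto
  have "ga \<noteq> de"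
  proof
    assume "ga = de"
    then have "ga \<in> N r" "ga \<in> N s" using Ta Tc by blast+
    then show False using com ia by blast
  qed
  then show "distinct [al, be, ga, de]" using ia ic bc by auto
  show "N r = {a, b, al, be, ga}" using Ta rN by blast
  show "N s = {c, d, al, be, de}" using Tc sN bc by blast
qed

text \<open>Two fibres of \<open>w\<close> cover the four-cycle and two go through the isolated
  label. The two kinds are exchanged when passing from \<open>x\<close> to \<open>y\<close>; after
  that the symmetries of \<open>lab\<close> suffice to bring the labels at \<open>y\<close> into the
  desired position.\<close>

lemma lab_aligned:
  assumes l: "lab x y a b c d e" and l': "lab y x a' b' c' d' e'"
  obtains A B C D where "lab y x A B C D e'" "pt x a e = pt y A C" "pt x a c = pt y A e'"
proof -
  have d4: "dist4 x y" using l unfolding lab_def by blast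
  have far: "far x y" "far y x" using d4 dist4_sym[OF d4] unfolding dist4_def by auto
  have M1: "M x y = {pt x a c, pt x a d, pt x b c, pt x b d, pt x a e, pt x b e, pt x c e, pt x d e}"
    using lab_pts(3)[OF l] .
  let ?r = "pt x a b" and ?s = "pt x c d" and ?w = "w x y"
  note L = lab_w[OF l]
  have ws: "w y x = ?w" using w_sym by (auto simp: fun_eq_iff)
  have Ms: "M y x = M x y" using M_sym .
  have N: "N x = {a, b, c, d, e}" and di: "distinct [a, b, c, d, e]"
    using l unfolding lab_def by auto
  have mem: "a \<in> N x" "b \<in> N x" "c \<in> N x" "d \<in> N x" "e \<in> N x" using N by auto
  have key: "?w (pt x a c) \<in> {?w (pt y A e'), ?w (pt y C e')} \<and>
      ?w (pt x a e) \<notin> {?w (pt y A e'), ?w (pt y C e')}"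
    if l2: "lab y x A B C D e'" for A B C D
  proof -
    note L2 = lab_w[OF l2, unfolded ws]
    have M2: "M x y = {pt y A C, pt y A D, pt y B C, pt y B D, pt y A e', pt y B e', pt y C e', pt y D e'}"
      using lab_pts(3)[OF l2] Ms by simp
    \<comment> \<open>A value belonging to the four-cycle on both sides would be adjacent to the two
      missing vertices of either side and to the two elements of its fibre: six neighbours in a
      graph of valency five.\<close>
    have no: "v \<noteq> ?w (pt y A C) \<and> v \<noteq> ?w (pt y A D)"
      if v: "v = ?w (pt x a c) \<or> v = ?w (pt x a d)" for v
    proof (rule ccontr)
      assume n: "\<not> ?thesis"
      have r's: "pt y A B \<notin> M x y" "pt y C D \<notin> M x y" "pt x a b \<notin> M x y" "pt x c d \<notin> M x y"
        "pt y A B \<in> D2 y" "pt y C D \<in> D2 y" "pt x a b \<in> D2 x" "pt x c d \<in> D2 x"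
        using l l2 unfolding lab_def Ms by blast+
      have ne: "pt y A B \<noteq> pt x a b" "pt y A B \<noteq> pt x c d" "pt y C D \<noteq> pt x a b" "pt y C D \<noteq> pt x c d"
        using r's unfolding M_def by auto
      have ne2: "pt y A B \<noteq> pt y C D" "pt x a b \<noteq> pt x c d"
        using lab_pts(2)[OF l] lab_pts(2)[OF l2] by auto
      have v4: "{pt y A B, pt y C D, pt x a b, pt x c d} \<subseteq> N v"
      proof -
        have "v \<in> N (pt x a b)" "v \<in> N (pt x c d)" using v L(6,7) by auto
        moreover have "v \<in> N (pt y A B)" "v \<in> N (pt y C D)" using n L2(6,7) by auto
        ultimately show ?thesis using symN by blast
      qed
      obtain m m' where m: "m \<in> M x y" "m' \<in> M x y" "m \<noteq> m'" "?w m = v" "?w m' = v"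
      proof (cases "v = ?w (pt x a c)")
        case True
        then show thesis using that[of "pt x a c" "pt x b d"] L(1) M1 lab_pts(2)[OF l] by auto
      next
        case False
        then show thesis using v that[of "pt x a d" "pt x b c"] L(2) M1 lab_pts(2)[OF l] by auto
      qed
      have mN: "m \<in> N v" "m' \<in> N v" using wD(4)[OF far(1)] m by metis+
      have "v \<in> V" using NV' mN by blast
      have "card {m, m', pt y A B, pt y C D, pt x a b, pt x c d} = 6"
      proof -
        have "m \<notin> {pt y A B, pt y C D, pt x a b, pt x c d}" "m' \<notin> {pt y A B, pt y C D, pt x a b, pt x c d}"
          using r's(1-4) m(1,2) by blast+
        then show ?thesis using m(3) ne ne2 by simp
      qed
      moreover have "card {m, m', pt y A B, pt y C D, pt x a b, pt x c d} \<le> card (N v)"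
        using v4 mN by (intro card_mono) auto
      ultimately show False using deg[OF \<open>v \<in> V\<close>] k5 by simp
    qed
    have Weq: "{?w (pt x a c), ?w (pt x a d), ?w (pt x a e), ?w (pt x c e)} =
        {?w (pt y A C), ?w (pt y A D), ?w (pt y A e'), ?w (pt y C e')}"
    proof -
      have "?w ` M x y = {?w (pt x a c), ?w (pt x a d), ?w (pt x a e), ?w (pt x c e)}"
        unfolding M1 using L(1-4) by auto
      moreover have "?w ` M x y = {?w (pt y A C), ?w (pt y A D), ?w (pt y A e'), ?w (pt y C e')}"
        unfolding M2 using L2(1-4) by auto
      ultimately show ?thesis by simp
    qed
    have "?w (pt x a c) \<in> {?w (pt y A e'), ?w (pt y C e')}"
      "?w (pt x a d) \<in> {?w (pt y A e'), ?w (pt y C e')}"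
      using Weq no by blast+
    then show ?thesis using L(5) by auto
  qed
  have ae: "pt x a e \<in> M x y" and ac: "pt x a c \<in> M x y" using M1 by auto
  \<comment> \<open>By \<open>key\<close>, \<open>pt x a e\<close> is an edge of the four-cycle at
    \<open>y\<close>, and the label swaps act transitively on these edges.\<close>
  have step1: "\<exists>A B C D. lab y x A B C D e' \<and> pt x a e = pt y A C"
  proof -
    note k = key[OF l']
    note L2 = lab_w[OF l', unfolded ws]
    have "pt x a e \<in> {pt y a' c', pt y a' d', pt y b' c', pt y b' d', pt y a' e', pt y b' e', pt y c' e', pt y d' e'}"
      using ae lab_pts(3)[OF l'] Ms by simp
    moreover have "pt x a e \<noteq> pt y a' e'" "pt x a e \<noteq> pt y b' e'" "pt x a e \<noteq> pt y c' e'" "pt x a e \<noteq> pt y d' e'"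
      using k L2(3,4) by auto
    ultimately have "pt x a e \<in> {pt y a' c', pt y a' d', pt y b' c', pt y b' d'}" by simp
    then show ?thesis
      using l' lab_swap12[OF l'] lab_swap34[OF l'] lab_swap12[OF lab_swap34[OF l']] by blast
  qed
  then obtain A B C D where l2: "lab y x A B C D e'" and AC: "pt x a e = pt y A C" by blast
  note L2 = lab_w[OF l2, unfolded ws]
  have N2: "N y = {A, B, C, D, e'}" and di2: "distinct [A, B, C, D, e']"
    using l2 unfolding lab_def by auto
  have mem2: "A \<in> N y" "B \<in> N y" "C \<in> N y" "D \<in> N y" "e' \<in> N y" using N2 by auto
  have nAC: "N (pt x a e) \<inter> N y = {A, C}" unfolding AC using pt_D2(2)[of A y C] mem2 di2 by auto
  have "N (pt x a e) \<inter> N x = {a, e}" "N (pt x a c) \<inter> N x = {a, c}"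
    using pt_D2(2)[of a x e] pt_D2(2)[of a x c] mem di by auto
  then have int: "N (pt x a e) \<inter> N (pt x a c) \<inter> N x = {a}" using di by auto
  have "?w (pt x a e) \<noteq> ?w (pt x a c)" using L(5) by auto
  \<comment> \<open>\<open>pt x a c\<close> shares a neighbour of \<open>y\<close> with
    \<open>pt x a e\<close>, hence contains \<open>A\<close> or \<open>C\<close>; by its fibre it
    also contains \<open>e'\<close>.\<close>
  then obtain t where t: "t \<in> N y" "t \<in> N (pt x a e)" "t \<in> N (pt x a c)"
    using M_share[OF far(1) ae ac _ int] by metis
  have tAC: "t = A \<or> t = C" using t nAC by blast
  have "pt x a c \<in> {pt y A C, pt y A D, pt y B C, pt y B D, pt y A e', pt y B e', pt y C e', pt y D e'}"
    using ac lab_pts(3)[OF l2] Ms by simp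
  moreover have "pt x a c \<noteq> pt y A C" "pt x a c \<noteq> pt y A D" "pt x a c \<noteq> pt y B C" "pt x a c \<noteq> pt y B D"
    using key[OF l2] L2(1,2,5) by auto
  moreover have "pt x a c \<noteq> pt y B e'"
    by (rule pt_neI[OF mem2(2,5) _ t(1,3)]) (use tAC di2 in auto)
  moreover have "pt x a c \<noteq> pt y D e'"
    by (rule pt_neI[OF mem2(4,5) _ t(1,3)]) (use tAC di2 in auto)
  ultimately have "pt x a c = pt y A e' \<or> pt x a c = pt y C e'" by simp
  then show thesis
  proof
    assume "pt x a c = pt y A e'"
    then show thesis using that[OF l2 AC] by simp
  next
    assume "pt x a c = pt y C e'"
    then show thesis using that[OF lab_swap[OF l2]] AC pt_sym[of y A C] by simp
  qed
qed

text \<open>The dictionary between pairs at \<open>x\<close> and pairs at \<open>y\<close>. The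
  fibres of \<open>w\<close> are the same from both sides; with \<open>M_share\<close> and
  \<open>three_common\<close> the two given equations determine all others.\<close>

lemma lab_match:
  assumes l: "lab x y a b c d e" and l': "lab y x A B C D E"
    and ae: "pt x a e = pt y A C" and ac: "pt x a c = pt y A E"
  shows "pt x b d = pt y B E" "pt x b e = pt y B D" "pt x a d = pt y C E" "pt x b c = pt y D E"
    "pt x c e = pt y A D" "pt x d e = pt y B C"
    "w x y (pt x a e) = w x y (pt y A C)" "w x y (pt x c e) = w x y (pt y A D)"
    "w x y (pt x a c) = w x y (pt y A E)" "w x y (pt x a d) = w x y (pt y C E)"
proof -
  have d4: "dist4 x y" using l unfolding lab_def by blast
  have far: "far x y" "far y x" using d4 dist4_sym[OF d4] unfolding dist4_def by auto
  let ?w = "w x y"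
  have ws: "w y x = ?w" using w_sym by (auto simp: fun_eq_iff)
  have Ms: "M y x = M x y" using M_sym .
  note L = lab_w[OF l] and L2 = lab_w[OF l', unfolded ws]
  note D1 = lab_pts(2)[OF l]
  have M1: "M x y = {pt x a c, pt x a d, pt x b c, pt x b d, pt x a e, pt x b e, pt x c e, pt x d e}"
    using lab_pts(3)[OF l] .
  have M2: "M x y = {pt y A C, pt y A D, pt y B C, pt y B D, pt y A E, pt y B E, pt y C E, pt y D E}"
    using lab_pts(3)[OF l'] Ms by simp
  have N: "N x = {a, b, c, d, e}" and di: "distinct [a, b, c, d, e]"
    and N2: "N y = {A, B, C, D, E}" and di2: "distinct [A, B, C, D, E]"
    using l l' unfolding lab_def by auto
  have mem: "a \<in> N x" "b \<in> N x" "c \<in> N x" "d \<in> N x" "e \<in> N x" using N by auto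
  have mem2: "A \<in> N y" "B \<in> N y" "C \<in> N y" "D \<in> N y" "E \<in> N y" using N2 by auto
  have nx: "N (pt x s t) \<inter> N x = {s, t}" if "s \<in> N x" "t \<in> N x" "s \<noteq> t" for s t
    using pt_D2(2)[OF that] .
  have ny: "N (pt y s t) \<inter> N y = {s, t}" if "s \<in> N y" "t \<in> N y" "s \<noteq> t" for s t
    using pt_D2(2)[OF that] .
  have share: "\<exists>t\<in>N y. t \<in> N (pt x u v) \<and> t \<in> N (pt x u z)"
    if "pt x u v \<in> M x y" "pt x u z \<in> M x y" "?w (pt x u v) \<noteq> ?w (pt x u z)"
      "u \<in> N x" "v \<in> N x" "z \<in> N x" "u \<noteq> v" "u \<noteq> z" "v \<noteq> z" for u v z
  proof -
    have "N (pt x u v) \<inter> N (pt x u z) \<inter> N x = {u}"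
      using nx[of u v] nx[of u z] that by blast
    from M_share[OF far(1) that(1-3) this] show ?thesis by blast
  qed
  have inM: "pt x a c \<in> M x y" "pt x a d \<in> M x y" "pt x b c \<in> M x y" "pt x b d \<in> M x y"
    "pt x a e \<in> M x y" "pt x b e \<in> M x y" "pt x c e \<in> M x y" "pt x d e \<in> M x y"
    using M1 by auto
  have wae: "?w (pt x a e) = ?w (pt y A C)" and wac: "?w (pt x a c) = ?w (pt y A E)"
    using ae ac by auto
  have "?w (pt x b d) = ?w (pt y A E)" using L(1) wac by simp
  moreover have "pt x b d \<in> {pt y A C, pt y A D, pt y B C, pt y B D, pt y A E, pt y B E, pt y C E, pt y D E}"
    using inM(4) M2 by simp
  ultimately have "pt x b d \<in> {pt y A E, pt y B E}" using L2(1-5) by auto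
  then show bd: "pt x b d = pt y B E" using D1 ac by auto
  have "?w (pt x b e) = ?w (pt y A C)" using L(3) wae by simp
  moreover have "pt x b e \<in> {pt y A C, pt y A D, pt y B C, pt y B D, pt y A E, pt y B E, pt y C E, pt y D E}"
    using inM(6) M2 by simp
  ultimately have "pt x b e \<in> {pt y A C, pt y B D}" using L2(1-5) by auto
  then show be: "pt x b e = pt y B D" using D1 ae by auto
  have Weq: "{?w (pt x a c), ?w (pt x a d), ?w (pt x a e), ?w (pt x c e)} =
      {?w (pt y A C), ?w (pt y A D), ?w (pt y A E), ?w (pt y C E)}"
  proof -
    have "?w ` M x y = {?w (pt x a c), ?w (pt x a d), ?w (pt x a e), ?w (pt x c e)}"
      unfolding M1 using L(1-4) by auto
    moreover have "?w ` M x y = {?w (pt y A C), ?w (pt y A D), ?w (pt y A E), ?w (pt y C E)}"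
      unfolding M2 using L2(1-4) by auto
    ultimately show ?thesis by simp
  qed
  have Dlist: "\<And>z. z \<in> M x y \<Longrightarrow> z \<in> {pt y A C, pt y A D, pt y B C, pt y B D, pt y A E, pt y B E, pt y C E, pt y D E}"
    using M2 by simp
  obtain t where t: "t \<in> N y" "t \<in> N (pt x a e)" "t \<in> N (pt x a d)"
    using share[of a e d] inM L(5) mem di by auto
  have tAC: "t = A \<or> t = C" using t(1,2) ny[of A C] mem2 di2 unfolding ae by auto
  have ne: "pt x a d \<noteq> pt y A C" "pt x a d \<noteq> pt y A E" "pt x a d \<noteq> pt y B E" "pt x a d \<noteq> pt y B D"
    using D1 ae ac bd be by auto
  have nt: "pt x a d \<noteq> pt y D E"
    by (rule pt_neI[OF mem2(4,5) _ t(1,3)]) (use tAC di2 in auto)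
  obtain u where u: "u \<in> N y" "u \<in> N (pt x a c)" "u \<in> N (pt x a d)"
    using share[of a c d] inM L(5) mem di by auto
  have uAE: "u = A \<or> u = E" using u(1,2) ny[of A E] mem2 di2 unfolding ac by auto
  have nu: "pt x a d \<noteq> pt y B C"
    by (rule pt_neI[OF mem2(2,3) _ u(1,3)]) (use uAE di2 in auto)
  \<comment> \<open>Otherwise \<open>a\<close> and \<open>A\<close> would have three common
    neighbours and coincide, although they lie next to \<open>x\<close> and \<open>y\<close>
    respectively.\<close>
  have notAD: "pt x a d \<noteq> pt y A D"
  proof
    assume adAD: "pt x a d = pt y A D"
    have "A \<in> N (pt x a e)" "A \<in> N (pt x a c)" "A \<in> N (pt x a d)"
      using ny[of A C] ny[of A E] ny[of A D] mem2 di2 unfolding ae ac adAD by auto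
    moreover have "a \<in> N (pt x a e)" "a \<in> N (pt x a c)" "a \<in> N (pt x a d)"
      using nx[of a e] nx[of a c] nx[of a d] mem di by auto
    ultimately have "a = A"
      using three_common[of "pt x a e" a "pt x a c" "pt x a d" A] symN D1 by auto
    then show False using mem mem2 farD(7)[OF far(1)] by blast
  qed
  show ad: "pt x a d = pt y C E"
    using Dlist[OF inM(2)] ne nt nu notAD by blast
  have wad: "?w (pt x a d) = ?w (pt y C E)" using ad by simp
  have "pt x b c \<in> {pt y C E, pt y D E}"
    using Dlist[OF inM(3)] L(2) wad L2(1-5) by auto
  then show bc: "pt x b c = pt y D E" using D1 ad by auto
  \<comment> \<open>By elimination: three of the four values are already matched.\<close>
  have wce: "?w (pt x c e) = ?w (pt y A D)" using Weq wae wac wad L(5) L2(5) by auto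
  obtain v where v: "v \<in> N y" "v \<in> N (pt x a c)" "v \<in> N (pt x c e)"
    using share[of c a e] inM L(5) mem di pt_sym[of x c a] by auto
  have vAE: "v = A \<or> v = E" using v(1,2) ny[of A E] mem2 di2 unfolding ac by auto
  have "pt x c e \<noteq> pt y B C"
    by (rule pt_neI[OF mem2(2,3) _ v(1,3)]) (use vAE di2 in auto)
  moreover have "pt x c e \<in> {pt y A D, pt y B C}"
    using Dlist[OF inM(7)] wce L2(1-5) by auto
  ultimately show ce: "pt x c e = pt y A D" by blast
  have "pt x d e \<in> {pt y A D, pt y B C}"
    using Dlist[OF inM(8)] wce L(4) L2(1-5) by auto
  then show de: "pt x d e = pt y B C" using D1 ce by auto
  show "?w (pt x a e) = ?w (pt y A C)" "?w (pt x c e) = ?w (pt y A D)"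
    "?w (pt x a c) = ?w (pt y A E)" "?w (pt x a d) = ?w (pt y C E)"
    using ae ce ac ad by auto
qed

lemma D2_outside:
  assumes d: "dist4 x y" and z: "z \<in> D2 x"
  shows "z \<noteq> x" "z \<noteq> y" "z \<notin> N x" "z \<notin> N y" "z \<in> V"
  using assms farD[of x y] D2_V[OF z] unfolding dist4_def D2_def by blast+

text \<open>Two centres, ten neighbours, \<open>20 - card (M x y)\<close> vertices at distance two
  from a centre, and the values of \<open>w\<close>. This gives 28 when \<open>M x y\<close> has
  eight elements and \<open>w\<close> four values, and 32 when both numbers are six.\<close>

lemma card_near:
  assumes d: "dist4 x y"
  defines "S \<equiv> {x, y} \<union> N x \<union> N y \<union> (D2 x \<union> (D2 y - M x y)) \<union> w x y ` M x y"
  shows "S \<subseteq> V" "card S + card (M x y) = 32 + card (w x y ` M x y)"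
proof -
  let ?W = "w x y ` M x y"
  have far: "far x y" using dist4_far[OF d] .
  have d': "dist4 y x" using dist4_sym[OF d] .
  have xV: "x \<in> V" "y \<in> V" using dist4_V[OF d] by auto
  have Wout: "v \<notin> N x" "v \<notin> N y" "v \<notin> D2 x" "v \<notin> D2 y" "v \<noteq> x" "v \<noteq> y" "v \<in> V" if v: "v \<in> ?W" for v
  proof -
    obtain m where m: "m \<in> M x y" "v = w x y m" using v by blast
    show "v \<notin> N x" "v \<notin> N y" "v \<in> V"
      using wD[OF far m(1)] NV unfolding m(2) by blast+
    show "v \<notin> D2 x" "v \<notin> D2 y" "v \<noteq> x" "v \<noteq> y"
      using w_at_dist3(1,3)[OF d m(1)] w_at_dist3'(1,3)[OF d m(1)] unfolding m(2) by auto
  qed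
  show "S \<subseteq> V" unfolding S_def using xV NV Wout(7) D2_V by blast
  have 1: "card {x, y} = 2" using farD(1)[OF far] by simp
  have 2: "card (N x) = 5" "card (N y) = 5" using deg xV k5 by auto
  have "M x y \<subseteq> D2 x" unfolding M_def by simp
  then have "card (M x y) \<le> card (D2 x)" by (intro card_mono) auto
  moreover have "card (D2 x) = 10" using card_D2 xV k5 by simp
  moreover have "card (D2 y - M x y) = 10 - card (M x y)" using card_missing[OF d'] M_sym[of x y] by simp
  moreover have "card (D2 x \<union> (D2 y - M x y)) = card (D2 x) + card (D2 y - M x y)"
    by (rule card_Un_disjoint) (auto simp: M_def)
  ultimately have 3: "card (D2 x \<union> (D2 y - M x y)) + card (M x y) = 20" by simp
  have "card ({x, y} \<union> N x) = 7"
    using 1 2 irr farD[OF far] by (subst card_Un_disjoint) auto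
  moreover have "card ({x, y} \<union> N x \<union> N y) = card ({x, y} \<union> N x) + card (N y)"
    by (rule card_Un_disjoint) (use irr farD[OF far] in auto)
  moreover have "card ({x, y} \<union> N x \<union> N y \<union> (D2 x \<union> (D2 y - M x y))) =
      card ({x, y} \<union> N x \<union> N y) + card (D2 x \<union> (D2 y - M x y))"
    by (rule card_Un_disjoint) (simp_all, use D2_outside[OF d] D2_outside[OF d'] in blast)
  moreover have "card S = card ({x, y} \<union> N x \<union> N y \<union> (D2 x \<union> (D2 y - M x y))) + card ?W"
    unfolding S_def by (rule card_Un_disjoint) (simp_all, use Wout in blast)
  ultimately show "card S + card (M x y) = 32 + card ?W" using 2 3 by simp
qed

text \<open>The partner of \<open>x\<close> in the other layer is \<open>e\<close>, the neighbour in
  neither missing pair. All neighbourhoods are computed and stay within the list, so connectivity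
  makes \<open>f\<close> surjective; it is injective because the list has 28 different
  entries.\<close>

lemma lab_iso:
  assumes l: "lab x y a b c d e" and l': "lab y x A B C D E"
    and ae: "pt x a e = pt y A C" and ac: "pt x a c = pt y A E"
  obtains f :: "bool \<times> nat \<Rightarrow> 'a" where
    "inj_on f (UNIV \<times> {..<14})" "f ` (UNIV \<times> {..<14}) = V"
    "\<And>t i. i < 14 \<Longrightarrow> N (f (t, i)) = f ` insert (\<not> t, i) (Pair t ` set (lam_nbrs i))"
proof -
  have d4: "dist4 x y" using l unfolding lab_def by blast
  have d4': "dist4 y x" using dist4_sym[OF d4] .
  have far: "far x y" "far y x" using d4 d4' unfolding dist4_def by auto
  have ws: "w y x = w x y" using w_sym by (auto simp: fun_eq_iff)
  have Ms: "M y x = M x y" using M_sym .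
  note L = lab_w[OF l] and L2 = lab_w[OF l', unfolded ws]
  note match = lab_match[OF l l' ae ac]
  define r where "r = pt x a b"
  define s where "s = pt x c d"
  define r' where "r' = pt y A B"
  define s' where "s' = pt y C D"
  define pac where "pac = pt x a c"
  define pad where "pad = pt x a d"
  define pae where "pae = pt x a e"
  define pbc where "pbc = pt x b c"
  define pbd where "pbd = pt x b d"
  define pbe where "pbe = pt x b e"
  define pce where "pce = pt x c e"
  define pde where "pde = pt x d e"
  define al where "al = w x y pac"
  define be where "be = w x y pad"
  define ga where "ga = w x y pae"
  define de where "de = w x y pce"
  note x_defs = r_def s_def pac_def pad_def pae_def pbc_def pbd_def pbe_def pce_def pde_def
  have y_eqs: "pt y A B = r'" "pt y C D = s'" "pt y B E = pbd" "pt y B D = pbe" "pt y C E = pad"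
    "pt y D E = pbc" "pt y A D = pce" "pt y B C = pde" "pt y A C = pae" "pt y A E = pac"
    using match(1-6) ae ac by (simp_all add: r'_def s'_def x_defs)
  have w_eqs: "w x y pac = al" "w x y pad = be" "w x y pae = ga" "w x y pce = de"
    "w x y pbd = al" "w x y pbc = be" "w x y pbe = ga" "w x y pde = de"
    using L(1-4) by (simp_all add: al_def be_def ga_def de_def x_defs)
  have M1: "M x y = {pac, pad, pbc, pbd, pae, pbe, pce, pde}"
    using lab_pts(3)[OF l] by (simp add: x_defs)
  have N: "N x = {a, b, c, d, e}" and di: "distinct [a, b, c, d, e]"
    and N2: "N y = {A, B, C, D, E}" and di2: "distinct [A, B, C, D, E]"
    and R1: "D2 x - M x y = {r, s}" and R2: "D2 y - M x y = {r', s'}"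
    using l l' unfolding lab_def x_defs r'_def s'_def Ms by auto
  have mem: "a \<in> N x" "b \<in> N x" "c \<in> N x" "d \<in> N x" "e \<in> N x" using N by auto
  have mem2: "A \<in> N y" "B \<in> N y" "C \<in> N y" "D \<in> N y" "E \<in> N y" using N2 by auto
  \<comment> \<open>the two layers, each in the vertex order of \<open>lam_nbrs\<close>\<close>
  define vs0 where "vs0 = [x, a, b, c, d, r, pac, pad, pbc, pbd, s, E, be, al]"
  define vs1 where "vs1 = [e, pae, pbe, pce, pde, ga, A, C, D, B, de, y, s', r']"
  define W where "W = w x y ` M x y"
  have Weq: "W = {al, be, ga, de}" unfolding W_def M1 using w_eqs by auto
  have dW: "distinct [al, be, ga, de]"
    using L(5) by (simp add: al_def be_def ga_def de_def x_defs)
  have DxM: "D2 x = insert r (insert s (M x y))" and DyM: "D2 y = insert r' (insert s' (M x y))"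
    using R1 R2 unfolding M_def by blast+
  let ?S = "{x, y} \<union> N x \<union> N y \<union> (D2 x \<union> (D2 y - M x y)) \<union> W"
  have set_vs: "set (vs0 @ vs1) = ?S"
    unfolding vs0_def vs1_def DxM DyM M1 N N2 Weq using R2 M1 by auto
  have SV: "?S \<subseteq> V" and card_S: "card ?S = 28"
  proof -
    have "card (M x y) = 8"
      using lab_pts(2)[OF l] unfolding M1 x_defs by auto
    moreover have "card W = 4" unfolding Weq using dW by simp
    ultimately show "?S \<subseteq> V" "card ?S = 28" using card_near[OF d4] unfolding W_def by auto
  qed
  have dist_vs: "distinct (vs0 @ vs1)"
    by (rule card_distinct) (simp only: set_vs card_S, simp add: vs0_def vs1_def)
  have pts: "N (pt x u v) \<inter> N x = {u, v}" if "u \<in> N x" "v \<in> N x" "u \<noteq> v" for u v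
    using pt_D2(2)[OF that] .
  have pts2: "N (pt y u v) \<inter> N y = {u, v}" if "u \<in> N y" "v \<in> N y" "u \<noteq> v" for u v
    using pt_D2(2)[OF that] .
  have NM: "N m = (N m \<inter> N x) \<union> (N m \<inter> N y) \<union> {w x y m}" if "m \<in> M x y" for m
    using M_nbrs[OF far(1) that] .
  have Na: "N a = {x, r, pac, pad, pae}"
    using N_first[OF N di] by (simp add: x_defs)
  have Nb: "N b = {x, r, pbc, pbd, pbe}"
    using N_first[of x b a c d e] N di pt_sym[of x b a] by (auto simp add: x_defs insert_commute)
  have Nc: "N c = {x, pac, pbc, s, pce}"
    using N_first[of x c a b d e] N di pt_sym[of x c a] pt_sym[of x c b]
    by (auto simp add: x_defs insert_commute)
  have Nd: "N d = {x, pad, pbd, s, pde}"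
    using N_first[of x d a b c e] N di pt_sym[of x d a] pt_sym[of x d b] pt_sym[of x d c]
    by (auto simp add: x_defs insert_commute)
  have Ne: "N e = {x, pae, pbe, pce, pde}"
    using N_first[of x e a b c d] N di pt_sym[of x e a] pt_sym[of x e b] pt_sym[of x e c] pt_sym[of x e d]
    by (auto simp add: x_defs insert_commute)
  have NA: "N A = {y, r', pae, pce, pac}"
    using N_first[OF N2 di2] unfolding y_eqs .
  have NB: "N B = {y, r', pde, pbe, pbd}"
    using N_first[of y B A C D E] N2 di2 pt_sym[of y B A] by (auto simp add: y_eqs insert_commute)
  have NC: "N C = {y, pae, pde, s', pad}"
    using N_first[of y C A B D E] N2 di2 pt_sym[of y C A] pt_sym[of y C B]
    by (auto simp add: y_eqs insert_commute)
  have ND: "N D = {y, pce, pbe, s', pbc}"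
    using N_first[of y D A B C E] N2 di2 pt_sym[of y D A] pt_sym[of y D B] pt_sym[of y D C]
    by (auto simp add: y_eqs insert_commute)
  have NE: "N E = {y, pac, pbd, pad, pbc}"
    using N_first[of y E A B C D] N2 di2 pt_sym[of y E A] pt_sym[of y E B] pt_sym[of y E C] pt_sym[of y E D]
    by (auto simp add: y_eqs insert_commute)
  have Nr: "N r = {a, b, al, be, ga}" and Ns: "N s = {c, d, al, be, de}"
    using L(6,7) by (simp_all add: al_def be_def ga_def de_def x_defs)
  have Nr': "N r' = {A, B, ga, de, al}" and Ns': "N s' = {C, D, ga, de, be}"
    using L2(6,7) unfolding y_eqs w_eqs by auto
  have xm: "N pac \<inter> N x = {a, c}" "N pad \<inter> N x = {a, d}" "N pae \<inter> N x = {a, e}"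
    "N pbc \<inter> N x = {b, c}" "N pbd \<inter> N x = {b, d}" "N pbe \<inter> N x = {b, e}"
    "N pce \<inter> N x = {c, e}" "N pde \<inter> N x = {d, e}"
    unfolding x_defs by (rule pts; use mem di in simp)+
  have ym: "N pac \<inter> N y = {A, E}" "N pad \<inter> N y = {C, E}" "N pae \<inter> N y = {A, C}"
    "N pbc \<inter> N y = {D, E}" "N pbd \<inter> N y = {B, E}" "N pbe \<inter> N y = {B, D}"
    "N pce \<inter> N y = {A, D}" "N pde \<inter> N y = {B, C}"
    unfolding y_eqs[symmetric] by (rule pts2; use mem2 di2 in simp)+
  have Npac: "N pac = {a, c, A, E, al}" and Npad: "N pad = {a, d, C, E, be}"
    and Npae: "N pae = {a, e, A, C, ga}" and Npbc: "N pbc = {b, c, D, E, be}"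
    and Npbd: "N pbd = {b, d, B, E, al}" and Npbe: "N pbe = {b, e, B, D, ga}"
    and Npce: "N pce = {c, e, A, D, de}" and Npde: "N pde = {d, e, B, C, de}"
    using NM[of pac] NM[of pad] NM[of pae] NM[of pbc] NM[of pbd] NM[of pbe] NM[of pce] NM[of pde]
    unfolding xm ym w_eqs M1 by auto
  have dm: "distinct [r, s, r', s', pac, pad, pae, pbc, pbd, pbe, pce, pde]"
    using dist_vs unfolding vs0_def vs1_def by (simp, blast)
  have Nal: "N al = set [r, s, pac, pbd, r']"
    by (rule N_eq_five) (use SV Weq dm Nr Ns Npac Npbd Nr' symN in auto)
  have Nbe: "N be = set [r, s, pad, pbc, s']"
    by (rule N_eq_five) (use SV Weq dm Nr Ns Npad Npbc Ns' symN in auto)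
  have Nga: "N ga = set [r, pae, pbe, r', s']"
    by (rule N_eq_five) (use SV Weq dm Nr Npae Npbe Nr' Ns' symN in auto)
  have Nde: "N de = set [s, pce, pde, r', s']"
    by (rule N_eq_five) (use SV Weq dm Ns Npce Npde Nr' Ns' symN in auto)
  define f where "f = (\<lambda>(t, i). if t then vs1 ! i else vs0 ! i)"
  have len: "length vs0 = 14" "length vs1 = 14" unfolding vs0_def vs1_def by auto
  have img: "f ` (UNIV \<times> {..<14}) = set (vs0 @ vs1)"
  proof -
    have "f ` (UNIV \<times> {..<14}) = (!) vs0 ` {..<14} \<union> (!) vs1 ` {..<14}"
      unfolding f_def by (auto simp: UNIV_bool image_iff split: if_splits)
    also have "\<dots> = set vs0 \<union> set vs1"
      using len by (metis atLeast0LessThan list.set_map map_nth set_upt)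
    finally show ?thesis by simp
  qed
  have inj: "inj_on f (UNIV \<times> {..<14})"
    by (rule eq_card_imp_inj_on) (simp_all only: img set_vs card_S, auto simp: card_UNIV_bool)
  have nbrs: "N (f (t, i)) = f ` insert (\<not> t, i) (Pair t ` set (lam_nbrs i))" if "i < 14" for t i
  proof -
    have "i \<in> {0, 1, 2, 3, 4, 5, 6, 7, 8, 9, 10, 11, 12, 13}" using that by (simp, presburger)
    then show ?thesis
      unfolding f_def vs0_def vs1_def lam_nbrs_def
      by (cases t) (elim insertE emptyE; simp add: N Na Nb Nc Nd Ne N2 NA NB NC ND NE Nr Ns Nr' Ns'
          Npac Npad Npae Npbc Npbd Npbe Npce Npde Nal Nbe Nga Nde insert_commute)+
  qed
  have lam_lt: "j < 14" if "i < 14" "j \<in> set (lam_nbrs i)" for i j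
  proof -
    have "i \<in> {0, 1, 2, 3, 4, 5, 6, 7, 8, 9, 10, 11, 12, 13}" using that(1) by (simp, presburger)
    then show ?thesis using that(2) unfolding lam_nbrs_def by auto
  qed
  have "set (vs0 @ vs1) = V"
  proof (rule conn)
    show "set (vs0 @ vs1) \<subseteq> V" unfolding set_vs by (rule SV)
    fix v assume "v \<in> set (vs0 @ vs1)"
    then obtain t i where "v = f (t, i)" "i < 14" unfolding img[symmetric] by auto
    then show "N v \<subseteq> set (vs0 @ vs1)"
      using nbrs lam_lt unfolding img[symmetric] by fastforce
  qed (simp add: vs0_def)
  with that[of f] inj img nbrs show thesis by simp
qed

end

section \<open>The complete graph on four neighbours: the 5-cube\<close>

context valency5_nbhd
begin

text \<open>Here \<open>e\<close> is the only neighbour of \<open>x\<close> without neighbours in \<open>M x y\<close>, which therefore is the edge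
  set of the complete graph on \<open>a, b, c, d\<close>.\<close>

definition clab :: "'a \<Rightarrow> 'a \<Rightarrow> 'a \<Rightarrow> 'a \<Rightarrow> 'a \<Rightarrow> 'a \<Rightarrow> 'a \<Rightarrow> bool" where
  "clab x y a b c d e \<longleftrightarrow> dist4 x y \<and> distinct [a, b, c, d, e] \<and> N x = {a, b, c, d, e} \<and>
     P x y = {a, b, c, d}"

lemma clab_perm:
  assumes "clab x y a b c d e"
  shows "clab x y b a c d e" "clab x y c a b d e" "clab x y d a b c e"
    "clab x y a c b d e" "clab x y a d b c e"
  using assms unfolding clab_def by (auto simp: insert_commute)

lemma clab_exists:
  assumes d: "dist4 x y" and c: "card (P x y) = 4"
  shows "\<exists>a b c d e. clab x y a b c d e"
proof -
  have "card (P x y) = Suc 3" using c by simp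
  then obtain p P3 where p: "P x y = insert p P3" "p \<notin> P3" "card P3 = 3"
    by (auto simp only: card_Suc_eq)
  then obtain q r s where qrs: "P3 = {q, r, s}" "q \<noteq> r" "q \<noteq> s" "r \<noteq> s" by (auto simp: card_3_iff)
  have sub: "P x y \<subseteq> N x" unfolding P_def by blast
  have "card (N x - P x y) = 1"
    using deg[of x] dist4_V[OF d] k5 c sub by (subst card_Diff_subset) auto
  then obtain e where e: "N x - P x y = {e}" by (rule card_1_singletonE)
  have "N x = {p, q, r, s, e}" using e sub p(1) qrs(1) by blast
  moreover have "distinct [p, q, r, s, e]" using e p(1,2) qrs by auto
  ultimately have "clab x y p q r s e" unfolding clab_def using d p(1) qrs(1) by simp
  then show ?thesis by blast
qed

text \<open>\<open>e\<close> has no neighbour in \<open>M x y\<close>, so \<open>pt x a e\<close> is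
  a missing vertex next to \<open>a\<close>, and \<open>missing_point\<close> supplies its
  neighbourhood.\<close>

lemma clab_nbr:
  assumes l: "clab x y a b c d e"
  shows "N a \<inter> M x y = {pt x a b, pt x a c, pt x a d}"
    and "pt x a e \<notin> M x y"
    and "N (pt x a e) = {a, e, w x y (pt x a b), w x y (pt x a c), w x y (pt x a d)}"
    and "distinct [w x y (pt x a b), w x y (pt x a c), w x y (pt x a d)]"
proof -
  have d4: "dist4 x y" and N: "N x = {a, b, c, d, e}" and di: "distinct [a, b, c, d, e]"
    and P: "P x y = {a, b, c, d}"
    using l unfolding clab_def by auto
  have far: "far x y" using dist4_far[OF d4] .
  have mem: "a \<in> N x" "b \<in> N x" "c \<in> N x" "d \<in> N x" "e \<in> N x" using N by auto
  show nM: "pt x a e \<notin> M x y"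
  proof
    assume "pt x a e \<in> M x y"
    then have "e \<in> P x y" unfolding P_def using pt_adj(2)[of a x e] mem di by auto
    then show False using P di by auto
  qed
  have "N a \<inter> M x y \<subseteq> {pt x a b, pt x a c, pt x a d}"
    using N_first[OF N di] nM M_notin(3)[OF far] by blast
  moreover have "3 \<le> card (N a \<inter> M x y)" using M_degree_34[OF far, of a] P by auto
  moreover have "card {pt x a b, pt x a c, pt x a d} \<le> 3" by (simp add: card_insert_if)
  ultimately show E: "N a \<inter> M x y = {pt x a b, pt x a c, pt x a d}"
    by (intro card_seteq) auto
  have r: "pt x a e \<in> D2 x" "N (pt x a e) \<inter> N x = {a, e}"
    using pt_D2[of a x e] mem di by auto
  have ar: "a \<in> N (pt x a e)" using r(2) by blast
  have aP: "a \<in> P x y" using P by simp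
  note R = missing_point[OF far r(1) nM aP ar]
  show "N (pt x a e) = {a, e, w x y (pt x a b), w x y (pt x a c), w x y (pt x a d)}"
    using R(4) unfolding E r(2) by auto
  have "card {w x y (pt x a b), w x y (pt x a c), w x y (pt x a d)} = 3"
    using R(5,6) unfolding E by simp
  then show "distinct [w x y (pt x a b), w x y (pt x a c), w x y (pt x a d)]"
    by (auto simp: card_insert_if split: if_splits)
qed

lemma clab_M:
  assumes l: "clab x y a b c d e"
  shows "M x y = {pt x a b, pt x a c, pt x a d, pt x b c, pt x b d, pt x c d}"
    and "distinct [pt x a b, pt x a c, pt x a d, pt x b c, pt x b d, pt x c d]"
proof -
  have N: "N x = {a, b, c, d, e}" and di: "distinct [a, b, c, d, e]"
    and P: "P x y = {a, b, c, d}"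
    using l unfolding clab_def by auto
  have mem: "a \<in> N x" "b \<in> N x" "c \<in> N x" "d \<in> N x" "e \<in> N x" using N by auto
  note E = clab_nbr(1)[OF l] clab_nbr(1)[OF clab_perm(1)[OF l]]
    clab_nbr(1)[OF clab_perm(2)[OF l]] clab_nbr(1)[OF clab_perm(3)[OF l]]
  have "M x y = (N a \<inter> M x y) \<union> (N b \<inter> M x y) \<union> (N c \<inter> M x y) \<union> (N d \<inter> M x y)"
  proof -
    have "\<exists>p\<in>P x y. m \<in> N p" if m: "m \<in> M x y" for m
    proof -
      obtain p where "p \<in> N x" "p \<in> N m" using m unfolding M_def D2_def by blast
      then show ?thesis unfolding P_def using m symN by blast
    qed
    then show ?thesis unfolding P by blast
  qed
  then show "M x y = {pt x a b, pt x a c, pt x a d, pt x b c, pt x b d, pt x c d}"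
    unfolding E using pt_sym[of x b a] pt_sym[of x c a] pt_sym[of x c b]
      pt_sym[of x d a] pt_sym[of x d b] pt_sym[of x d c] by auto
  have "\<And>s t u v. s \<in> N x \<Longrightarrow> t \<in> N x \<Longrightarrow> u \<in> N x \<Longrightarrow> v \<in> N x \<Longrightarrow> s \<noteq> t \<Longrightarrow> u \<noteq> v \<Longrightarrow>
      {s, t} \<noteq> {u, v} \<Longrightarrow> pt x s t \<noteq> pt x u v"
    using pt_inj by blast
  then show "distinct [pt x a b, pt x a c, pt x a d, pt x b c, pt x b d, pt x c d]"
    using mem di by (simp add: doubleton_eq_iff)
qed

text \<open>A common value for opposite edges would be adjacent to both of them and, by
  \<open>clab_nbr\<close>, to the four vertices pairing \<open>e\<close> with
  \<open>a, b, c, d\<close>: six neighbours.\<close>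

lemma clab_opp:
  assumes l: "clab x y a b c d e"
  shows "w x y (pt x a b) \<noteq> w x y (pt x c d)"
proof
  assume eq: "w x y (pt x a b) = w x y (pt x c d)"
  let ?v = "w x y (pt x a b)"
  have d4: "dist4 x y" and N: "N x = {a, b, c, d, e}" and di: "distinct [a, b, c, d, e]"
    using l unfolding clab_def by auto
  have far: "far x y" using dist4_far[OF d4] .
  have mem: "a \<in> N x" "b \<in> N x" "c \<in> N x" "d \<in> N x" "e \<in> N x" using N by auto
  have pM: "pt x a b \<in> M x y" "pt x c d \<in> M x y" using clab_M(1)[OF l] by auto
  have "?v \<in> N (pt x a e)" "?v \<in> N (pt x b e)" "?v \<in> N (pt x c e)" "?v \<in> N (pt x d e)"
    using clab_nbr(3)[OF l] clab_nbr(3)[OF clab_perm(1)[OF l]]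
      clab_nbr(3)[OF clab_perm(2)[OF l]] clab_nbr(3)[OF clab_perm(3)[OF l]]
      pt_sym[of x b a] pt_sym[of x d c] eq by auto
  moreover have "?v \<in> N (pt x a b)" "?v \<in> N (pt x c d)"
    using wD(1)[OF far pM(1)] wD(1)[OF far pM(2)] eq by simp_all
  ultimately have sub: "{pt x a e, pt x b e, pt x c e, pt x d e, pt x a b, pt x c d} \<subseteq> N ?v"
    using symN by blast
  have "\<And>s t u v. s \<in> N x \<Longrightarrow> t \<in> N x \<Longrightarrow> u \<in> N x \<Longrightarrow> v \<in> N x \<Longrightarrow> s \<noteq> t \<Longrightarrow> u \<noteq> v \<Longrightarrow>
      {s, t} \<noteq> {u, v} \<Longrightarrow> pt x s t \<noteq> pt x u v"
    using pt_inj by blast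
  moreover have "distinct [e, d, c, b, a]" using di by auto
  ultimately have "distinct [pt x a e, pt x b e, pt x c e, pt x d e, pt x a b, pt x c d]"
    using mem di by (simp add: doubleton_eq_iff)
  then have "card {pt x a e, pt x b e, pt x c e, pt x d e, pt x a b, pt x c d} = 6"
    using distinct_card[of "[pt x a e, pt x b e, pt x c e, pt x d e, pt x a b, pt x c d]"] by simp
  moreover have "card (N ?v) = 5" using deg k5 wD(1)[OF far pM(1)] NV by metis
  ultimately show False using card_mono[OF finN sub] by simp
qed

lemma clab_inj:
  assumes l: "clab x y a b c d e"
  shows "distinct (map (w x y) [pt x a b, pt x a c, pt x a d, pt x b c, pt x b d, pt x c d])"
  using clab_nbr(4)[OF l] clab_nbr(4)[OF clab_perm(1)[OF l]]
    clab_nbr(4)[OF clab_perm(2)[OF l]] clab_nbr(4)[OF clab_perm(3)[OF l]]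
    clab_opp[OF l] clab_opp[OF clab_perm(4)[OF l]] clab_opp[OF clab_perm(5)[OF l]]
    pt_sym[of x b a] pt_sym[of x c a] pt_sym[of x c b]
    pt_sym[of x d a] pt_sym[of x d b] pt_sym[of x d c] by auto

text \<open>Such a \<open>q\<close> puts the two opposite edges at distance two. By
  \<open>clab_opp\<close> their second common neighbour \<open>u\<close> is also next to
  \<open>y\<close>, and then \<open>u\<close> and \<open>q\<close> share \<open>y\<close> and both
  edges.\<close>

lemma clab_opp_nbr:
  assumes l: "clab x y a b c d e" and q: "q \<in> N y" "q \<in> N (pt x a b)" "q \<in> N (pt x c d)"
  shows False
proof -
  have d4: "dist4 x y" and N: "N x = {a, b, c, d, e}" and di: "distinct [a, b, c, d, e]"
    using l unfolding clab_def by auto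
  have far: "far x y" using dist4_far[OF d4] .
  have mem: "a \<in> N x" "b \<in> N x" "c \<in> N x" "d \<in> N x" "e \<in> N x" using N by auto
  have pM: "pt x a b \<in> M x y" "pt x c d \<in> M x y" using clab_M(1)[OF l] by auto
  have ne: "pt x a b \<noteq> pt x c d" using clab_M(2)[OF l] by auto
  have "pt x c d \<in> D2 (pt x a b)" using mem_D2I[OF ne[symmetric] q(2,3)] .
  then have c2: "2 \<le> card (N (pt x a b) \<inter> N (pt x c d))" using card_common mu_eq by simp
  obtain u where u: "u \<in> N (pt x a b)" "u \<in> N (pt x c d)" "u \<noteq> q"
    using card_ge_2_ex[OF c2, of q] by blast
  have "N (pt x a b) \<inter> N x = {a, b}" "N (pt x c d) \<inter> N x = {c, d}"
    using pt_D2(2)[of a x b] pt_D2(2)[of c x d] mem di by auto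
  then have "u \<notin> N x" using u di by auto
  moreover have "\<not> (u = w x y (pt x a b) \<and> u = w x y (pt x c d))" using clab_opp[OF l] by metis
  moreover have "u \<in> N x \<or> u \<in> N y \<or> u = w x y (pt x a b)" "u \<in> N x \<or> u \<in> N y \<or> u = w x y (pt x c d)"
    using M_nbrs[OF far pM(1)] M_nbrs[OF far pM(2)] u by blast+
  ultimately have uy: "u \<in> N y" by blast
  have "u = q"
  proof (rule three_common[of y u "pt x a b" "pt x c d" q])
    show "y \<in> N u" "y \<in> N q" using uy q symN by blast+
    show "pt x a b \<in> N u" "pt x c d \<in> N u" "pt x a b \<in> N q" "pt x c d \<in> N q" using u q symN by blast+
    show "y \<noteq> pt x a b" "y \<noteq> pt x c d" using M_notin(4)[OF far] pM by metis+
  qed (rule ne)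
  then show False using u by simp
qed

text \<open>The neighbours of \<open>y\<close> in \<open>P y x\<close> correspond to the triangles
  of the complete graph at \<open>x\<close>. The vertex \<open>q\<close> found by
  \<open>M_share\<close> has three neighbours in \<open>M x y\<close>; \<open>pt x a d\<close> would
  identify \<open>q\<close> with \<open>a\<close>, and the two edges opposite to known ones are
  excluded by \<open>clab_opp_nbr\<close>.\<close>

lemma clab_triangle:
  assumes l: "clab x y a b c d e" and l': "clab y x A B C D E"
  obtains q where "q \<in> P y x" "N q \<inter> M x y = {pt x a b, pt x a c, pt x b c}"
proof -
  have d4: "dist4 x y" and N: "N x = {a, b, c, d, e}" and di: "distinct [a, b, c, d, e]"
    using l unfolding clab_def by auto
  have far: "far x y" using dist4_far[OF d4] .
  have mem: "a \<in> N x" "b \<in> N x" "c \<in> N x" "d \<in> N x" "e \<in> N x" using N by auto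
  have pM: "pt x a b \<in> M x y" "pt x a c \<in> M x y" using clab_M(1)[OF l] by auto
  note di' = clab_M(2)[OF l]
  have wne: "w x y (pt x a b) \<noteq> w x y (pt x a c)" using clab_inj[OF l] by auto
  have "N (pt x a b) \<inter> N x = {a, b}" "N (pt x a c) \<inter> N x = {a, c}"
    using pt_D2(2)[of a x b] pt_D2(2)[of a x c] mem di by auto
  then have int: "N (pt x a b) \<inter> N (pt x a c) \<inter> N x = {a}" using di by auto
  obtain q where q: "q \<in> N y" "q \<in> N (pt x a b)" "q \<in> N (pt x a c)"
    by (rule M_share[OF far pM wne int])
  have q': "pt x a b \<in> N q" "pt x a c \<in> N q" using q symN by blast+
  have qP: "q \<in> P y x" unfolding P_def using q q' pM M_sym[of x y] by blast
  then have "q \<in> {A, B, C, D}" using l' unfolding clab_def by blast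
  then have c3: "card (N q \<inter> M x y) = 3"
  proof -
    have t: "card {m, m', m''} = 3" if "distinct [w y x m, w y x m', w y x m'']" for m m' m''
    proof -
      from that have "m \<noteq> m'" "m \<noteq> m''" "m' \<noteq> m''" by auto
      then show ?thesis by simp
    qed
    show ?thesis
      using \<open>q \<in> {A, B, C, D}\<close> clab_nbr(1)[OF l'] clab_nbr(1)[OF clab_perm(1)[OF l']]
        clab_nbr(1)[OF clab_perm(2)[OF l']] clab_nbr(1)[OF clab_perm(3)[OF l']]
        t[OF clab_nbr(4)[OF l']] t[OF clab_nbr(4)[OF clab_perm(1)[OF l']]]
        t[OF clab_nbr(4)[OF clab_perm(2)[OF l']]] t[OF clab_nbr(4)[OF clab_perm(3)[OF l']]]
        M_sym[of x y]
      by (elim insertE emptyE) simp_all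
  qed
  have "pt x a d \<notin> N q"
  proof
    assume "pt x a d \<in> N q"
    then have "a = q"
      using three_common[of "pt x a b" a "pt x a c" "pt x a d" q] q' di'
        pt_adj(1)[of a x b] pt_adj(1)[of a x c] pt_adj(1)[of a x d] mem di by auto
    then show False using q mem farD(7)[OF far] by blast
  qed
  moreover have "pt x c d \<notin> N q" using clab_opp_nbr[OF l q(1,2)] symN by blast
  moreover have "pt x b d \<notin> N q" using clab_opp_nbr[OF clab_perm(4)[OF l] q(1,3)] symN by blast
  ultimately have "N q \<inter> M x y \<subseteq> {pt x a b, pt x a c, pt x b c}"
    using clab_M(1)[OF l] by blast
  moreover have "card {pt x a b, pt x a c, pt x b c} \<le> 3" by (simp add: card_insert_if)
  ultimately have "N q \<inter> M x y = {pt x a b, pt x a c, pt x b c}" using c3 by (intro card_seteq) auto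
  then show thesis using that qP by blast
qed

text \<open>Six vertices of \<open>M x y\<close> send 12 edges to \<open>P y x\<close>, and each
  element there takes at least three.\<close>

lemma card_P_sym4:
  assumes l: "clab x y a b c d e"
  shows "card (P y x) = 4"
proof -
  have d4: "dist4 x y" using l unfolding clab_def by blast
  have far: "far y x" using dist4_sym[OF d4] unfolding dist4_def by blast
  have "card (M x y) = 6" using clab_M[OF l] by simp
  then have "(\<Sum>p\<in>P y x. card (N p \<inter> M y x)) = 12"
    using sum_P[OF far] mu_eq M_sym[of x y] by simp
  moreover have "card (P y x) * 3 \<le> (\<Sum>p\<in>P y x. card (N p \<inter> M y x))"
    using sum_bounded_below[of "P y x" 3 "\<lambda>p. card (N p \<inter> M y x)"] M_degree_34[OF far] by fastforce
  ultimately show ?thesis using card_P_ge4[OF dist4_sym[OF d4]] by simp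
qed

text \<open>Each capital letter is chosen as the triangle that avoids the corresponding small
  letter.\<close>

lemma clab_aligned:
  assumes l: "clab x y a b c d e"
  obtains A B C D E where "clab y x A B C D E"
    "N D \<inter> M x y = {pt x a b, pt x a c, pt x b c}" "N C \<inter> M x y = {pt x a b, pt x a d, pt x b d}"
    "N B \<inter> M x y = {pt x a c, pt x a d, pt x c d}" "N A \<inter> M x y = {pt x b c, pt x b d, pt x c d}"
proof -
  have d4: "dist4 x y" using l unfolding clab_def by blast
  obtain A' B' C' D' E where l': "clab y x A' B' C' D' E"
    using clab_exists[OF dist4_sym[OF d4] card_P_sym4[OF l]] by blast
  note di = clab_M(2)[OF l]
  have l2: "clab x y a b d c e" "clab x y a c d b e" "clab x y b c d a e"
    using l unfolding clab_def by (auto simp: insert_commute)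
  obtain D where D: "D \<in> P y x" "N D \<inter> M x y = {pt x a b, pt x a c, pt x b c}"
    by (rule clab_triangle[OF l l'])
  obtain C where C: "C \<in> P y x" "N C \<inter> M x y = {pt x a b, pt x a d, pt x b d}"
    by (rule clab_triangle[OF l2(1) l'])
  obtain B where B: "B \<in> P y x" "N B \<inter> M x y = {pt x a c, pt x a d, pt x c d}"
    by (rule clab_triangle[OF l2(2) l'])
  obtain A where A: "A \<in> P y x" "N A \<inter> M x y = {pt x b c, pt x b d, pt x c d}"
    by (rule clab_triangle[OF l2(3) l'])
  have "pt x a b \<in> N D \<inter> M x y" "pt x a c \<in> N D \<inter> M x y" "pt x a b \<in> N C \<inter> M x y"
    "pt x a c \<notin> N C \<inter> M x y" "pt x a b \<notin> N B \<inter> M x y" "pt x a c \<in> N B \<inter> M x y"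
    "pt x a b \<notin> N A \<inter> M x y" "pt x a c \<notin> N A \<inter> M x y"
    unfolding A(2) B(2) C(2) D(2) using di by auto
  then have dis: "distinct [A, B, C, D]" by auto
  have "P y x = {A, B, C, D}"
    by (rule card_subset_eq[symmetric]) (use A(1) B(1) C(1) D(1) dis card_P_sym4[OF l] in auto)
  moreover have "N y = insert E (P y x)" "E \<notin> P y x"
    using l' unfolding clab_def by auto
  ultimately have "clab y x A B C D E"
    unfolding clab_def using dist4_sym[OF d4] dis by auto
  then show thesis using that A B C D by blast
qed

text \<open>With \<open>x\<close> as origin and \<open>a, b, c, d, e\<close> as unit vectors,
  \<open>D\<close> is the sum of \<open>a, b, c\<close>, and \<open>y\<close> that of
  \<open>a, b, c, d\<close>; adding \<open>e\<close> to an edge of \<open>M x y\<close> gives its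
  value under \<open>w\<close>.\<close>

lemma clab_iso:
  assumes l: "clab x y a b c d e"
  obtains f :: "bool list \<Rightarrow> 'a" where
    "inj_on f {xs. length xs = 5}" "f ` {xs. length xs = 5} = V"
    "\<And>xs. length xs = 5 \<Longrightarrow> N (f xs) = (\<lambda>i. f (xs[i := \<not> xs ! i])) ` {..<5}"
proof -
  obtain A B C D E where l': "clab y x A B C D E" and
    tri_sets: "N D \<inter> M x y = {pt x a b, pt x a c, pt x b c}" "N C \<inter> M x y = {pt x a b, pt x a d, pt x b d}"
    "N B \<inter> M x y = {pt x a c, pt x a d, pt x c d}" "N A \<inter> M x y = {pt x b c, pt x b d, pt x c d}"
    by (rule clab_aligned[OF l])
  have d4: "dist4 x y" using l unfolding clab_def by blast
  have far: "far x y" using dist4_far[OF d4] .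
  have ws: "w y x = w x y" using w_sym by (auto simp: fun_eq_iff)
  have Ms: "M y x = M x y" using M_sym .
  have N: "N x = {a, b, c, d, e}" and di: "distinct [a, b, c, d, e]"
    and N2: "N y = {A, B, C, D, E}" and di2: "distinct [A, B, C, D, E]"
    using l l' unfolding clab_def by auto
  have mem: "a \<in> N x" "b \<in> N x" "c \<in> N x" "d \<in> N x" "e \<in> N x" using N by auto
  have mem2: "A \<in> N y" "B \<in> N y" "C \<in> N y" "D \<in> N y" "E \<in> N y" using N2 by auto
  define pab where "pab = pt x a b"
  define pac where "pac = pt x a c"
  define pad where "pad = pt x a d"
  define pbc where "pbc = pt x b c"
  define pbd where "pbd = pt x b d"
  define pcd where "pcd = pt x c d"
  define ra where "ra = pt x a e"
  define rb where "rb = pt x b e"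
  define rc where "rc = pt x c e"
  define rd where "rd = pt x d e"
  define rA where "rA = pt y A E"
  define rB where "rB = pt y B E"
  define rC where "rC = pt y C E"
  define rD where "rD = pt y D E"
  define wab where "wab = w x y pab"
  define wac where "wac = w x y pac"
  define wad where "wad = w x y pad"
  define wbc where "wbc = w x y pbc"
  define wbd where "wbd = w x y pbd"
  define wcd where "wcd = w x y pcd"
  note p_defs = pab_def pac_def pad_def pbc_def pbd_def pcd_def
  note r_defs = ra_def rb_def rc_def rd_def rA_def rB_def rC_def rD_def
  note w_defs = wab_def wac_def wad_def wbc_def wbd_def wcd_def
  have p_eqs: "pt x a b = pab" "pt x a c = pac" "pt x a d = pad" "pt x b c = pbc" "pt x b d = pbd"
    "pt x c d = pcd" "pt x b a = pab" "pt x c a = pac" "pt x d a = pad" "pt x c b = pbc"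
    "pt x d b = pbd" "pt x d c = pcd"
    unfolding p_defs by (simp_all add: pt_sym)
  note w_eqs = w_defs[symmetric]
  have T: "N D \<inter> M x y = {pab, pac, pbc}" "N C \<inter> M x y = {pab, pad, pbd}"
    "N B \<inter> M x y = {pac, pad, pcd}" "N A \<inter> M x y = {pbc, pbd, pcd}"
    using tri_sets unfolding p_eqs .
  have M1: "M x y = {pab, pac, pad, pbc, pbd, pcd}" using clab_M(1)[OF l] unfolding p_eqs .
  have dM: "distinct [pab, pac, pad, pbc, pbd, pcd]" using clab_M(2)[OF l] unfolding p_eqs .
  \<comment> \<open>Two triangles share one edge: those avoiding \<open>c\<close> and
    \<open>d\<close> share the edge on \<open>a\<close> and \<open>b\<close>. So a pair at
    \<open>y\<close> carries the letters complementary to those of the pair at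
    \<open>x\<close>.\<close>
  have q_eqs: "pt y C D = pab" "pt y B D = pac" "pt y B C = pad" "pt y A D = pbc" "pt y A C = pbd"
    "pt y A B = pcd"
  proof -
    have u: "pt y s t = m" if "s \<in> N y" "t \<in> N y" "s \<noteq> t" "m \<in> N s \<inter> M x y" "m \<in> N t \<inter> M x y" for s t m
      using pt_unique[of s y t m] that M_notin(4)[OF far] by auto
    show "pt y C D = pab" "pt y B D = pac" "pt y B C = pad" "pt y A D = pbc" "pt y A C = pbd"
      "pt y A B = pcd"
      by (rule u; use mem2 di2 T in simp)+
  qed
  have q_eqs': "pt y D C = pab" "pt y D B = pac" "pt y C B = pad" "pt y D A = pbc" "pt y C A = pbd"
    "pt y B A = pcd"
    using q_eqs pt_sym by metis+
  have cyc: "clab x y a b c d e" "clab x y b a c d e" "clab x y c a b d e" "clab x y d a b c e"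
    using l clab_perm[OF l] by auto
  have cyc': "clab y x A B C D E" "clab y x B A C D E" "clab y x C A B D E" "clab y x D A B C E"
    using l' clab_perm[OF l'] by auto
  have Nra: "N ra = {a, e, wab, wac, wad}" and Nrb: "N rb = {b, e, wab, wbc, wbd}"
    and Nrc: "N rc = {c, e, wac, wbc, wcd}" and Nrd: "N rd = {d, e, wad, wbd, wcd}"
    using cyc[THEN clab_nbr(3)] unfolding p_eqs w_eqs r_defs by auto
  have NrA: "N rA = {A, E, wbc, wbd, wcd}" and NrB: "N rB = {B, E, wac, wad, wcd}"
    and NrC: "N rC = {C, E, wab, wad, wbd}" and NrD: "N rD = {D, E, wab, wac, wbc}"
    using cyc'[THEN clab_nbr(3)] unfolding q_eqs q_eqs' ws w_eqs r_defs by auto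
  have rM: "ra \<notin> M x y" "rb \<notin> M x y" "rc \<notin> M x y" "rd \<notin> M x y"
    using cyc[THEN clab_nbr(2)] unfolding r_defs by auto
  have rM': "rA \<notin> M x y" "rB \<notin> M x y" "rC \<notin> M x y" "rD \<notin> M x y"
    using cyc'[THEN clab_nbr(2)] unfolding r_defs Ms by auto
  have rDx: "{ra, rb, rc, rd} \<subseteq> D2 x" and rDy: "{rA, rB, rC, rD} \<subseteq> D2 y"
    unfolding r_defs using pt_D2(1)[of _ x e] pt_D2(1)[of _ y E] mem mem2 di di2 by auto
  have MD: "M x y \<subseteq> D2 x" "M x y \<subseteq> D2 y" unfolding M_def by auto
  have dinj: "distinct [ra, rb, rc, rd]" "distinct [rA, rB, rC, rD]"
  proof -
    have "\<And>z s t u. s \<in> N z \<Longrightarrow> t \<in> N z \<Longrightarrow> u \<in> N z \<Longrightarrow> s \<noteq> t \<Longrightarrow> s \<noteq> u \<Longrightarrow> t \<noteq> u \<Longrightarrow>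
        pt z s u \<noteq> pt z t u"
      using pt_inj by (metis doubleton_eq_iff)
    then show "distinct [ra, rb, rc, rd]" "distinct [rA, rB, rC, rD]"
      unfolding r_defs using mem mem2 di di2 by auto
  qed
  have cM: "card (M x y) = 6" unfolding M1 using dM by simp
  have cD: "card (D2 x - M x y) = 4" "card (D2 y - M x y) = 4"
    using card_missing[OF d4] card_missing[OF dist4_sym[OF d4]] cM Ms by auto
  have DxM: "D2 x - M x y = {ra, rb, rc, rd}" and DyM: "D2 y - M x y = {rA, rB, rC, rD}"
    by (rule card_subset_eq[symmetric]; use rDx rDy rM rM' cD dinj in auto)+
  have Wd: "distinct [wab, wac, wad, wbc, wbd, wcd]"
    using clab_inj[OF l] unfolding p_eqs w_defs by simp
  have Weq: "w x y ` M x y = {wab, wac, wad, wbc, wbd, wcd}"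
    unfolding M1 w_defs by simp
  have cW: "card (w x y ` M x y) = 6" unfolding Weq using Wd by simp
  let ?S = "{x, y} \<union> N x \<union> N y \<union> (D2 x \<union> (D2 y - M x y)) \<union> w x y ` M x y"
  have SV: "?S \<subseteq> V" and card_S: "card ?S = 32"
    using card_near[OF d4] cM cW by auto
  \<comment> \<open>the two facets of the cube, ordered by binary expansion\<close>
  define vs0 where "vs0 = [x, a, b, pab, c, pac, pbc, D, d, pad, pbd, C, pcd, B, A, y]"
  define vs1 where "vs1 = [e, ra, rb, wab, rc, wac, wbc, rD, rd, wad, wbd, rC, wcd, rB, rA, E]"
  have D2x: "D2 x = {ra, rb, rc, rd} \<union> M x y" using DxM MD by blast
  have set_vs: "set (vs0 @ vs1) = ?S"
    unfolding vs0_def vs1_def DyM unfolding D2x M1 N N2 Weq[unfolded M1] by auto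
  have xm: "N pab \<inter> N x = {a, b}" "N pac \<inter> N x = {a, c}" "N pad \<inter> N x = {a, d}"
    "N pbc \<inter> N x = {b, c}" "N pbd \<inter> N x = {b, d}" "N pcd \<inter> N x = {c, d}"
    unfolding p_defs by (rule pt_D2(2); use mem di in simp)+
  have ym: "N pab \<inter> N y = {C, D}" "N pac \<inter> N y = {B, D}" "N pad \<inter> N y = {B, C}"
    "N pbc \<inter> N y = {A, D}" "N pbd \<inter> N y = {A, C}" "N pcd \<inter> N y = {A, B}"
    unfolding q_eqs[symmetric] by (rule pt_D2(2); use mem2 di2 in simp)+
  have NM: "N m = (N m \<inter> N x) \<union> (N m \<inter> N y) \<union> {w x y m}" if "m \<in> M x y" for m
    using M_nbrs[OF far that] .
  have Npab: "N pab = {a, b, C, D, wab}" and Npac: "N pac = {a, c, B, D, wac}"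
    and Npad: "N pad = {a, d, B, C, wad}" and Npbc: "N pbc = {b, c, A, D, wbc}"
    and Npbd: "N pbd = {b, d, A, C, wbd}" and Npcd: "N pcd = {c, d, A, B, wcd}"
    using NM[of pab] NM[of pac] NM[of pad] NM[of pbc] NM[of pbd] NM[of pcd]
    unfolding xm ym w_eqs M1 by auto
  have Na: "N a = {x, pab, pac, pad, ra}"
    using N_first[of x a b c d e] N di unfolding p_eqs r_defs by auto
  have Nb: "N b = {x, pab, pbc, pbd, rb}"
    using N_first[of x b a c d e] N di unfolding p_eqs r_defs by auto
  have Nc: "N c = {x, pac, pbc, pcd, rc}"
    using N_first[of x c a b d e] N di unfolding p_eqs r_defs by auto
  have Nd: "N d = {x, pad, pbd, pcd, rd}"
    using N_first[of x d a b c e] N di unfolding p_eqs r_defs by auto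
  have Ne: "N e = {x, ra, rb, rc, rd}"
    using N_first[of x e a b c d] N di pt_sym[of x e] unfolding r_defs by auto
  have NA: "N A = {y, pbc, pbd, pcd, rA}"
    using N_first[of y A B C D E] N2 di2 unfolding q_eqs q_eqs' r_defs by auto
  have NB: "N B = {y, pac, pad, pcd, rB}"
    using N_first[of y B A C D E] N2 di2 unfolding q_eqs q_eqs' r_defs by auto
  have NC: "N C = {y, pab, pad, pbd, rC}"
    using N_first[of y C A B D E] N2 di2 unfolding q_eqs q_eqs' r_defs by auto
  have ND: "N D = {y, pab, pac, pbc, rD}"
    using N_first[of y D A B C E] N2 di2 unfolding q_eqs q_eqs' r_defs by auto
  have NE: "N E = {y, rA, rB, rC, rD}"
    using N_first[of y E A B C D] N2 di2 pt_sym[of y E] unfolding r_defs by auto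
  have rne: "r \<noteq> r'" if "r \<in> {ra, rb, rc, rd}" "r' \<in> {rA, rB, rC, rD}" for r r'
    using that DxM DyM unfolding M_def by blast
  have pne: "p \<noteq> r \<and> p \<noteq> r'" if "p \<in> M x y" "r \<in> {ra, rb, rc, rd}" "r' \<in> {rA, rB, rC, rD}" for p r r'
    using that DxM DyM by blast
  have WV: "v \<in> V" if "v \<in> {wab, wac, wad, wbc, wbd, wcd}" for v using SV that Weq by blast
  have five: "N v = {p, r, s, r', s'}"
    if "v \<in> {wab, wac, wad, wbc, wbd, wcd}" "p \<in> M x y" "r \<in> {ra, rb, rc, rd}" "s \<in> {ra, rb, rc, rd}"
      "r' \<in> {rA, rB, rC, rD}" "s' \<in> {rA, rB, rC, rD}" "r \<noteq> s" "r' \<noteq> s'"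
      "v \<in> N p" "v \<in> N r" "v \<in> N s" "v \<in> N r'" "v \<in> N s'" for v p r s r' s'
  proof -
    have "distinct [p, r, s, r', s']"
      using that rne[of r r'] rne[of r s'] rne[of s r'] rne[of s s'] pne[of p r r'] pne[of p s s'] by simp
    moreover have "set [p, r, s, r', s'] \<subseteq> N v" using that symN by simp
    ultimately have "N v = set [p, r, s, r', s']" using WV[OF that(1)] by (intro N_eq_five) auto
    then show ?thesis by simp
  qed
  have Nwab: "N wab = {pab, ra, rb, rC, rD}"
    by (rule five) (use M1 dinj Npab Nra Nrb NrC NrD in auto)
  have Nwac: "N wac = {pac, ra, rc, rB, rD}"
    by (rule five) (use M1 dinj Npac Nra Nrc NrB NrD in auto)
  have Nwad: "N wad = {pad, ra, rd, rB, rC}"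
    by (rule five) (use M1 dinj Npad Nra Nrd NrB NrC in auto)
  have Nwbc: "N wbc = {pbc, rb, rc, rA, rD}"
    by (rule five) (use M1 dinj Npbc Nrb Nrc NrA NrD in auto)
  have Nwbd: "N wbd = {pbd, rb, rd, rA, rC}"
    by (rule five) (use M1 dinj Npbd Nrb Nrd NrA NrC in auto)
  have Nwcd: "N wcd = {pcd, rc, rd, rA, rB}"
    by (rule five) (use M1 dinj Npcd Nrc Nrd NrA NrB in auto)
  note all_N = N Na Nb Nc Nd Ne N2 NA NB NC ND NE Npab Npac Npad Npbc Npbd Npcd
    Nra Nrb Nrc Nrd NrA NrB NrC NrD Nwab Nwac Nwad Nwbc Nwbd Nwcd
  define f where "f xs = (if xs ! 4 then vs1 else vs0) !
    (of_bool (xs ! 0) + 2 * of_bool (xs ! 1) + 4 * of_bool (xs ! 2) + 8 * of_bool (xs ! 3))"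
    for xs :: "bool list"
  have len: "length vs0 = 16" "length vs1 = 16" unfolding vs0_def vs1_def by auto
  have len5: "\<exists>t1 t2 t3 t4 t5. xs = [t1, t2, t3, t4, t5]" if "length xs = 5" for xs :: "bool list"
    using that by (auto simp: length_Suc_conv eval_nat_numeral)
  have img1: "f ` {xs. length xs = 5} \<subseteq> set (vs0 @ vs1)"
    unfolding f_def using len by (auto intro!: nth_mem simp: of_bool_def)
  have img2: "set (vs0 @ vs1) \<subseteq> f ` {xs. length xs = 5}"
  proof -
    have "vs0 @ vs1 = map f
     [[False, False, False, False, False], [True, False, False, False, False], [False, True,
      False, False, False], [True, True, False, False, False], [False, False, True, False,
      False], [True, False, True, False, False], [False, True, True, False, False], [True,
      True, True, False, False], [False, False, False, True, False], [True, False, False,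
      True, False], [False, True, False, True, False], [True, True, False, True, False],
      [False, False, True, True, False], [True, False, True, True, False], [False, True, True,
      True, False], [True, True, True, True, False], [False, False, False, False, True],
      [True, False, False, False, True], [False, True, False, False, True], [True, True,
      False, False, True], [False, False, True, False, True], [True, False, True, False,
      True], [False, True, True, False, True], [True, True, True, False, True], [False, False,
      False, True, True], [True, False, False, True, True], [False, True, False, True, True],
      [True, True, False, True, True], [False, False, True, True, True], [True, False, True,
      True, True], [False, True, True, True, True], [True, True, True, True, True]]"
      by (simp add: f_def vs0_def vs1_def)
    then show ?thesis by (simp only:) auto
  qed
  have img: "f ` {xs. length xs = 5} = set (vs0 @ vs1)" using img1 img2 by blast
  have "card {xs :: bool list. length xs = 5} = 32"
    using card_lists_length_eq[of "UNIV :: bool set" 5] by (simp add: card_UNIV_bool)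
  then have inj: "inj_on f {xs. length xs = 5}"
    using img set_vs card_S by (intro eq_card_imp_inj_on) (auto intro: card_ge_0_finite)
  have nbrs: "N (f xs) = (\<lambda>i. f (xs[i := \<not> xs ! i])) ` {..<5}" if len: "length xs = 5" for xs
  proof -
    obtain t1 t2 t3 t4 t5 where xs: "xs = [t1, t2, t3, t4, t5]" using len5[OF len] by blast
    have five_set: "{..<5::nat} = {0, 1, 2, 3, 4}" by auto
    have "(\<lambda>i. f (xs[i := \<not> xs ! i])) ` {..<5} = {f [\<not> t1, t2, t3, t4, t5], f [t1, \<not> t2, t3, t4, t5],
        f [t1, t2, \<not> t3, t4, t5], f [t1, t2, t3, \<not> t4, t5], f [t1, t2, t3, t4, \<not> t5]}"
      unfolding xs five_set by (simp add: eval_nat_numeral)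
    moreover have "N (f [t1, t2, t3, t4, t5]) = {f [\<not> t1, t2, t3, t4, t5], f [t1, \<not> t2, t3, t4, t5],
        f [t1, t2, \<not> t3, t4, t5], f [t1, t2, t3, \<not> t4, t5], f [t1, t2, t3, t4, \<not> t5]}"
      by (cases t1; cases t2; cases t3; cases t4; cases t5;
          simp add: f_def vs0_def vs1_def all_N insert_commute)
    ultimately show ?thesis unfolding xs by simp
  qed
  have "set (vs0 @ vs1) = V"
  proof (rule conn)
    show "set (vs0 @ vs1) \<subseteq> V" unfolding set_vs by (rule SV)
    fix v assume "v \<in> set (vs0 @ vs1)"
    then obtain xs where "v = f xs" "length xs = 5" unfolding img[symmetric] by auto
    then show "N v \<subseteq> set (vs0 @ vs1)" using nbrs unfolding img[symmetric] by auto
  qed (simp add: vs0_def)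
  with that[of f] inj img nbrs show thesis by simp
qed

end

section \<open>The classification\<close>

context triangle_free_nbhd
begin

text \<open>\<open>D2 u\<close> lies in \<open>U\<close> and has \<open>2 * k\<close> of its
  \<open>2 * k + 2\<close> elements, so apart from \<open>u\<close> exactly one vertex of
  \<open>U\<close> shares no neighbour with \<open>u\<close>. The groups are these pairs; they are
  well defined because \<open>D2\<close> is symmetric.\<close>

lemma GDD_of_bipartite_halves:
  assumes V: "V = U \<union> X" "U \<inter> X = {}" and cU: "card U = 2 * k + 2"
    and UX: "\<And>u. u \<in> U \<Longrightarrow> N u \<subseteq> X" and XU: "\<And>v. v \<in> X \<Longrightarrow> N v \<subseteq> U"
    and D: "points D = U" "blocks D = X" "\<And>p b. incident D p b \<longleftrightarrow> b \<in> N p"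
  shows "\<exists>\<G>. GDD D \<G> 2 (k + 1) k 0 mu"
proof -
  have fin: "finite U" "finite X" using finV V(1) by auto
  define cl where "cl u = U - D2 u" for u
  have D2U: "D2 u \<subseteq> U" if u: "u \<in> U" for u
  proof
    fix z assume "z \<in> D2 u"
    then obtain p where "p \<in> N u" "p \<in> N z" unfolding D2_def by blast
    then show "z \<in> U" using UX[OF u] XU symN by blast
  qed
  have cl2: "card (cl u) = 2" and u_cl: "u \<in> cl u" if u: "u \<in> U" for u
  proof -
    have "card (D2 u) = 2 * k" using card_D2 u V(1) by blast
    then show "card (cl u) = 2"
      unfolding cl_def using D2U[OF u] cU by (subst card_Diff_subset) auto
    show "u \<in> cl u" unfolding cl_def using u by (simp add: D2_def)
  qed
  have cl_eq: "cl v = cl u" if u: "u \<in> U" and v: "v \<in> cl u" for u v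
  proof (cases "v = u")
    case False
    have vU: "v \<in> U" and "u \<in> cl v" using v u D2_sym unfolding cl_def by auto
    then have sub: "{u, v} \<subseteq> cl v" "{u, v} \<subseteq> cl u" using u_cl[OF u] u_cl[OF vU] v by auto
    have fcl: "finite (cl z)" for z unfolding cl_def using fin(1) by simp
    have "card {u, v} = 2" using False by simp
    then have "{u, v} = cl v" "{u, v} = cl u"
      using card_subset_eq[OF fcl sub(1)] card_subset_eq[OF fcl sub(2)] cl2[OF u] cl2[OF vU] by simp_all
    then show ?thesis by simp
  qed simp
  have disj: "cl u \<inter> cl v = {}" if "u \<in> U" "v \<in> U" "cl u \<noteq> cl v" for u v
    using cl_eq[OF that(1)] cl_eq[OF that(2)] that(3) by blast
  define \<G> where "\<G> = cl ` U"
  have part: "partition_on U \<G>"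
  proof (rule partition_onI)
    show "\<Union> \<G> = U" unfolding \<G>_def using u_cl by (auto simp: cl_def)
    show "disjnt p q" if "p \<in> \<G>" "q \<in> \<G>" "p \<noteq> q" for p q
      using that disj unfolding \<G>_def disjnt_def by blast
    show "{} \<notin> \<G>" using u_cl unfolding \<G>_def by blast
  qed
  have un: "\<Union> \<G> = U" using partition_onD1[OF part] by simp
  have "2 * card \<G> = card (\<Union> \<G>)"
  proof (rule card_partition)
    show "finite \<G>" unfolding \<G>_def using fin(1) by simp
    show "finite (\<Union> \<G>)" unfolding un by (rule fin(1))
    show "card c = 2" if "c \<in> \<G>" for c using that cl2 unfolding \<G>_def by (elim imageE) simp
    show "c \<inter> c' = {}" if "c \<in> \<G>" "c' \<in> \<G>" "c \<noteq> c'" for c c'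
      using that disj unfolding \<G>_def by (elim imageE) simp
  qed
  then have cG: "card \<G> = k + 1" unfolding un using cU by simp
  have on: "points_on D b = N b" if b: "b \<in> X" for b
    unfolding points_on_def D using XU[OF b] symN by blast
  have through: "blocks_through D p q = N p \<inter> N q" if "p \<in> U" "q \<in> U" for p q
  proof -
    have "blocks_through D p q = {b \<in> X. p \<in> N b \<and> q \<in> N b}"
      unfolding blocks_through_def D(2) using on by auto
    then show ?thesis using UX[OF that(1)] symN by blast
  qed
  have "GDD D \<G> 2 (k + 1) k 0 mu" unfolding GDD_def
  proof (intro conjI ballI impI)
    show "finite (points D)" "finite (blocks D)" using fin D by auto
    show "partition_on (points D) \<G>" using part D by simp
    show "card \<G> = k + 1" by (rule cG)
    show "card S = 2" if "S \<in> \<G>" for S using that cl2 unfolding \<G>_def by auto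
    show "card (points_on D b) = k" if "b \<in> blocks D" for b
      using that on deg V(1) unfolding D by auto
    show "card (blocks_through D p q) = 0" if h: "S \<in> \<G>" "p \<in> S" "q \<in> S" "p \<noteq> q" for S p q
    proof -
      obtain u where u: "u \<in> U" "S = cl u" using h(1) unfolding \<G>_def by blast
      then have "p \<in> U" "q \<in> U" using h(2,3) unfolding cl_def by auto
      moreover have "q \<in> cl p" using cl_eq[OF u(1), of p] h(2,3) u(2) by simp
      ultimately have "N p \<inter> N q = {}" using h(4) mem_D2I[of q p] unfolding cl_def by blast
      then show ?thesis using through \<open>p \<in> U\<close> \<open>q \<in> U\<close> by simp
    qed
    show "card (blocks_through D p q) = mu" if h: "S \<in> \<G>" "T \<in> \<G>" "S \<noteq> T" "p \<in> S" "q \<in> T" for S T p q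
    proof -
      obtain u v where u: "u \<in> U" "S = cl u" and v: "v \<in> U" "T = cl v"
        using h(1,2) unfolding \<G>_def by blast
      have pq: "p \<in> U" "q \<in> U" using h(4,5) u v unfolding cl_def by auto
      have "cl p = S" "cl q = T" using cl_eq[OF u(1), of p] cl_eq[OF v(1), of q] u v h by auto
      then have "q \<notin> cl p" using cl_eq[OF pq(1), of q] h(3) by auto
      then have "q \<in> D2 p" using pq unfolding cl_def by blast
      then show ?thesis using through[OF pq] card_common by simp
    qed
  qed
  then show ?thesis by blast
qed

lemma trichotomy:
  assumes d: "dist4 x y"
  obtains (cube) f where "mu = 2" "inj_on f {xs :: bool list. length xs = 5}"
      "f ` {xs. length xs = 5} = V"
      "\<And>xs. length xs = 5 \<Longrightarrow> N (f xs) = (\<lambda>i. f (xs[i := \<not> xs ! i])) ` {..<5}"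
  | (lambda) f where "inj_on f (UNIV \<times> {..<14})" "f ` (UNIV \<times> {..<14}) = V"
      "\<And>t i. i < 14 \<Longrightarrow> N (f (t, i)) = f ` insert (\<not> t, i) (Pair t ` set (lam_nbrs i))"
  | (design) U X where "V = U \<union> X" "U \<inter> X = {}" "card U = 2 * k + 2" "card X = 2 * k + 2"
      "\<And>u. u \<in> U \<Longrightarrow> N u \<subseteq> X" "\<And>v. v \<in> X \<Longrightarrow> N v \<subseteq> U"
proof (cases "\<forall>p\<in>P x y. card (N p \<inter> M x y) = 2 * mu")
  case True
  then show thesis using bipartite_halves[OF d] design by metis
next
  case False
  have far: "far x y" using dist4_far[OF d] .
  obtain p where p: "p \<in> P x y" "card (N p \<inter> M x y) \<noteq> 2 * mu" using False by blast
  then have mu: "mu = 2"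
    using M_degree_dichotomy(1,4)[OF far, of p] unfolding P_def by blast
  interpret valency5_nbhd V N k lam mu by unfold_locales (rule mu)
  have sub: "P x y \<subseteq> N x" unfolding P_def by blast
  have cN: "card (N x) = 5" using deg dist4_V[OF d] k5 by simp
  have "card (P x y) \<le> 5" using card_mono[OF finN sub] cN by simp
  then consider "card (P x y) = 4" | "card (P x y) = 5" using card_P_ge4[OF d] by linarith
  then show thesis
  proof cases
    case 1
    obtain a b c e g where "clab x y a b c e g" using clab_exists[OF d 1] by blast
    then show thesis by (rule clab_iso) (rule cube[OF mu])
  next
    case 2
    then have P: "P x y = N x" using sub cN by (intro card_subset_eq) auto
    have P': "P y x = N y" by (rule P_sym_full[OF d P])
    \<comment> \<open>If nothing were missing, all \<open>2 * mu\<close> further neighbours of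
      \<open>p\<close> would be in \<open>M x y\<close>, against the choice of
      \<open>p\<close>.\<close>
    have "D2 x - M x y \<noteq> {}"
    proof
      assume "D2 x - M x y = {}"
      then have "N p \<inter> M x y = N p \<inter> D2 x" unfolding M_def by blast
      moreover have "p \<in> N x" using p(1) sub by blast
      ultimately have "N p \<inter> M x y = N p - {x}" using nbr_D2 by simp
      then show False using p(2) deg[OF NV[OF \<open>p \<in> N x\<close>]] symN[OF \<open>p \<in> N x\<close>] k5 mu by simp
    qed
    then have "card (D2 x - M x y) \<noteq> 0" by simp
    then have c2: "card (D2 x - M x y) = 2"
      using card_missing_le_2[OF d P] not_one_missing[OF d P] by linarith
    then have c2': "card (D2 y - M y x) = 2"
      using card_missing[OF d] card_missing[OF dist4_sym[OF d]] M_sym[of x y] by simp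
    obtain a b c e g where l: "lab x y a b c e g" using lab_exists[OF d P c2] by blast
    obtain a' b' c' e' g' where l': "lab y x a' b' c' e' g'"
      using lab_exists[OF dist4_sym[OF d] P' c2'] by blast
    obtain A B C E where l2: "lab y x A B C E g'" "pt x a g = pt y A C" "pt x a c = pt y A g'"
      by (rule lab_aligned[OF l l'])
    show thesis by (rule lab_iso[OF l l2]) (rule lambda)
  qed
qed

end

section \<open>Cubes and the sizes of incidence graphs\<close>

lemma neighbors_cube:
  assumes "length xs = n"
  shows "neighbors (cube_graph n) xs = (\<lambda>i. xs[i := \<not> xs ! i]) ` {..<n}"
proof (intro equalityI subsetI)
  fix ys assume "ys \<in> neighbors (cube_graph n) xs"
  then have len: "length ys = n" and c: "card {i. i < n \<and> xs ! i \<noteq> ys ! i} = 1"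
    unfolding neighbors_def cube_graph_def by auto
  obtain i where i: "{i. i < n \<and> xs ! i \<noteq> ys ! i} = {i}" using c by (rule card_1_singletonE)
  have "ys = xs[i := \<not> xs ! i]"
  proof (rule nth_equalityI)
    fix j assume "j < length ys"
    then show "ys ! j = xs[i := \<not> xs ! i] ! j"
      using i len assms by (cases "j = i") auto
  qed (use len assms in simp)
  moreover have "i < n" using i by auto
  ultimately show "ys \<in> (\<lambda>i. xs[i := \<not> xs ! i]) ` {..<n}" by blast
next
  fix ys assume "ys \<in> (\<lambda>i. xs[i := \<not> xs ! i]) ` {..<n}"
  then obtain i where i: "i < n" "ys = xs[i := \<not> xs ! i]" by auto
  then have "{j. j < n \<and> xs ! j \<noteq> ys ! j} = {i}" using assms by (auto simp: nth_list_update)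
  then show "ys \<in> neighbors (cube_graph n) xs"
    using i assms unfolding neighbors_def cube_graph_def by simp
qed

lemma pverts_cube: "pverts (cube_graph n) = {xs. length xs = n}"
  by (simp add: cube_graph_def)

lemma card_cube: "card (pverts (cube_graph n)) = 2 ^ n"
  using card_lists_length_eq[of "UNIV :: bool set" n] by (simp add: pverts_cube card_UNIV_bool)

lemma pair_graph_cube: "pair_graph (cube_graph n)"
proof (rule pair_graphI)
  show "finite (pverts (cube_graph n))"
    using finite_lists_length_eq[of "UNIV :: bool set" n] by (simp add: pverts_cube)
  show "parcs (cube_graph n) \<subseteq> pverts (cube_graph n) \<times> pverts (cube_graph n)"
    unfolding cube_graph_def by auto
  show "sym (parcs (cube_graph n))"
  proof (rule symI)
    fix xs ys assume "(xs, ys) \<in> parcs (cube_graph n)"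
    moreover have "{i. i < n \<and> xs ! i \<noteq> ys ! i} = {i. i < n \<and> ys ! i \<noteq> xs ! i}" by auto
    ultimately show "(ys, xs) \<in> parcs (cube_graph n)" unfolding cube_graph_def by simp
  qed
  show "irrefl (parcs (cube_graph n))" unfolding cube_graph_def irrefl_def by auto
qed

lemma regular_cube: "regular_graph (cube_graph n) n"
  unfolding regular_graph_def
proof
  fix xs assume "xs \<in> pverts (cube_graph n)"
  then have len: "length xs = n" by (simp add: pverts_cube)
  have "inj_on (\<lambda>i. xs[i := \<not> xs ! i]) {..<n}"
  proof (rule inj_onI)
    fix i j assume ij: "i \<in> {..<n}" "j \<in> {..<n}" "xs[i := \<not> xs ! i] = xs[j := \<not> xs ! j]"
    then have "xs[i := \<not> xs ! i] ! i = xs[j := \<not> xs ! j] ! i" by simp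
    then show "i = j" using ij(1,2) len by (auto simp: nth_list_update split: if_splits)
  qed
  then show "card (neighbors (cube_graph n) xs) = n"
    unfolding neighbors_cube[OF len] by (simp add: card_image)
qed

lemma GDD_card_points:
  assumes "GDD D \<G> n m k l1 l2"
  shows "card (points D) = n * m" "finite (points D)" "finite (blocks D)"
proof -
  have fin: "finite (points D)" and p: "partition_on (points D) \<G>" and m: "card \<G> = m"
    and n: "\<And>S. S \<in> \<G> \<Longrightarrow> card S = n"
    using assms unfolding GDD_def by auto
  have "finite \<G>" using finite_elements[OF fin p] .
  then have "n * card \<G> = card (\<Union> \<G>)"
    by (rule card_partition) (use p fin n in \<open>auto simp: partition_on_def disjoint_def\<close>)
  then show "card (points D) = n * m" using p m by (simp add: partition_on_def)
  show "finite (points D)" "finite (blocks D)" using assms unfolding GDD_def by auto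
qed

lemma GDDDP_incidence:
  assumes "GDDDP D \<G> n m k l1 l2"
  shows "pair_graph (incidence_graph D)" "card (pverts (incidence_graph D)) = 2 * n * m"
proof -
  obtain \<G>' where g: "GDD D \<G> n m k l1 l2" "GDD (dual_structure D) \<G>' n m k l1 l2"
    using assms unfolding GDDDP_def by blast
  note p = GDD_card_points[OF g(1)] and b = GDD_card_points[OF g(2)]
  have "card (blocks D) = n * m" using b(1) by (simp add: dual_structure_def)
  then show "card (pverts (incidence_graph D)) = 2 * n * m"
    using p by (simp add: incidence_graph_def card_Plus)
  show "pair_graph (incidence_graph D)" using pair_graph_incidence p by blast
qed

lemma regular_graph_unique:
  assumes "regular_graph G k" "regular_graph G l" "pverts G \<noteq> {}"
  shows "k = l"
  using assms by (metis ex_in_conv regular_graph_def)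

section \<open>From the hypotheses on the graph to a pair at distance four\<close>

lemma far_pair:
  assumes G: "pair_graph G" and con: "connected_graph G" and diam: "enat 4 \<le> graph_diameter G"
  obtains x z where "x \<in> pverts G" "walk_le G 4 x z" "\<not> walk_le G 3 x z"
proof -
  note wf = pair_graphD(2)[OF G]
  have "\<exists>x\<in>pverts G. \<exists>y\<in>pverts G. \<not> walk_le G 3 x y"
  proof (rule ccontr)
    assume n: "\<not> ?thesis"
    have "graph_distance G x y \<le> enat 3" if "x \<in> pverts G" "y \<in> pverts G" for x y
      using n distance_le_iff[OF wf that(1)] that by blast
    then have "graph_diameter G \<le> enat 3"
      unfolding graph_diameter_def by (intro SUP_least) auto
    then have "enat 4 \<le> enat 3" using diam order_trans by blast
    then show False by simp
  qed
  then obtain x y where xy: "x \<in> pverts G" "y \<in> pverts G" "\<not> walk_le G 3 x y" by blast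
  let ?S = "{z \<in> pverts G. walk_le G 3 x z}"
  \<comment> \<open>The diameter may exceed four, so \<open>y\<close> itself may be too far away. If
    no vertex were at distance exactly four from \<open>x\<close>, the ball of radius three would be
    closed under neighbours and contain \<open>y\<close>.\<close>
  have "\<exists>z. walk_le G (Suc 3) x z \<and> \<not> walk_le G 3 x z"
  proof (rule ccontr)
    assume n: "\<not> ?thesis"
    have "?S = pverts G"
    proof (rule connected_closure[OF G con])
      have "x \<in> ?S" using xy(1) walk_le_refl[of G 3 x] by simp
      then show "?S \<noteq> {}" by blast
      fix s assume s: "s \<in> ?S"
      show "neighbors G s \<subseteq> ?S"
      proof
        fix z assume z: "z \<in> neighbors G s"
        have "walk_le G (Suc 3) x z" using walk_le_step[of G 3 x s, OF _ z] s by blast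
        then have "walk_le G 3 x z" using n by blast
        then show "z \<in> ?S" using pair_graphD(3)[OF G z] by simp
      qed
    qed simp
    then have "y \<in> ?S" using xy(2) by simp
    then show False using xy(3) by simp
  qed
  then obtain z where "walk_le G (Suc 3) x z" "\<not> walk_le G 3 x z" by blast
  then show thesis using that[of x z] xy(1) by simp
qed

lemma amply_regular_nbhdI:
  assumes ar: "amply_regular G v k lam mu" and k: "k = 2 * mu + 1" "2 \<le> mu"
  shows "amply_regular_nbhd (pverts G) (neighbors G) k lam mu"
proof -
  have pg: "pair_graph G" using ar unfolding amply_regular_def by blast
  note pgD = pair_graphD[OF pg]
  show ?thesis
  proof
    fix x y
    show "card (neighbors G x \<inter> neighbors G y) = lam" if y: "y \<in> neighbors G x"
    proof -
      have "(x, y) \<in> parcs G" using y unfolding neighbors_def by simp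
      then show ?thesis using ar pgD(3,4)[OF y] unfolding amply_regular_def by blast
    qed
    show "card (neighbors G x \<inter> neighbors G y) = mu"
      if n: "x \<noteq> y" "y \<notin> neighbors G x" "neighbors G x \<inter> neighbors G y \<noteq> {}"
    proof -
      obtain z where z: "z \<in> neighbors G x" "z \<in> neighbors G y" using n(3) by blast
      then have V: "x \<in> pverts G" "y \<in> pverts G" using pgD(4) by blast+
      have "y \<in> neighbors G z" using z(2) pgD(5) by blast
      then have "graph_distance G x y = 2"
        using distance_eq_2_iff[OF pgD(2) V(1)] n z(1) by blast
      then show ?thesis using ar V unfolding amply_regular_def by blast
    qed
    show "card (neighbors G x) = k" if "x \<in> pverts G"
      using ar that unfolding amply_regular_def regular_graph_def by blast
  qed (use pgD k in blast)+
qed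

text \<open>The middle vertex \<open>b\<close> of a walk of four steps lies in \<open>M x z\<close>;
  any shortcut would shorten the walk to at most three steps.\<close>

lemma dist4_of_walk:
  assumes loc: "amply_regular_nbhd (pverts G) (neighbors G) k lam mu"
    and w4: "walk_le G 4 x z" and w3: "\<not> walk_le G 3 x z"
  shows "amply_regular_nbhd.dist4 (neighbors G) x z"
proof -
  interpret amply_regular_nbhd "pverts G" "neighbors G" k lam mu by (rule loc)
  let ?N = "neighbors G"
  have n3: "\<not> walk_le G (Suc (Suc (Suc 0))) x z" using w3 by (simp add: eval_nat_numeral)
  have "walk_le G (Suc (Suc (Suc (Suc 0)))) x z" using w4 by (simp add: eval_nat_numeral)
  then obtain u where u: "walk_le G (Suc (Suc (Suc 0))) x u" "z \<in> ?N u"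
    using n3 walk_le_SucE walk_le_refl by metis
  have n2: "\<not> walk_le G (Suc (Suc 0)) x u" using u(2) n3 walk_le_step by metis
  then obtain b where b: "walk_le G (Suc (Suc 0)) x b" "u \<in> ?N b"
    using u(1) walk_le_SucE walk_le_refl by metis
  have n1: "\<not> walk_le G (Suc 0) x b" using b(2) n2 walk_le_step by metis
  then obtain a where a: "walk_le G (Suc 0) x a" "b \<in> ?N a"
    using b(1) walk_le_SucE walk_le_refl by metis
  have "\<not> walk_le G 0 x a" using a(2) n1 walk_le_step by metis
  then have ax: "a \<in> ?N x" using a(1) by (auto simp: walk_le_Suc walk_le_0)
  have bx: "b \<noteq> x" "b \<notin> ?N x" using n1 by (auto simp: walk_le_Suc walk_le_0)
  have bz: "b \<noteq> z" "b \<notin> ?N z"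
    using b(1) n3 walk_le_mono[OF b(1), of "Suc (Suc (Suc 0))"] walk_le_step[OF b(1)] symN by auto
  have "b \<in> D2 x" unfolding D2_def using bx ax a(2) symN by blast
  moreover have "b \<in> D2 z" unfolding D2_def using bz u(2) b(2) symN by blast
  moreover have "far x z" unfolding far_def
  proof (intro conjI ballI)
    have far: "x \<noteq> z \<and> z \<notin> ?N x \<and> (\<forall>p\<in>?N x. z \<notin> ?N p) \<and> (\<forall>p\<in>?N x. \<forall>q\<in>?N p. z \<notin> ?N q)"
      using n3 by (auto simp: walk_le_Suc_front walk_le_0)
    then show "x \<noteq> z" "z \<notin> ?N x" "?N x \<inter> ?N z = {}" using symN by blast+
    show "?N p \<inter> ?N z = {}" if "p \<in> ?N x" for p using far that symN by blast
  qed
  ultimately show ?thesis unfolding dist4_def M_def by blast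
qed

lemma bipartite_iso_incidence:
  fixes G :: "'a pair_pre_digraph"
  assumes pg: "pair_graph G" and V: "pverts G = U \<union> X" "U \<inter> X = {}"
    and UX: "\<And>u. u \<in> U \<Longrightarrow> neighbors G u \<subseteq> X" and XU: "\<And>v. v \<in> X \<Longrightarrow> neighbors G v \<subseteq> U"
  shows "graph_iso G (incidence_graph
    \<lparr> points = U, blocks = X, incident = (\<lambda>p b. b \<in> neighbors G p) \<rparr>)"
proof -
  let ?D = "\<lparr> points = U, blocks = X, incident = (\<lambda>p b. b \<in> neighbors G p) \<rparr>"
  define f where "f u = (if u \<in> U then Inl u else Inr u :: 'a + 'a)" for u
  have XnU: "b \<notin> U" if "b \<in> X" for b using V(2) that by blast
  have "finite U" "finite X" using pair_graphD(1)[OF pg] V(1) by auto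
  then have pgD: "pair_graph (incidence_graph ?D)" by (intro pair_graph_incidence) auto
  show ?thesis
  proof (rule graph_isoI(2)[OF pair_graphD(2)[OF pgD] pair_graphD(2)[OF pg], of f])
    show "bij_betw f (pverts G) (pverts (incidence_graph ?D))"
      unfolding bij_betw_def
    proof
      show "inj_on f (pverts G)" unfolding f_def inj_on_def by (auto split: if_splits)
      show "f ` pverts G = pverts (incidence_graph ?D)"
        unfolding V(1) f_def incidence_graph_def using XnU by (auto simp: Plus_def image_iff)
    qed
    fix u assume u: "u \<in> pverts G"
    show "neighbors (incidence_graph ?D) (f u) = f ` neighbors G u"
    proof (cases "u \<in> U")
      case True
      have "f ` neighbors G u = Inr ` neighbors G u"
        unfolding f_def using UX[OF True] XnU by (intro image_cong) auto
      moreover have "{b \<in> blocks ?D. incident ?D u b} = neighbors G u" using UX[OF True] by auto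
      ultimately show ?thesis using True unfolding f_def by (simp add: neighbors_incidence)
    next
      case False
      then have uX: "u \<in> X" using u V(1) by blast
      have "f ` neighbors G u = Inl ` neighbors G u"
        unfolding f_def using XU[OF uX] by (intro image_cong) auto
      moreover have "points_on ?D u = neighbors G u"
        unfolding points_on_def using XU[OF uX] pair_graphD(5)[OF pg] by auto
      ultimately show ?thesis using False uX unfolding f_def by (simp add: neighbors_incidence)
    qed
  qed
qed

theorem theorem1p2:
  fixes \<Gamma> :: "'a pair_pre_digraph"
    and v k lam mu d :: nat
  assumes "k \<ge> 5" and "odd k"
    and "amply_regular \<Gamma> v k lam mu"
    and "connected_graph \<Gamma>"
    and "graph_diameter \<Gamma> = enat d" and "d \<ge> 4"
    and "mu = (k - 1) div 2"
  shows "\<exists>\<Lambda> :: nat pair_pre_digraph.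
    \<comment> \<open>\<open>\<Lambda>\<close> is the unique bipartite (0,2)-graph with 14 vertices and valency 4\<close>
    (bipartite_graph \<Lambda> \<and> zero_two_graph \<Lambda> \<and> card (pverts \<Lambda>) = 14 \<and> regular_graph \<Lambda> 4) \<and>
    (\<forall>\<Lambda>' :: 'l pair_pre_digraph.
       bipartite_graph \<Lambda>' \<and> zero_two_graph \<Lambda>' \<and> card (pverts \<Lambda>') = 14 \<and> regular_graph \<Lambda>' 4
       \<longrightarrow> graph_iso \<Lambda>' \<Lambda>) \<and>
    \<comment> \<open>\<open>\<Lambda>\<close> is the incidence graph of the square 2-(7,4,2) design\<close>
    (\<exists>D :: (nat, nat) incidence_structure. square_2_design D 7 4 2) \<and>
    (\<forall>D :: ('p, 'b) incidence_structure.
       square_2_design D 7 4 2 \<longrightarrow> graph_iso \<Lambda> (incidence_graph D)) \<and>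
    graph_diameter (cartesian_graph_product K2_graph \<Lambda>) = 4 \<and>
    amply_regular (cartesian_graph_product K2_graph \<Lambda>) 28 5 0 2 \<and>
    exactly_one_of_three
      (graph_iso \<Gamma> (cube_graph 5))
      (graph_iso \<Gamma> (cartesian_graph_product K2_graph \<Lambda>))
      \<comment> \<open>a structure with this incidence graph can be relabelled by the vertices of \<open>\<Gamma>\<close>\<close>
      (\<exists>(D :: ('a, 'a) incidence_structure) \<G>.
         GDDDP D \<G> 2 (k + 1) k 0 ((k - 1) div 2) \<and> graph_iso \<Gamma> (incidence_graph D))"
proof -
  let ?A = "graph_iso \<Gamma> (cube_graph 5)"
  let ?B = "graph_iso \<Gamma> KLam"
  let ?C = "\<exists>(D :: ('a, 'a) incidence_structure) \<G>.
         GDDDP D \<G> 2 (k + 1) k 0 ((k - 1) div 2) \<and> graph_iso \<Gamma> (incidence_graph D)"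
  let ?V = "pverts \<Gamma>" and ?N = "neighbors \<Gamma>"
  have pg: "pair_graph \<Gamma>" and reg: "regular_graph \<Gamma> k" using assms(3) unfolding amply_regular_def by auto
  note pgD = pair_graphD[OF pg]
  have k_eq: "k = 2 * mu + 1" and mu2: "2 \<le> mu" using assms(1,2,7) by (auto elim!: oddE)
  interpret amply_regular_nbhd ?V ?N k lam mu
    by (rule amply_regular_nbhdI[OF assms(3) k_eq mu2])
  obtain x z where xz: "x \<in> ?V" "walk_le \<Gamma> 4 x z" "\<not> walk_le \<Gamma> 3 x z"
    by (rule far_pair[OF pg assms(4)]) (use assms(5,6) in auto)
  have d4: "dist4 x z" by (rule dist4_of_walk[OF amply_regular_nbhd_axioms xz(2,3)])
  interpret triangle_free_nbhd ?V ?N k lam mu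
  proof
    show "lam = 0" by (rule lam_zero[OF d4])
    show "S = ?V" if "S \<noteq> {}" "S \<subseteq> ?V" "\<And>s. s \<in> S \<Longrightarrow> ?N s \<subseteq> S" for S
      by (rule connected_closure[OF pg assms(4) that])
  qed
  have one: "?A \<or> ?B \<or> ?C"
  proof (rule trichotomy[OF d4])
    fix f :: "bool list \<Rightarrow> 'a"
    assume f: "inj_on f {xs. length xs = 5}" "f ` {xs. length xs = 5} = ?V"
      "\<And>xs. length xs = 5 \<Longrightarrow> ?N (f xs) = (\<lambda>i. f (xs[i := \<not> xs ! i])) ` {..<5}"
    have "graph_iso \<Gamma> (cube_graph 5)"
      by (rule graph_isoI(1)[OF pgD(2) pair_graphD(2)[OF pair_graph_cube], of f])
        (use f in \<open>auto simp: bij_betw_def pverts_cube neighbors_cube image_image\<close>)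
    then show ?thesis by simp
  next
    fix f :: "bool \<times> nat \<Rightarrow> 'a"
    assume f: "inj_on f (UNIV \<times> {..<14})" "f ` (UNIV \<times> {..<14}) = ?V"
      "\<And>t i. i < 14 \<Longrightarrow> ?N (f (t, i)) = f ` insert (\<not> t, i) (Pair t ` set (lam_nbrs i))"
    have "graph_iso \<Gamma> KLam"
    proof (rule graph_isoI(1)[OF pgD(2) pair_graphD(2)[OF pair_graph_KLam], of f])
      show "bij_betw f (pverts KLam) ?V" using f(1,2) by (simp add: bij_betw_def pverts_KLam)
      fix u assume "u \<in> pverts KLam"
      then obtain t i where u: "u = (t, i)" "i < 14" by (auto simp: pverts_KLam)
      show "?N (f u) = f ` neighbors KLam u"
        unfolding u(1) f(3)[OF u(2)] neighbors_KLam[OF u(2)] ..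
    qed
    then show ?thesis by simp
  next
    fix U X assume UX: "?V = U \<union> X" "U \<inter> X = {}" "card U = 2 * k + 2" "card X = 2 * k + 2"
      "\<And>u. u \<in> U \<Longrightarrow> ?N u \<subseteq> X" "\<And>v. v \<in> X \<Longrightarrow> ?N v \<subseteq> U"
    define D where "D = \<lparr> points = U, blocks = X, incident = (\<lambda>p b. b \<in> ?N p) \<rparr>"
    obtain \<G> where G: "GDD D \<G> 2 (k + 1) k 0 mu"
      using GDD_of_bipartite_halves[OF UX(1-3,5,6), of D] unfolding D_def by auto
    \<comment> \<open>Both halves have the same size and the same closure property, so the dual is
      handled by exchanging them.\<close>
    have "\<exists>\<G>'. GDD (dual_structure D) \<G>' 2 (k + 1) k 0 mu"
    proof (rule GDD_of_bipartite_halves[of X U])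
      show "incident (dual_structure D) p b \<longleftrightarrow> b \<in> ?N p" for p b
        unfolding D_def dual_structure_def by (simp, rule symN_iff)
    qed (use UX in \<open>auto simp: D_def dual_structure_def\<close>)
    then obtain \<G>' where G': "GDD (dual_structure D) \<G>' 2 (k + 1) k 0 mu" by blast
    have des: "GDDDP D \<G> 2 (k + 1) k 0 ((k - 1) div 2)"
      unfolding GDDDP_def using G G' assms(7) by blast
    moreover have "graph_iso \<Gamma> (incidence_graph D)"
      unfolding D_def by (rule bipartite_iso_incidence[OF pg UX(1,2,5,6)])
    ultimately show ?thesis by blast
  qed
  have A: "card ?V = 32 \<and> k = 5" if ?A
  proof -
    note wf = pgD(2) pair_graphD(2)[OF pair_graph_cube[of 5]]
    have "regular_graph (cube_graph 5) k" by (rule graph_iso_regular[OF wf that reg])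
    moreover have "pverts (cube_graph 5) \<noteq> {}" using card_cube[of 5] by auto
    ultimately show ?thesis
      using regular_graph_unique regular_cube graph_iso_card[OF wf that] card_cube[of 5] by fastforce
  qed
  have B: "card ?V = 28 \<and> k = 5" if ?B
  proof -
    note wf = pgD(2) pair_graphD(2)[OF pair_graph_KLam]
    have "regular_graph KLam k" by (rule graph_iso_regular[OF wf that reg])
    moreover have "pverts KLam \<noteq> {}" by (simp add: pverts_KLam lessThan_empty_iff)
    ultimately have "k = 5" using regular_graph_unique regular_KLam by blast
    moreover have "card (pverts KLam) = 28"
      using amply_regular_KLam unfolding amply_regular_def by blast
    ultimately show ?thesis using graph_iso_card[OF wf that] by simp
  qed
  have C: "card ?V = 4 * (k + 1)" if c: ?C
  proof -
    obtain D :: "('a, 'a) incidence_structure" and \<G> where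
      D: "GDDDP D \<G> 2 (k + 1) k 0 ((k - 1) div 2)" "graph_iso \<Gamma> (incidence_graph D)"
      using c by blast
    show ?thesis
      using graph_iso_card[OF pgD(2) pair_graphD(2)[OF GDDDP_incidence(1)[OF D(1)]] D(2)]
        GDDDP_incidence(2)[OF D(1)] by simp
  qed
  \<comment> \<open>For \<open>k = 5\<close> the three alternatives have 32, 28 and 24
    vertices.\<close>
  have "\<not> (?A \<and> ?B)" using A B by auto
  moreover have "\<not> (?A \<and> ?C)"
  proof
    assume h: "?A \<and> ?C"
    show False using A[OF conjunct1[OF h]] C[OF conjunct2[OF h]] by auto
  qed
  moreover have "\<not> (?B \<and> ?C)"
  proof
    assume h: "?B \<and> ?C"
    show False using B[OF conjunct1[OF h]] C[OF conjunct2[OF h]] by auto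
  qed
  ultimately have "exactly_one_of_three ?A ?B ?C"
    unfolding exactly_one_of_three_def using one by blast
  note last = this diameter_KLam amply_regular_KLam
  show ?thesis
  proof (intro exI[of _ Lam] conjI allI impI)
    show "card (pverts Lam) = 14" by simp
    show "graph_iso G Lam"
      if "bipartite_graph G \<and> zero_two_graph G \<and> card (pverts G) = 14 \<and> regular_graph G 4"
      for G :: "'l pair_pre_digraph"
      using that Lam_unique by blast
    show "graph_iso Lam (incidence_graph D)" if "square_2_design D 7 4 2"
      for D :: "('p, 'b) incidence_structure"
      using that by (rule Lam_iso_design)
  qed (use bipartite_Lam zero_two_Lam regular_Lam ex_design last[unfolded KLam_def] in blast)+
qed

end
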